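(* Let $\mathbf{b}=(b_1,\dots,b_K)$ be an ordered $K$-partition of $N$ (i.e. $b_i\in\mathbb{Z}_{\ge0}$, $\sum_i b_i=N$) and let $(\mathcal{E}_{\mathbf b},\varphi_{\mathbf b})$ be the associated filtered Higgs bundle, with harmonic metric $h$. Then the regulated $L^2$ norm $$\mu([(\mathcal{E}_{\mathbf b},\varphi_{\mathbf b})])=\frac{\mathrm{i}}{\pi}\int_{\mathbb{C}}\operatorname{Tr}\left(\varphi_{\mathbf b}\wedge\varphi_{\mathbf b}^{\dagger_h}-\mathrm{Id}\,|z|^{2N/K}\,dz\wedge d\bar z\right)$$ is given by $$\mu([(\mathcal{E}_{\mathbf b},\varphi_{\mathbf b})])=\frac{K}{K+N}\,\|B\mathbf b\|^2,$$ where $B$ is the $K\times K$ matrix with entries $$B_{ij}=\frac{1}{2K}\Bigl(-(K-1)+2\bigl((j-i)\bmod K\bigr)\Bigr),$$ with $(j-i)\bmod K\in\{0,1,\dots,K-1\}$, and $\|\cdot\|$ is the Euclidean norm.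
   Context: $K\ge 2$ and $N\ge 1$ are coprime integers; $z$ is the standard coordinate on $\mathbb{C}\subset\mathbb{CP}^1$. A filtered rank $K$ bundle on $(\mathbb{CP}^1,\{\infty\})$ is a locally free $\mathcal{O}_{\mathbb{CP}^1}( *\{\infty\})$-module $\mathcal{E}$ of rank $K$ (where $\mathcal{O}_{\mathbb{CP}^1}( *\{\infty\})$ is the sheaf of meromorphic functions with poles only at $\infty$) with an increasing filtration by locally free $\mathcal{O}_{\mathbb{CP}^1}$-submodules $\mathcal{P}_\alpha\mathcal{E}$, $\alpha\in\mathbb{R}$, such that $\mathcal{P}_\alpha\mathcal{E}|_{\mathbb{C}}=\mathcal{E}|_{\mathbb{C}}$, $\mathcal{P}_\alpha\mathcal{E}=\bigcap_{\beta>\alpha}\mathcal{P}_\beta\mathcal{E}$, and near $\infty$, with $x=1/z$, $\mathcal{P}_{\alpha-1}\mathcal{E}=x\,\mathcal{P}_\alpha\mathcal{E}$. For a section $s$ near $\infty$, $\nu_\infty(s)=\inf\{\alpha: s\in\mathcal{P}_\alpha\mathcal{E}\}$. For $\alpha\in\mathbb{R}$, $\mathcal{O}(\alpha)$ is the filtered line bundle with underlying module $\mathcal{O}_{\mathbb{CP}^1}( *\{\infty\})$ and filtration by pole order at $\infty$ shifted by $-\alpha$; its canonical section $e$ (the element $1$) trivializes it on $\mathbb{C}$ and has $\nu_\infty(e)=-\alpha$. Direct sums carry $\mathcal{P}_\alpha(\mathcal{E}\oplus\mathcal{E}')=\mathcal{P}_\alpha\mathcal{E}\oplus\mathcal{P}_\alpha\mathcal{E}'$.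 The Higgs bundle $(\mathcal{E}_{\mathbf b},\varphi_{\mathbf b})$: let $\alpha_1,\dots,\alpha_K$ be determined by $b_i-\frac NK=\alpha_i-\alpha_{i+1}$ (indices mod $K$) and $\sum_i\alpha_i=0$. Put $\mathcal{E}_{\mathbf b}=\bigoplus_{i=1}^K\mathcal{O}(\alpha_i)$ with canonical sections $e_i$, and $\varphi_{\mathbf b}(e_{i+1})=z^{b_i}\,e_i\,dz$ (indices mod $K$). A Hermitian metric $h$ on $\mathcal{E}|_{\mathbb{C}}$ is adapted to the filtration if near $\infty$, $\mathcal{P}_\alpha\mathcal{E}=\{s:\|s\|_h=O(|x|^{-(\alpha+\epsilon)})\text{ for all }\epsilon>0\}$ for all $\alpha\in\mathbb{R}$. A harmonic metric on $(\mathcal{E},\varphi)$ is an adapted Hermitian metric with $F_{D(\mathcal{E},h)}+[\varphi,\varphi^{\dagger_h}]=0$ on $\mathbb{C}$, where $D(\mathcal{E},h)$ is the Chern connection, $\varphi^{\dagger_h}$ is the $h$-adjoint and $[\varphi,\varphi^{\dagger_h}]=\varphi\wedge\varphi^{\dagger_h}+\varphi^{\dagger_h}\wedge\varphi$. It is known that $(\mathcal{E}_{\mathbf b},\varphi_{\mathbf b})$ has a harmonic metric, unique up to a positive scalar (and $\mu$ does not depend on the scalar). *)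

theory Defs
  imports
    "HOL-Analysis.Analysis"
    "HOL-Library.Landau_Symbols"
    "Jordan_Normal_Form.Matrix"
begin

unbundle no vec_syntax

text \<open>
  Conventions. Every locally free module of rank \<open>K\<close> considered here is the free
  \<open>O(*\<infinity>)\<close>-module on canonical sections \<open>e\<^sub>1, \<dots>, e\<^sub>K\<close>, so a section is written as its coordinate
  function with values in \<^typ>\<open>complex vec\<close>. In the code indices run over \<open>0, \<dots>, K - 1\<close>:
  \<open>e\<^sub>i\<close>, \<open>b\<^sub>i\<close>, \<open>\<alpha>\<^sub>i\<close> are the objects with index \<open>i - 1\<close>.
  Forms on \<open>\<complex>\<close> are given by their coefficients: \<open>(1,0)\<close>-forms with respect to \<open>dz\<close>, \<open>(0,1)\<close>-forms
  with respect to \<open>dzbar\<close> (the differential of the conjugate of \<open>z\<close>), and 2-forms with respect to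
  \<open>dz \<and> dzbar\<close>.
\<close>


section \<open>Filtered bundles with pole at infinity\<close>

text \<open>
  The germ of \<open>f\<close> at \<open>\<infinity>\<close> is meromorphic with pole order at most \<open>n\<close>; here \<open>x = 1/z\<close>, and \<open>n\<close> may
  be negative.
\<close>

definition pole_order_le :: "(complex \<Rightarrow> complex) \<Rightarrow> int \<Rightarrow> bool" where
  "pole_order_le f n \<longleftrightarrow>
     (\<exists>g. g analytic_on {0} \<and> (\<forall>\<^sub>F x in at 0. f (inverse x) = x powi (- n) * g x))"

text \<open>Sections near \<open>\<infinity>\<close> of the free \<open>O(*\<infinity>)\<close>-module of rank \<open>K\<close>, not identified as germs.\<close>

definition mero_sections :: "nat \<Rightarrow> (complex \<Rightarrow> complex vec) set" where
  "mero_sections K = {s. (\<forall>\<^sub>F z in at_infinity. s z \<in> carrier_vec K) \<and>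
                         (\<forall>i<K. \<exists>n. pole_order_le (\<lambda>z. s z $ i) n)}"

text \<open>
  The \<open>\<beta>\<close>-th step of the filtration of the line bundle \<open>O(\<alpha>)\<close> near \<open>\<infinity>\<close>: pole order minus \<open>\<alpha>\<close> is at
  most \<open>\<beta>\<close>. In particular the canonical section \<open>1\<close> has order \<open>-\<alpha>\<close>.
\<close>

definition O_filt :: "real \<Rightarrow> real \<Rightarrow> (complex \<Rightarrow> complex) set" where
  "O_filt \<alpha> \<beta> = {f. \<exists>n::int. pole_order_le f n \<and> of_int n - \<alpha> \<le> \<beta>}"

definition direct_sum_filt :: "nat \<Rightarrow> (nat \<Rightarrow> real) \<Rightarrow> real \<Rightarrow> (complex \<Rightarrow> complex vec) set" where
  "direct_sum_filt K \<alpha> \<beta> = {s \<in> mero_sections K. \<forall>i<K. (\<lambda>z. s z $ i) \<in> O_filt (\<alpha> i) \<beta>}"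

text \<open>
  A Higgs bundle with filtration at \<open>\<infinity>\<close> on the free module: its rank, the sections near \<open>\<infinity>\<close> of each
  step of the filtration, and the matrix of the Higgs field in the frame \<open>e\<close> (coefficient of \<open>dz\<close>).
\<close>

record filtered_higgs =
  fh_rank :: nat
  fh_filt :: "real \<Rightarrow> (complex \<Rightarrow> complex vec) set"
  fh_higgs :: "complex \<Rightarrow> complex mat"

text \<open>The column with index \<open>i + 1 mod K\<close> of the Higgs field has the single entry \<open>z ^ b i\<close>, in row \<open>i\<close>.\<close>

definition higgs_bundle :: "nat \<Rightarrow> (nat \<Rightarrow> nat) \<Rightarrow> (nat \<Rightarrow> real) \<Rightarrow> filtered_higgs" where
  "higgs_bundle K b \<alpha> =
     \<lparr> fh_rank = K,
       fh_filt = direct_sum_filt K \<alpha>,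
       fh_higgs = (\<lambda>z. mat K K (\<lambda>(i, j). if j = (i + 1) mod K then z ^ b i else 0)) \<rparr>"

definition ordered_partition :: "nat \<Rightarrow> nat \<Rightarrow> (nat \<Rightarrow> nat) \<Rightarrow> bool" where
  "ordered_partition K N b \<longleftrightarrow> (\<Sum>i<K. b i) = N"

definition filtration_weights :: "nat \<Rightarrow> nat \<Rightarrow> (nat \<Rightarrow> nat) \<Rightarrow> (nat \<Rightarrow> real) \<Rightarrow> bool" where
  "filtration_weights K N b \<alpha> \<longleftrightarrow>
     (\<forall>i<K. real (b i) - real N / real K = \<alpha> i - \<alpha> ((i + 1) mod K)) \<and> (\<Sum>i<K. \<alpha> i) = 0"


section \<open>Hermitian metrics\<close>

text \<open>Wirtinger derivatives; meaningful where \<open>f\<close> is differentiable in the real sense.\<close>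

definition d_z :: "(complex \<Rightarrow> complex) \<Rightarrow> complex \<Rightarrow> complex" where
  "d_z f z = (frechet_derivative f (at z) 1 - \<i> * frechet_derivative f (at z) \<i>) / 2"

definition d_zbar :: "(complex \<Rightarrow> complex) \<Rightarrow> complex \<Rightarrow> complex" where
  "d_zbar f z = (frechet_derivative f (at z) 1 + \<i> * frechet_derivative f (at z) \<i>) / 2"

text \<open>\<open>k\<close>-fold continuous differentiability in the two real coordinates of the plane.\<close>

primrec Ck :: "nat \<Rightarrow> (complex \<Rightarrow> complex) \<Rightarrow> bool" where
  "Ck 0 f \<longleftrightarrow> continuous_on UNIV f"
| "Ck (Suc k) f \<longleftrightarrow> (\<forall>z. f differentiable at z) \<and>
     Ck k (\<lambda>z. frechet_derivative f (at z) 1) \<and> Ck k (\<lambda>z. frechet_derivative f (at z) \<i>)"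

text \<open>
  The sesquilinear form, linear in the first argument, for which \<open>H $$ (i, j)\<close> is the product of the
  frame vector with index \<open>j\<close> with the one with index \<open>i\<close>.
\<close>

definition herm :: "complex mat \<Rightarrow> complex vec \<Rightarrow> complex vec \<Rightarrow> complex" where
  "herm H v w = (H *\<^sub>v v) \<bullet>c w"

definition herm_norm :: "complex mat \<Rightarrow> complex vec \<Rightarrow> real" where
  "herm_norm H v = sqrt (Re (herm H v v))"

definition hermitian_inner_product :: "nat \<Rightarrow> complex mat \<Rightarrow> bool" where
  "hermitian_inner_product K H \<longleftrightarrow> H \<in> carrier_mat K K \<and>
     (\<forall>v\<in>carrier_vec K. \<forall>w\<in>carrier_vec K. herm H w v = cnj (herm H v w)) \<and>
     (\<forall>v\<in>carrier_vec K. v \<noteq> 0\<^sub>v K \<longrightarrow> Re (herm H v v) > 0)"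

definition hermitian_metric :: "nat \<Rightarrow> (complex \<Rightarrow> complex mat) \<Rightarrow> bool" where
  "hermitian_metric K h \<longleftrightarrow> (\<forall>z. hermitian_inner_product K (h z)) \<and>
     (\<forall>i<K. \<forall>j<K. \<forall>k. Ck k (\<lambda>z. h z $$ (i, j)))"

text \<open>Below, \<open>norm (inverse z)\<close> is the absolute value of the coordinate \<open>x = 1/z\<close> at \<open>\<infinity>\<close>.\<close>

definition adapted ::
    "nat \<Rightarrow> (real \<Rightarrow> (complex \<Rightarrow> complex vec) set) \<Rightarrow> (complex \<Rightarrow> complex mat) \<Rightarrow> bool" where
  "adapted K P h \<longleftrightarrow> (\<forall>\<beta>. P \<beta> = {s \<in> mero_sections K. \<forall>\<epsilon>>0.
     (\<lambda>z. herm_norm (h z) (s z)) \<in> O[at_infinity](\<lambda>z. norm (inverse z) powr (- (\<beta> + \<epsilon>)))})"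

definition herm_adjoint :: "nat \<Rightarrow> complex mat \<Rightarrow> complex mat \<Rightarrow> complex mat" where
  "herm_adjoint K H A = (THE B. B \<in> carrier_mat K K \<and>
     (\<forall>v\<in>carrier_vec K. \<forall>w\<in>carrier_vec K. herm H (A *\<^sub>v v) w = herm H v (B *\<^sub>v w)))"


section \<open>The Chern connection and harmonic metrics\<close>

text \<open>
  A connection \<open>d + A dz + A' dzbar\<close> is the Chern connection of \<open>h\<close> if its \<open>(0,1)\<close>-part is the
  holomorphic structure, for which the canonical frame is holomorphic, and if it is unitary. The last
  two equations are the \<open>dz\<close>- and \<open>dzbar\<close>-parts of \<open>d h(v, w) = h(Dv, w) + h(v, Dw)\<close> for sections
  \<open>v\<close>, \<open>w\<close> with constant coefficients; for other sections this follows from the Leibniz rule.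
\<close>

definition chern_connection ::
    "nat \<Rightarrow> (complex \<Rightarrow> complex mat) \<Rightarrow> (complex \<Rightarrow> complex mat) \<Rightarrow> (complex \<Rightarrow> complex mat) \<Rightarrow> bool" where
  "chern_connection K h A A' \<longleftrightarrow>
     (\<forall>z. A z \<in> carrier_mat K K \<and> A' z = 0\<^sub>m K K) \<and>
     (\<forall>z. \<forall>v\<in>carrier_vec K. \<forall>w\<in>carrier_vec K.
        d_z (\<lambda>u. herm (h u) v w) z = herm (h z) (A z *\<^sub>v v) w + herm (h z) v (A' z *\<^sub>v w) \<and>
        d_zbar (\<lambda>u. herm (h u) v w) z = herm (h z) (A' z *\<^sub>v v) w + herm (h z) v (A z *\<^sub>v w))"

text \<open>The coefficient of \<open>dz \<and> dzbar\<close> in \<open>d\<omega> + \<omega> \<and> \<omega>\<close>, where \<open>\<omega> = A dz + A' dzbar\<close>.\<close>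

definition curvature ::
    "nat \<Rightarrow> (complex \<Rightarrow> complex mat) \<Rightarrow> (complex \<Rightarrow> complex mat) \<Rightarrow> complex \<Rightarrow> complex mat" where
  "curvature K A A' z =
     mat K K (\<lambda>ij. d_z (\<lambda>u. A' u $$ ij) z - d_zbar (\<lambda>u. A u $$ ij) z) + (A z * A' z - A' z * A z)"

text \<open>
  With \<open>\<phi> = \<Phi> dz\<close> and adjoint \<open>\<Psi> dzbar\<close>, the bracket of the two (a sum of wedge products in both
  orders) has coefficient \<open>\<Phi> \<Psi> - \<Psi> \<Phi>\<close>.
\<close>

definition harmonic_metric :: "filtered_higgs \<Rightarrow> (complex \<Rightarrow> complex mat) \<Rightarrow> bool" where
  "harmonic_metric E h \<longleftrightarrow>
     hermitian_metric (fh_rank E) h \<and> adapted (fh_rank E) (fh_filt E) h \<and>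
     (\<exists>A A'. chern_connection (fh_rank E) h A A' \<and>
       (\<forall>z. let \<Phi> = fh_higgs E z; \<Psi> = herm_adjoint (fh_rank E) (h z) \<Phi>
            in curvature (fh_rank E) A A' z + (\<Phi> * \<Psi> - \<Psi> * \<Phi>) = 0\<^sub>m (fh_rank E) (fh_rank E)))"


section \<open>The regulated norm\<close>

definition mat_trace :: "'a::comm_monoid_add mat \<Rightarrow> 'a" where
  "mat_trace A = (\<Sum>i<dim_row A. A $$ (i, i))"

definition regulated_density ::
    "nat \<Rightarrow> filtered_higgs \<Rightarrow> (complex \<Rightarrow> complex mat) \<Rightarrow> complex \<Rightarrow> complex" where
  "regulated_density N E h z =
     mat_trace (fh_higgs E z * herm_adjoint (fh_rank E) (h z) (fh_higgs E z)
       - complex_of_real (norm z powr (2 * real N / real (fh_rank E))) \<cdot>\<^sub>m 1\<^sub>m (fh_rank E))"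

text \<open>The factor \<open>- 2 * \<i>\<close> comes from \<open>dz \<and> dzbar = -2 \<i> dx \<and> dy\<close>.\<close>

definition regulated_L2_norm :: "nat \<Rightarrow> filtered_higgs \<Rightarrow> (complex \<Rightarrow> complex mat) \<Rightarrow> complex" where
  "regulated_L2_norm N E h =
     \<i> / complex_of_real pi * ((- 2 * \<i>) * (LINT z|lborel. regulated_density N E h z))"

definition B_mat :: "nat \<Rightarrow> real mat" where
  "B_mat K = mat K K (\<lambda>(i, j).
     1 / (2 * real K) * (- (real K - 1) + 2 * real_of_int ((int j - int i) mod int K)))"

definition euclid_norm :: "real vec \<Rightarrow> real" where
  "euclid_norm v = L2_set (($) v) {..<dim_vec v}"

end

theory Submission
  imports Defs "Jordan_Normal_Form.Determinant"
begin

text \<open>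
  Let \<open>h\<close> be a harmonic metric, \<open>u\<^sub>i = ln (h(e\<^sub>i, e\<^sub>i))\<close> and \<open>w\<^sub>i = \<bar>z\<bar>^(2 b\<^sub>i) exp (u\<^sub>i - u\<^sub>i\<^sub>+\<^sub>1)\<close>, with cyclic indices. The
  proof extracts everything from these functions.

  Curvature decreases in subbundles. Applied to the line spanned by the holomorphic section \<open>e\<^sub>i\<close>, together
  with Hitchin's equation and Cauchy-Schwarz, this gives the Toda inequality
  \<open>\<Delta>u\<^sub>i \<ge> 4 (w\<^sub>i - w\<^sub>i\<^sub>-\<^sub>1)\<close> (\<open>lap_ge\<close>, \<open>X_ge\<close>). As the metric is adapted, \<open>u\<^sub>i \<le> (\<epsilon> - 2 \<alpha>\<^sub>i) ln \<bar>z\<bar> + C\<close>. The weights sum to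
  zero, so the sum of the \<open>u\<^sub>i\<close> is subharmonic and grows slower than the logarithm; by a Liouville theorem
  (\<open>subharmonic_sublogarithmic\<close>) it is constant. Hence all the inequalities are equations: the \<open>u\<^sub>i\<close> solve the
  Toda system (\<open>toda_equation\<close>), the adjoint of the Higgs field maps \<open>e\<^sub>i\<close> to a multiple of \<open>e\<^sub>i\<^sub>+\<^sub>1\<close>, and
  the trace in the regulated norm is the sum of the \<open>w\<^sub>i\<close> (\<open>higgs_trace\<close>). The same Liouville theorem,
  applied to the log-sum-exp of the differences between the \<open>u\<^sub>i\<close> and their rotations, shows that the \<open>u\<^sub>i\<close> depend on
  \<open>\<bar>z\<bar>\<close> only (\<open>radial\<close>).

  What remains is an ordinary differential equation. With \<open>t = ln \<bar>z\<bar>\<close> and \<open>V\<^sub>i = u\<^sub>i + 2 \<alpha>\<^sub>i t\<close> it becomes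
  \<open>V\<^sub>i'' = 4 (G\<^sub>i - G\<^sub>i\<^sub>-\<^sub>1)\<close> with \<open>G\<^sub>i = exp (\<gamma> t + V\<^sub>i - V\<^sub>i\<^sub>+\<^sub>1)\<close> and \<open>\<gamma> = 2 + 2 N / K\<close>, and the regulated density is, up to the
  factor \<open>exp (- 2 t)\<close>, the sum \<open>Q\<close> of the \<open>G\<^sub>i - exp (\<gamma> t)\<close>, which is nonnegative. The Pohozaev quantity
  \<open>P = 4 Q - 1/2 \<Sum> V\<^sub>i'\<^sup>2\<close> satisfies \<open>P' = 4 \<gamma> Q\<close>. It tends to \<open>- 2 \<Sum> \<alpha>\<^sub>i\<^sup>2\<close> at the origin, where the \<open>u\<^sub>i\<close> are smooth, and to \<open>0\<close>
  at infinity (\<open>cyclic_toda_ode\<close>). So the integral converges and is \<open>pi / \<gamma> \<Sum> \<alpha>\<^sub>i\<^sup>2\<close> (\<open>integral_regulated\<close>).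
  Finally \<open>B\<close> maps the partition to \<open>- \<alpha>\<close> (\<open>B_mat_weights\<close>).
\<close>

section \<open>Second derivatives along lines and the maximum principle\<close>

text \<open>
  Derivatives are taken along the lines in a direction \<open>d\<close>: this is all that the second-derivative
  test at a maximum sees, and it serves the plane (with the directions \<open>c\<close> and \<open>c * \<i>\<close>, which add up to
  the Laplacian) and the real line (with \<open>d = 1\<close>) at once.
\<close>

definition twice_diff :: "'a::real_normed_vector \<Rightarrow> 'a set \<Rightarrow> ('a \<Rightarrow> real) \<Rightarrow> ('a \<Rightarrow> real) \<Rightarrow> ('a \<Rightarrow> real) \<Rightarrow> bool" where
  "twice_diff d X f f1 f2 \<longleftrightarrow> continuous_on X f \<and> continuous_on X f1 \<and> continuous_on X f2 \<and>
     (\<forall>x\<in>X. ((\<lambda>t. f (x + t *\<^sub>R d)) has_real_derivative f1 x) (at 0) \<and>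
            ((\<lambda>t. f1 (x + t *\<^sub>R d)) has_real_derivative f2 x) (at 0))"

lemma twice_diffD:
  assumes "twice_diff d X f f1 f2"
  shows "continuous_on X f" "continuous_on X f1" "continuous_on X f2"
    "x \<in> X \<Longrightarrow> ((\<lambda>t. f (x + t *\<^sub>R d)) has_real_derivative f1 x) (at 0)"
    "x \<in> X \<Longrightarrow> ((\<lambda>t. f1 (x + t *\<^sub>R d)) has_real_derivative f2 x) (at 0)"
  using assms unfolding twice_diff_def by auto

lemma twice_diff_subset: "twice_diff d X f f1 f2 \<Longrightarrow> Y \<subseteq> X \<Longrightarrow> twice_diff d Y f f1 f2"
  unfolding twice_diff_def by (meson continuous_on_subset subsetD)

lemma twice_diff_cong:
  assumes f: "twice_diff d X f f1 f2" and eq: "\<And>x. x \<in> X \<Longrightarrow> f x = g x" and X: "open X"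
  shows "twice_diff d X g f1 f2"
proof -
  have "((\<lambda>t. g (x + t *\<^sub>R d)) has_real_derivative f1 x) (at 0)" if x: "x \<in> X" for x
  proof (rule has_field_derivative_transform_within_open)
    show "((\<lambda>t. f (x + t *\<^sub>R d)) has_real_derivative f1 x) (at 0)" using twice_diffD(4)[OF f x] .
    show "open ((\<lambda>t. x + t *\<^sub>R d) -` X)" by (intro open_vimage X continuous_intros)
  qed (use x eq in auto)
  thus ?thesis using f eq continuous_on_cong[OF refl eq] unfolding twice_diff_def by simp
qed

lemma twice_diff_const: "twice_diff d X (\<lambda>x. c) (\<lambda>x. 0) (\<lambda>x. 0)"
  unfolding twice_diff_def by auto

lemma twice_diff_add:
  assumes "twice_diff d X f f1 f2" "twice_diff d X g g1 g2"
  shows "twice_diff d X (\<lambda>x. f x + g x) (\<lambda>x. f1 x + g1 x) (\<lambda>x. f2 x + g2 x)"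
  using assms unfolding twice_diff_def by (auto intro!: continuous_intros DERIV_add)

lemma twice_diff_diff:
  assumes "twice_diff d X f f1 f2" "twice_diff d X g g1 g2"
  shows "twice_diff d X (\<lambda>x. f x - g x) (\<lambda>x. f1 x - g1 x) (\<lambda>x. f2 x - g2 x)"
  using assms unfolding twice_diff_def by (auto intro!: continuous_intros DERIV_diff)

lemma twice_diff_cmult:
  assumes "twice_diff d X f f1 f2"
  shows "twice_diff d X (\<lambda>x. c * f x) (\<lambda>x. c * f1 x) (\<lambda>x. c * f2 x)"
  using assms unfolding twice_diff_def by (auto intro!: continuous_intros DERIV_cmult)

lemma twice_diff_sum:
  assumes "\<And>i. i \<in> I \<Longrightarrow> twice_diff d X (f i) (f1 i) (f2 i)"
  shows "twice_diff d X (\<lambda>x. \<Sum>i\<in>I. f i x) (\<lambda>x. \<Sum>i\<in>I. f1 i x) (\<lambda>x. \<Sum>i\<in>I. f2 i x)"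
  using assms unfolding twice_diff_def by (auto intro!: continuous_intros DERIV_sum)

lemma twice_diff_exp:
  assumes "twice_diff d X f f1 f2"
  shows "twice_diff d X (\<lambda>x. exp (f x)) (\<lambda>x. exp (f x) * f1 x) (\<lambda>x. exp (f x) * ((f1 x)\<^sup>2 + f2 x))"
proof -
  note D = twice_diffD[OF assms]
  show ?thesis unfolding twice_diff_def
  proof (intro conjI ballI)
    fix x assume x: "x \<in> X"
    note [derivative_intros] = D(4,5)[OF x]
    show "((\<lambda>t. exp (f (x + t *\<^sub>R d))) has_real_derivative exp (f x) * f1 x) (at 0)"
      by (auto intro!: derivative_eq_intros)
    show "((\<lambda>t. exp (f (x + t *\<^sub>R d)) * f1 (x + t *\<^sub>R d)) has_real_derivative exp (f x) * ((f1 x)\<^sup>2 + f2 x)) (at 0)"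
      by (auto intro!: derivative_eq_intros simp: algebra_simps power2_eq_square)
  qed (auto intro!: continuous_intros D)
qed

lemma twice_diff_square:
  assumes "twice_diff d X f f1 f2"
  shows "twice_diff d X (\<lambda>x. (f x)\<^sup>2) (\<lambda>x. 2 * f x * f1 x) (\<lambda>x. 2 * (f1 x)\<^sup>2 + 2 * f x * f2 x)"
proof -
  note D = twice_diffD[OF assms]
  show ?thesis unfolding twice_diff_def
  proof (intro conjI ballI)
    fix x assume x: "x \<in> X"
    note [derivative_intros] = D(4,5)[OF x]
    show "((\<lambda>t. (f (x + t *\<^sub>R d))\<^sup>2) has_real_derivative 2 * f x * f1 x) (at 0)"
      by (auto intro!: derivative_eq_intros)
    show "((\<lambda>t. 2 * f (x + t *\<^sub>R d) * f1 (x + t *\<^sub>R d)) has_real_derivative 2 * (f1 x)\<^sup>2 + 2 * f x * f2 x) (at 0)"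
      by (auto intro!: derivative_eq_intros simp: algebra_simps power2_eq_square)
  qed (auto intro!: continuous_intros D)
qed

lemma twice_diff_ln:
  assumes "twice_diff d X f f1 f2" and pos: "\<And>x. x \<in> X \<Longrightarrow> f x > 0"
  shows "twice_diff d X (\<lambda>x. ln (f x)) (\<lambda>x. f1 x / f x) (\<lambda>x. f2 x / f x - (f1 x / f x)\<^sup>2)"
proof -
  note D = twice_diffD[OF assms(1)]
  have nz: "\<And>x. x \<in> X \<Longrightarrow> f x \<noteq> 0" using pos by force
  show ?thesis unfolding twice_diff_def
  proof (intro conjI ballI)
    fix x assume x: "x \<in> X"
    note [derivative_intros] = D(4,5)[OF x]
    show "((\<lambda>t. ln (f (x + t *\<^sub>R d))) has_real_derivative f1 x / f x) (at 0)"
      using pos[OF x] by (auto intro!: derivative_eq_intros)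
    show "((\<lambda>t. f1 (x + t *\<^sub>R d) / f (x + t *\<^sub>R d)) has_real_derivative f2 x / f x - (f1 x / f x)\<^sup>2) (at 0)"
      using pos[OF x] by (auto intro!: derivative_eq_intros simp: field_simps power2_eq_square)
  qed (auto intro!: continuous_intros D nz)
qed

text \<open>
  The second derivative of a log-sum-exp is the mean of the second derivatives for the weights
  \<open>exp (f i)\<close> plus the variance of the first derivatives, and the variance is nonnegative.
\<close>

lemma twice_diff_lse:
  fixes f :: "'i \<Rightarrow> 'a::real_normed_vector \<Rightarrow> real"
  assumes fin: "finite I" "I \<noteq> {}" and f: "\<And>i. i \<in> I \<Longrightarrow> twice_diff d X (f i) (f1 i) (f2 i)"
  obtains L1 L2 where "twice_diff d X (\<lambda>x. ln (\<Sum>i\<in>I. exp (f i x))) L1 L2"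
    "\<And>x. L2 x \<ge> (\<Sum>i\<in>I. exp (f i x) * f2 i x) / (\<Sum>i\<in>I. exp (f i x))"
proof -
  let ?G = "\<lambda>x. \<Sum>i\<in>I. exp (f i x)"
  let ?G1 = "\<lambda>x. \<Sum>i\<in>I. exp (f i x) * f1 i x"
  let ?G2 = "\<lambda>x. \<Sum>i\<in>I. exp (f i x) * ((f1 i x)\<^sup>2 + f2 i x)"
  have pos: "?G x > 0" for x using fin by (intro sum_pos) auto
  have G: "twice_diff d X ?G ?G1 ?G2"
    by (intro twice_diff_sum twice_diff_exp f)
  have "?G2 x / ?G x - (?G1 x / ?G x)\<^sup>2 \<ge> (\<Sum>i\<in>I. exp (f i x) * f2 i x) / ?G x" for x
  proof -
    have e: "exp (f i x) = (exp (f i x / 2))\<^sup>2" for i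
      by (simp add: power2_eq_square flip: exp_add)
    have "(\<Sum>i\<in>I. exp (f i x / 2) * (exp (f i x / 2) * f1 i x))\<^sup>2
       \<le> (\<Sum>i\<in>I. (exp (f i x / 2))\<^sup>2) * (\<Sum>i\<in>I. (exp (f i x / 2) * f1 i x)\<^sup>2)"
      by (rule Cauchy_Schwarz_ineq_sum)
    hence cs: "(?G1 x)\<^sup>2 \<le> ?G x * (\<Sum>i\<in>I. exp (f i x) * (f1 i x)\<^sup>2)"
      by (simp add: e power2_eq_square mult_ac)
    have "(?G1 x / ?G x)\<^sup>2 \<le> (\<Sum>i\<in>I. exp (f i x) * (f1 i x)\<^sup>2) / ?G x"
      using cs pos[of x] by (simp add: power_divide divide_simps power2_eq_square mult_ac)
    moreover have "?G2 x = (\<Sum>i\<in>I. exp (f i x) * (f1 i x)\<^sup>2) + (\<Sum>i\<in>I. exp (f i x) * f2 i x)"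
      by (simp add: algebra_simps sum.distrib)
    ultimately show ?thesis by (simp add: add_divide_distrib)
  qed
  thus thesis by (intro that[OF twice_diff_ln[OF G pos]]) auto
qed

lemma twice_diff_local_max:
  fixes f :: "'a::real_normed_vector \<Rightarrow> real"
  assumes f: "twice_diff d U f f1 f2" and p: "p \<in> interior U"
    and mx: "\<forall>\<^sub>F x in nhds p. f x \<le> f p"
  shows "f2 p \<le> 0"
proof (rule ccontr)
  assume "\<not> f2 p \<le> 0"
  hence pos: "f2 p > 0" by simp
  note D = twice_diffD[OF f]
  define g where "g t = f (p + t *\<^sub>R d)" for t
  define g1 where "g1 t = f1 (p + t *\<^sub>R d)" for t
  have tend: "((\<lambda>t. p + t *\<^sub>R d) \<longlongrightarrow> p) (at 0)"
    by (auto intro!: tendsto_eq_intros)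
  have "\<forall>\<^sub>F x in nhds p. x \<in> interior U" using p by (simp add: eventually_nhds_in_open)
  with mx have "\<forall>\<^sub>F x in nhds p. f x \<le> f p \<and> x \<in> interior U" by eventually_elim auto
  then obtain V where V: "open V" "p \<in> V" "\<And>x. x \<in> V \<Longrightarrow> f x \<le> f p \<and> x \<in> interior U"
    unfolding eventually_nhds by auto
  have "open ((\<lambda>t::real. p + t *\<^sub>R d) -` V)"
    by (intro open_vimage V continuous_intros)
  moreover have "0 \<in> ((\<lambda>t::real. p + t *\<^sub>R d) -` V)" using V by auto
  ultimately have "\<exists>e>0. \<forall>t. dist t 0 < e \<longrightarrow> t \<in> ((\<lambda>t::real. p + t *\<^sub>R d) -` V)"
    unfolding open_dist by (rule bspec)
  then obtain e where e: "e > 0" "\<And>t. \<bar>t\<bar> < e \<Longrightarrow> p + t *\<^sub>R d \<in> V"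
    by (metis dist_0_norm dist_commute real_norm_def vimageE)
  have dg: "(g has_real_derivative g1 t) (at t)" if t: "\<bar>t\<bar> < e" for t
  proof -
    have "p + t *\<^sub>R d \<in> U" using V(3) e(2)[OF t] interior_subset by blast
    from D(4)[OF this] have "((\<lambda>s. g (s + t)) has_real_derivative g1 t) (at 0)"
      by (simp add: g_def g1_def algebra_simps)
    thus ?thesis using DERIV_shift[of g "g1 t" 0 t] by simp
  qed
  have "p \<in> U" using p interior_subset by blast
  hence dg1: "(g1 has_real_derivative f2 p) (at 0)"
    using D(5)[of p] unfolding g1_def by blast
  have g0: "g1 0 = 0"
  proof (rule DERIV_local_max[OF dg e(1)])
    show "\<forall>y. \<bar>0 - y\<bar> < e \<longrightarrow> g y \<le> g 0" using e V by (simp add: g_def)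
  qed (use e in auto)
  from has_real_derivative_pos_inc_right[OF dg1[THEN has_field_derivative_at_within, of UNIV] pos]
  obtain d' where d': "d' > 0" "\<And>h. h > 0 \<Longrightarrow> h < d' \<Longrightarrow> g1 0 < g1 h" by auto
  define s where "s = min e d' / 2"
  have s: "0 < s" "s < e" "s < d'" using e d' by (auto simp: s_def min_def)
  \<comment> \<open>a vanishing first and a positive second derivative make \<open>g\<close> increase to the right of \<open>0\<close>\<close>
  have "g 0 < g s"
  proof (rule DERIV_pos_imp_increasing_open[OF s(1)])
    fix x assume "0 < x" "x < s"
    thus "\<exists>y. DERIV g x :> y \<and> 0 < y" using dg[of x] d'(2)[of x] s g0 by auto
    next
    show "continuous_on {0..s} g"
      using s by (intro continuous_at_imp_continuous_on ballI DERIV_isCont[OF dg]) auto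
  qed
  moreover have "g s \<le> g 0" using V(3)[OF e(2)[of s]] s by (simp add: g_def)
  ultimately show False by simp
qed

text \<open>
  A strictly subharmonic function cannot have an interior maximum, as both second derivatives would
  be nonpositive there.
\<close>

lemma weak_max_principle:
  fixes T :: "complex \<Rightarrow> real"
  assumes X: "compact X" "X \<noteq> {}" "X \<subseteq> U" "open U"
    and T: "twice_diff 1 U T Tx Txx" "twice_diff \<i> U T Ty Tyy"
    and B: "\<And>z. z \<in> X \<Longrightarrow> z \<notin> B \<Longrightarrow> z \<in> interior X \<and> Txx z + Tyy z > 0"
  obtains p where "p \<in> X" "p \<in> B" "\<And>z. z \<in> X \<Longrightarrow> T z \<le> T p"
proof -
  have "continuous_on X T" using twice_diffD(1)[OF T(1)] X continuous_on_subset by blast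
  from continuous_attains_sup[OF X(1,2) this] obtain p where p: "p \<in> X" "\<And>z. z \<in> X \<Longrightarrow> T z \<le> T p"
    by auto
  have "p \<in> B"
  proof (rule ccontr)
    assume "p \<notin> B"
    from B[OF p(1) this] have i: "p \<in> interior X" "Txx p + Tyy p > 0" by auto
    have "\<forall>\<^sub>F x in nhds p. x \<in> interior X" using i by (simp add: eventually_nhds_in_open)
    hence ev: "\<forall>\<^sub>F x in nhds p. T x \<le> T p"
      by eventually_elim (use p interior_subset in blast)
    have "p \<in> interior U" using X p by (auto simp: interior_open)
    from twice_diff_local_max[OF T(1) this ev] twice_diff_local_max[OF T(2) this ev] i
    show False by simp
  qed
  with p show thesis by (intro that) auto
qed

lemma twice_diff_norm_sq:
  fixes c :: complex
  shows "twice_diff d X (\<lambda>z. (norm (z - c))\<^sup>2)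
    (\<lambda>z. 2 * ((Re z - Re c) * Re d + (Im z - Im c) * Im d)) (\<lambda>z. 2 * (norm d)\<^sup>2)"
  unfolding twice_diff_def cmod_power2
  by (auto intro!: continuous_intros derivative_eq_intros simp: algebra_simps power2_eq_square)

text \<open>
  With \<open>r = norm (z - c)\<close> this function is \<open>ln r - 1 / r\<^sup>2\<close>: the logarithm is harmonic and \<open>1 / r\<^sup>2\<close> is strictly
  subharmonic. Subtracting a small multiple of the barrier from a subharmonic function makes it strictly
  subharmonic and, for a function of sublogarithmic growth, makes it tend to minus infinity.
\<close>

lemma barrier:
  fixes c :: complex
  defines "\<beta> \<equiv> \<lambda>z. ln ((norm (z - c))\<^sup>2) / 2 - inverse ((norm (z - c))\<^sup>2)"
  obtains bx bxx by' byy where "twice_diff 1 (- {c}) \<beta> bx bxx" "twice_diff \<i> (- {c}) \<beta> by' byy"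
    "\<And>z. z \<noteq> c \<Longrightarrow> bxx z + byy z < 0"
proof -
  let ?q = "\<lambda>z. (norm (z - c))\<^sup>2"
  have q: "z \<in> - {c} \<Longrightarrow> ?q z > 0" for z by auto
  note L = twice_diff_ln[OF twice_diff_norm_sq q]
  note E = twice_diff_exp[OF twice_diff_cmult[where c = "-1", OF L]]
  note F = twice_diff_diff[OF twice_diff_cmult[where c = "1/2", OF L] E]
  have beq: "z \<in> - {c} \<Longrightarrow> 1/2 * ln (?q z) - exp (-1 * ln (?q z)) = \<beta> z" for z
    using q[of z] by (simp add: \<beta>_def exp_minus)
  have op: "open (- {c})" by auto
  note G = twice_diff_cong[OF _ beq op, OF F]
  show thesis
  proof (rule that[OF G G])
    fix z assume "z \<noteq> c"
    define x where "x = Re z - Re c"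
    define y where "y = Im z - Im c"
    define q where "q = x\<^sup>2 + y\<^sup>2"
    have pos: "q > 0" using \<open>z \<noteq> c\<close> unfolding x_def y_def q_def
      by (metis add.commute complex_eq_iff eq_iff_diff_eq_0 sum_power2_gt_zero_iff)
    have nq: "(norm (z - c))\<^sup>2 = q" by (simp add: cmod_power2 q_def x_def y_def)
    define l where "l a b = 2 / q - (2 * (x * a + y * b) / q)\<^sup>2" for a b
    have l: "l 1 0 + l 0 1 = 0"
    proof -
      have "l 1 0 + l 0 1 = 4 / q - 4 * (x\<^sup>2 + y\<^sup>2) / q\<^sup>2"
        by (simp add: l_def field_simps power2_eq_square add_divide_distrib)
      also have "\<dots> = 0" using pos unfolding q_def[symmetric] by (simp add: field_simps power2_eq_square)
      finally show ?thesis .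
    qed
    have "l 1 0 / 2 - inverse q * ((2 * x / q)\<^sup>2 - l 1 0) + (l 0 1 / 2 - inverse q * ((2 * y / q)\<^sup>2 - l 0 1))
       = - (inverse q * (4 * q / q\<^sup>2)) + (l 1 0 + l 0 1) * (1/2 + inverse q)"
      by (simp add: q_def power_divide power_mult_distrib algebra_simps add_divide_distrib)
    also have "\<dots> < 0" using pos by (simp add: l)
    finally show "1 / 2 * (2 * (norm (1::complex))\<^sup>2 / (cmod (z - c))\<^sup>2 -
            (2 * ((Re z - Re c) * Re 1 + (Im z - Im c) * Im 1) / (cmod (z - c))\<^sup>2)\<^sup>2) -
         exp (- 1 * ln ((cmod (z - c))\<^sup>2)) *
         ((- 1 * (2 * ((Re z - Re c) * Re 1 + (Im z - Im c) * Im 1) / (cmod (z - c))\<^sup>2))\<^sup>2 +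
          - 1 * (2 * (cmod 1)\<^sup>2 / (cmod (z - c))\<^sup>2 -
            (2 * ((Re z - Re c) * Re 1 + (Im z - Im c) * Im 1) / (cmod (z - c))\<^sup>2)\<^sup>2)) +
         (1 / 2 * (2 * (norm \<i>)\<^sup>2 / (cmod (z - c))\<^sup>2 -
            (2 * ((Re z - Re c) * Re \<i> + (Im z - Im c) * Im \<i>) / (cmod (z - c))\<^sup>2)\<^sup>2) -
         exp (- 1 * ln ((cmod (z - c))\<^sup>2)) *
         ((- 1 * (2 * ((Re z - Re c) * Re \<i> + (Im z - Im c) * Im \<i>) / (cmod (z - c))\<^sup>2))\<^sup>2 +
          - 1 * (2 * (cmod \<i>)\<^sup>2 / (cmod (z - c))\<^sup>2 -
            (2 * ((Re z - Re c) * Re \<i> + (Im z - Im c) * Im \<i>) / (cmod (z - c))\<^sup>2)\<^sup>2))) < 0"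
      unfolding nq using pos by (simp add: exp_minus l_def flip: x_def y_def)
  qed
qed

section \<open>A Liouville theorem for subharmonic functions\<close>

text \<open>
  By comparison with the barrier, the maximum of \<open>S\<close> over a circle bounds \<open>S\<close>
  outside the circle, so circle maxima around a fixed centre do not increase with the radius. If the Laplacian were positive at a
  point, then subtracting a small multiple of \<open>norm (w - z)\<^sup>2\<close> would leave a subharmonic function near it,
  and the circle maxima around it would strictly increase.
\<close>

theorem subharmonic_sublogarithmic:
  fixes S :: "complex \<Rightarrow> real"
  assumes S: "twice_diff 1 UNIV S Sx Sxx" "twice_diff \<i> UNIV S Sy Syy"
    and sub: "\<And>z. Sxx z + Syy z \<ge> 0"
    and growth: "\<And>\<epsilon>. \<epsilon> > 0 \<Longrightarrow> \<exists>R C. \<forall>z. norm z \<ge> R \<longrightarrow> S z \<le> \<epsilon> * ln (norm z) + C"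
  shows "Sxx z + Syy z = 0"
proof (rule ccontr)
  have exterior: "S z \<le> m" if \<rho>: "\<rho> > 0" and m: "\<And>w. norm (w - c) = \<rho> \<Longrightarrow> S w \<le> m" and z: "norm (z - c) \<ge> \<rho>"
    for c z \<rho> m
  proof -
    define \<beta> where "\<beta> w = ln ((norm (w - c))\<^sup>2) / 2 - inverse ((norm (w - c))\<^sup>2)" for w
    define \<beta>0 where "\<beta>0 = ln (\<rho>\<^sup>2) / 2 - inverse (\<rho>\<^sup>2)"
    obtain bx bxx by' byy where b: "twice_diff 1 (- {c}) \<beta> bx bxx" "twice_diff \<i> (- {c}) \<beta> by' byy"
      "\<And>z. z \<noteq> c \<Longrightarrow> bxx z + byy z < 0"
      using barrier[of c] unfolding \<beta>_def by blast
    have key: "S z - m \<le> \<epsilon> * (\<beta> z - \<beta>0)" if \<epsilon>: "\<epsilon> > 0" for \<epsilon>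
    proof -
      define T where "T w = S w - \<epsilon> * \<beta> w" for w
      have T: "twice_diff 1 (- {c}) T (\<lambda>w. Sx w - \<epsilon> * bx w) (\<lambda>w. Sxx w - \<epsilon> * bxx w)"
         "twice_diff \<i> (- {c}) T (\<lambda>w. Sy w - \<epsilon> * by' w) (\<lambda>w. Syy w - \<epsilon> * byy w)"
        unfolding T_def
        by (intro twice_diff_diff twice_diff_cmult b twice_diff_subset[OF S(1)] twice_diff_subset[OF S(2)] subset_UNIV)+
      from growth[of "\<epsilon>/2"] \<epsilon> obtain R0 C where R0: "\<And>w. norm w \<ge> R0 \<Longrightarrow> S w \<le> \<epsilon>/2 * ln (norm w) + C"
        by auto
      \<comment> \<open>on the circle of radius \<open>R\<close> the barrier makes \<open>T\<close> smaller than its value at \<open>z\<close>\<close>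
      define R where "R = exp (\<bar>2 / \<epsilon> * (\<epsilon>/2 * ln 2 + C + \<epsilon> - T z)\<bar>) + \<bar>R0\<bar> + norm c + norm (z - c) + 1"
      have R: "R > norm (z - c)" "R \<ge> R0 + norm c" "R \<ge> 1" "R > norm c" "R > exp (\<bar>2 / \<epsilon> * (\<epsilon>/2 * ln 2 + C + \<epsilon> - T z)\<bar>)"
      proof -
        have "exp (\<bar>2 / \<epsilon> * (\<epsilon>/2 * ln 2 + C + \<epsilon> - T z)\<bar>) > 0" "norm c \<ge> 0" "norm (z - c) \<ge> 0" by simp_all
        thus "R > norm (z - c)" "R \<ge> R0 + norm c" "R \<ge> 1" "R > norm c" "R > exp (\<bar>2 / \<epsilon> * (\<epsilon>/2 * ln 2 + C + \<epsilon> - T z)\<bar>)"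
          unfolding R_def by linarith+
      qed
      have far: "T w < T z" if w: "norm (w - c) = R" for w
      proof -
        have w1: "norm w \<ge> R0" using R(2) w norm_triangle_ineq2[of w c] norm_triangle_ineq4[of w c] by linarith
        have w2: "norm w \<le> 2 * R" using R(4) w norm_triangle_ineq[of "w - c" c] by simp
        have w3: "norm w > 0" using R(4) w by (cases "w = 0") auto
        have "ln (norm w) \<le> ln (2 * R)" using w2 w3 by (subst ln_le_cancel_iff) linarith+
        also have "\<dots> = ln 2 + ln R" using R(3) by (simp add: ln_mult)
        finally have "\<epsilon>/2 * ln (norm w) \<le> \<epsilon>/2 * (ln 2 + ln R)" using \<epsilon> by (intro mult_left_mono) auto
        hence s: "S w \<le> \<epsilon>/2 * (ln 2 + ln R) + C" using R0[OF w1] by linarith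
        have "\<beta> w = ln R - inverse (R\<^sup>2)" using R(3) by (simp add: \<beta>_def w ln_realpow)
        moreover have "inverse (R\<^sup>2) \<le> 1" using R(3) by (simp add: inverse_le_1_iff)
        ultimately have "\<epsilon> * (ln R - 1) \<le> \<epsilon> * \<beta> w" using \<epsilon> by (intro mult_left_mono) auto
        hence "T w \<le> (\<epsilon>/2 * ln 2 + C + \<epsilon>) - \<epsilon>/2 * ln R"
          using s unfolding T_def by (simp add: algebra_simps)
        moreover have "ln R > \<bar>2 / \<epsilon> * (\<epsilon>/2 * ln 2 + C + \<epsilon> - T z)\<bar>"
          using R(3,5) by (metis exp_gt_zero ln_exp ln_less_cancel_iff order_less_trans)
        hence "ln R > 2 / \<epsilon> * (\<epsilon>/2 * ln 2 + C + \<epsilon> - T z)" by linarith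
        hence "\<epsilon>/2 * ln R > \<epsilon>/2 * (2 / \<epsilon> * (\<epsilon>/2 * ln 2 + C + \<epsilon> - T z))"
          using \<epsilon> by (intro mult_strict_left_mono) auto
        hence "\<epsilon>/2 * ln R > \<epsilon>/2 * ln 2 + C + \<epsilon> - T z" using \<epsilon> by simp
        ultimately show ?thesis by linarith
      qed
      define X where "X = cball c R - ball c \<rho>"
      have Xi: "w \<in> X \<longleftrightarrow> \<rho> \<le> norm (w - c) \<and> norm (w - c) \<le> R" for w
        by (auto simp: X_def dist_norm norm_minus_commute)
      have "compact X" unfolding X_def by (intro compact_diff) auto
      moreover have "z \<in> X" using z R by (simp add: Xi)
      moreover have "X \<subseteq> - {c}" using \<rho> by (auto simp: Xi)
      moreover have "w \<in> interior X \<and> (Sxx w - \<epsilon> * bxx w) + (Syy w - \<epsilon> * byy w) > 0"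
        if "w \<in> X" "w \<notin> sphere c \<rho> \<union> sphere c R" for w
      proof
        have "w \<in> ball c R - cball c \<rho>" using that by (auto simp: X_def)
        moreover have "open (ball c R - cball c \<rho>)" by (intro open_Diff) auto
        moreover have "ball c R - cball c \<rho> \<subseteq> X" by (auto simp: X_def)
        ultimately show "w \<in> interior X" by (meson interiorI)
        have "w \<noteq> c" using that \<rho> by (auto simp: Xi)
        from b(3)[OF this] \<epsilon> have "\<epsilon> * (bxx w + byy w) < 0" by (simp add: mult_pos_neg)
        thus "(Sxx w - \<epsilon> * bxx w) + (Syy w - \<epsilon> * byy w) > 0" using sub[of w] by (simp add: algebra_simps)
      qed
      ultimately obtain p where p: "p \<in> sphere c \<rho> \<union> sphere c R" "\<And>w. w \<in> X \<Longrightarrow> T w \<le> T p"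
        using weak_max_principle[of X "- {c}" T, OF _ _ _ _ T, of "sphere c \<rho> \<union> sphere c R"] by (metis empty_iff open_Compl closed_singleton)
      have "T z \<le> T p" using p \<open>z \<in> X\<close> by auto
      hence "norm (p - c) \<noteq> R" using far[of p] by auto
      hence pc: "norm (p - c) = \<rho>" using p by (auto simp: dist_norm norm_minus_commute)
      hence "T p \<le> m - \<epsilon> * \<beta>0" using m[OF pc] by (simp add: T_def \<beta>_def \<beta>0_def pc)
      with \<open>T z \<le> T p\<close> show ?thesis unfolding T_def by (simp add: algebra_simps)
    qed
    show ?thesis
    proof (rule ccontr)
      assume "\<not> S z \<le> m"
      hence gt: "S z - m > 0" by simp
      define k where "k = \<bar>\<beta> z - \<beta>0\<bar> + 1"
      have k: "k > 0" "\<beta> z - \<beta>0 \<le> k" by (simp_all add: k_def)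
      have e: "(S z - m) / (2 * k) > 0" using gt k by simp
      from key[OF this] have "S z - m \<le> (S z - m) / (2 * k) * (\<beta> z - \<beta>0)" .
      also have "\<dots> \<le> (S z - m) / (2 * k) * k" using e k by (intro mult_left_mono) auto
      also have "\<dots> = (S z - m) / 2" using k by simp
      finally show False using gt by simp
    qed
  qed
  define L where "L w = Sxx w + Syy w" for w
  assume "Sxx z + Syy z \<noteq> 0"
  hence Lz: "L z > 0" using sub[of z] by (auto simp: L_def)
  \<comment> \<open>on a small disc the Laplacian stays above \<open>4 * \<kappa>\<close>, the Laplacian of \<open>\<kappa> * (norm (w - z))\<^sup>2\<close>\<close>
  define \<kappa> where "\<kappa> = L z / 8"
  have k: "\<kappa> > 0" using Lz by (simp add: \<kappa>_def)
  have "continuous_on UNIV L" unfolding L_def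
    by (intro continuous_intros twice_diffD(3)[OF S(1)] twice_diffD(3)[OF S(2)])
  hence "isCont L z" by (simp add: continuous_on_eq_continuous_at)
  hence "\<forall>\<^sub>F w in nhds z. L w > 4 * \<kappa>"
    using k by (intro order_tendstoD(1)[where y = "L z"]) (auto simp: \<kappa>_def isCont_def tendsto_nhds_iff)
  then obtain r0 where r0: "r0 > 0" "\<And>w. dist w z < r0 \<Longrightarrow> L w > 4 * \<kappa>"
    unfolding eventually_nhds_metric by auto
  define \<rho> where "\<rho> = r0 / 2"
  have \<rho>: "\<rho> > 0" using r0 by (simp add: \<rho>_def)
  define T where "T w = S w - \<kappa> * (norm (w - z))\<^sup>2" for w
  note T = twice_diff_diff[OF S(1) twice_diff_cmult[OF twice_diff_norm_sq, of _ _ \<kappa> z], folded T_def]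
     twice_diff_diff[OF S(2) twice_diff_cmult[OF twice_diff_norm_sq, of _ _ \<kappa> z], folded T_def]
  have ex: "\<exists>p\<in>sphere z \<rho>. \<forall>w\<in>cball z \<rho>. T w \<le> T p"
  proof -
    have "w \<in> interior (cball z \<rho>) \<and>
      Sxx w - \<kappa> * (2 * (norm (1::complex))\<^sup>2) + (Syy w - \<kappa> * (2 * (norm \<i>)\<^sup>2)) > 0"
      if "w \<in> cball z \<rho>" "w \<notin> sphere z \<rho>" for w
      using that r0(2)[of w] r0(1) by (auto simp: L_def \<rho>_def dist_commute)
    from weak_max_principle[of "cball z \<rho>" UNIV T, OF _ _ _ _ T, of "sphere z \<rho>", OF _ _ _ _ this]
    obtain p where "p \<in> sphere z \<rho>" "\<And>w. w \<in> cball z \<rho> \<Longrightarrow> T w \<le> T p" using \<rho> by auto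
    thus ?thesis by blast
  qed
  then obtain p where p: "norm (p - z) = \<rho>" "\<And>w. norm (w - z) \<le> \<rho> \<Longrightarrow> T w \<le> T p"
    unfolding mem_sphere mem_cball Bex_def Ball_def dist_norm norm_minus_commute[of z] by blast
  have "continuous_on (sphere z (\<rho>/2)) S" using twice_diffD(1)[OF S(1)] continuous_on_subset by blast
  moreover have "sphere z (\<rho>/2) \<noteq> {}" using \<rho> by simp
  ultimately obtain p' where p': "norm (p' - z) = \<rho>/2" "\<And>w. norm (w - z) = \<rho>/2 \<Longrightarrow> S w \<le> S p'"
    using continuous_attains_sup[of "sphere z (\<rho>/2)" S, OF compact_sphere]
    unfolding mem_sphere Bex_def Ball_def dist_norm norm_minus_commute[of z] by blast
  have "S p \<le> S p'" by (rule exterior[of "\<rho>/2" z]) (use p p' \<rho> in auto)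
  moreover have "T p' \<le> T p" using p' p \<rho> by auto
  hence "S p' - \<kappa> * (\<rho>/2)\<^sup>2 \<le> S p - \<kappa> * \<rho>\<^sup>2" by (simp add: T_def p p')
  moreover have "\<kappa> * (\<rho>/2)\<^sup>2 < \<kappa> * \<rho>\<^sup>2" using k \<rho> by (intro mult_strict_left_mono) (auto simp: power2_eq_square)
  ultimately show False by simp
qed

section \<open>The cyclic Toda system on the line\<close>

definition nxt :: "nat \<Rightarrow> nat \<Rightarrow> nat" where "nxt K i = (i + 1) mod K"
definition prv :: "nat \<Rightarrow> nat \<Rightarrow> nat" where "prv K i = (i + (K - 1)) mod K"

lemma nxt_less: "K > 0 \<Longrightarrow> nxt K i < K" and prv_less: "K > 0 \<Longrightarrow> prv K i < K"
  by (simp_all add: nxt_def prv_def)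

lemma prv_nxt: "i < K \<Longrightarrow> prv K (nxt K i) = i"
  by (cases "Suc i = K") (auto simp: nxt_def prv_def)

lemma nxt_prv: "i < K \<Longrightarrow> nxt K (prv K i) = i"
  by (cases i) (auto simp: nxt_def prv_def mod_Suc_eq)

lemma bij_nxt: "bij_betw (nxt K) {..<K} {..<K}"
  by (rule bij_betwI[where g = "prv K"]) (auto simp: nxt_less prv_less prv_nxt nxt_prv)

lemma sum_nxt: "(\<Sum>i<K. f (nxt K i)) = (\<Sum>i<K. f i)"
  by (rule sum.reindex_bij_betw[OF bij_nxt])

lemma sum_prv: "(\<Sum>i<K. f (prv K i)) = (\<Sum>i<K. f i)"
proof -
  have "(\<Sum>i<K. f (prv K i)) = (\<Sum>i<K. f (prv K (nxt K i)))" by (rule sum_nxt[symmetric])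
  also have "\<dots> = (\<Sum>i<K. f i)" by (intro sum.cong) (auto simp: prv_nxt)
  finally show ?thesis .
qed

lemma cyclic_summation_by_parts:
  fixes g a :: "nat \<Rightarrow> 'a::comm_ring"
  shows "(\<Sum>i<K. g i * (a i - a (prv K i))) = (\<Sum>i<K. a i * (g i - g (nxt K i)))"
proof -
  have "(\<Sum>i<K. g i * a (prv K i)) = (\<Sum>i<K. g (nxt K i) * a (prv K (nxt K i)))"
    by (rule sum_nxt[symmetric])
  also have "\<dots> = (\<Sum>i<K. a i * g (nxt K i))"
    by (intro sum.cong) (auto simp: prv_nxt mult.commute)
  finally show ?thesis by (simp add: algebra_simps sum_subtractf)
qed

lemma twice_diff_real:
  assumes "\<And>t. (f has_real_derivative f1 t) (at t)" "\<And>t. (f1 has_real_derivative f2 t) (at t)"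
    "continuous_on UNIV f2"
  shows "twice_diff 1 UNIV f f1 f2"
proof -
  have "continuous_on UNIV f" "continuous_on UNIV f1"
    using assms by (auto intro!: continuous_at_imp_continuous_on DERIV_isCont)
  moreover have "((\<lambda>t. f (x + t *\<^sub>R 1)) has_real_derivative f1 x) (at 0)"
    "((\<lambda>t. f1 (x + t *\<^sub>R 1)) has_real_derivative f2 x) (at 0)" for x
    using DERIV_shift[of f "f1 x" 0 x] DERIV_shift[of f1 "f2 x" 0 x] assms(1,2)[of x]
    by (simp_all add: add.commute)
  ultimately show ?thesis using assms(3) unfolding twice_diff_def by simp
qed

lemma twice_diff_real_DERIV:
  fixes f :: "real \<Rightarrow> real"
  assumes "twice_diff 1 UNIV f f1 f2"
  shows "(f has_real_derivative f1 t) (at t)" "(f1 has_real_derivative f2 t) (at t)"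
  using twice_diffD(4,5)[OF assms, of t] DERIV_shift[of f "f1 t" 0 t] DERIV_shift[of f1 "f2 t" 0 t]
  by (simp_all add: add.commute)

lemma linear_lower_bound:
  fixes g :: "real \<Rightarrow> real"
  assumes "\<And>t. (g has_real_derivative g1 t) (at t)" "\<And>t. t \<ge> t0 \<Longrightarrow> g1 t \<ge> m" "t \<ge> t0"
  shows "g t \<ge> g t0 + m * (t - t0)"
proof -
  have "g t0 - m * t0 \<le> g t - m * t"
    by (rule DERIV_nonneg_imp_nondecreasing[OF assms(3)], rule exI[where x = "g1 _ - m"])
       (use assms(2) in \<open>auto intro!: derivative_eq_intros assms(1)\<close>)
  thus ?thesis by (simp add: algebra_simps)
qed

lemma convex_sublinear_nonincreasing:
  fixes g :: "real \<Rightarrow> real"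
  assumes d: "\<And>t. (g has_real_derivative g1 t) (at t)" "\<And>t. (g1 has_real_derivative g2 t) (at t)"
    and pos: "\<And>t. g2 t \<ge> 0"
    and growth: "\<And>\<epsilon>. \<epsilon> > 0 \<Longrightarrow> \<exists>T C. \<forall>t\<ge>T. g t \<le> \<epsilon> * t + C"
  shows "g1 t0 \<le> 0"
proof (rule ccontr)
  assume "\<not> g1 t0 \<le> 0"
  hence m: "g1 t0 > 0" by simp
  have "g1 t0 \<le> g1 t" if "t \<ge> t0" for t
    using linear_lower_bound[OF d(2), of t0 0 t] pos that by simp
  hence up: "g t \<ge> g t0 + g1 t0 * (t - t0)" if "t \<ge> t0" for t
    using linear_lower_bound[OF d(1), of t0 "g1 t0" t] that by simp
  from growth[of "g1 t0 / 2"] m obtain T C where T: "\<And>t. t \<ge> T \<Longrightarrow> g t \<le> g1 t0 / 2 * t + C" by auto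
  define t where "t = max (max T t0) (2 * (C - g t0 + g1 t0 * t0 + 1) / g1 t0)"
  have t: "t \<ge> T" "t \<ge> t0" "t \<ge> 2 * (C - g t0 + g1 t0 * t0 + 1) / g1 t0" by (auto simp: t_def)
  have "g t0 + g1 t0 * (t - t0) \<le> g1 t0 / 2 * t + C" using up[OF t(2)] T[OF t(1)] by linarith
  hence "g1 t0 / 2 * t \<le> C - g t0 + g1 t0 * t0" by (simp add: algebra_simps)
  moreover have "g1 t0 / 2 * t \<ge> C - g t0 + g1 t0 * t0 + 1" using t(3) m by (simp add: field_simps)
  ultimately show False by simp
qed

text \<open>
  Both factors on the left have the sign of \<open>x - y\<close>; the right-hand side also shows when they vanish.
\<close>

lemma exp_diff_mult_nonneg: "(exp (x - y) - 1) * (exp x - exp y) = exp y * (exp (x - y) - 1)\<^sup>2" for x y :: real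
proof -
  have "exp x = exp (x - y) * exp y" by (simp flip: exp_add)
  thus ?thesis by (simp add: power2_eq_square algebra_simps)
qed

text \<open>
  The radial Toda system in logarithmic time. \<open>P\<close> is the Pohozaev quantity: differentiating it
  and using the equations leaves a multiple of \<open>Q\<close>, so that the integral of \<open>Q\<close> is determined by
  the limits of \<open>P\<close>. That \<open>P\<close> tends to \<open>0\<close> has two reasons. First, \<open>ln (\<Sum>i<K. exp (V i t))\<close> is convex and grows
  slower than any linear function, hence does not increase; as the sum of the \<open>V i\<close> is constant, all
  \<open>V i\<close> stay bounded. Second, \<open>E = (\<Sum>i<K. (V i)\<^sup>2)\<close> is then convex and bounded, hence its derivative
  stays nonpositive, while its second derivative dominates \<open>\<bar>P\<bar>\<close>. As \<open>P\<close> is monotone, a nonzero limit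
  would make the derivative of \<open>E\<close> grow without bound.
\<close>

lemma cyclic_toda_ode:
  fixes V V1 G :: "nat \<Rightarrow> real \<Rightarrow> real" and \<gamma> c :: real and K :: nat
  defines "Q \<equiv> \<lambda>t. \<Sum>i<K. G i t - exp (\<gamma> * t)"
  defines "P \<equiv> \<lambda>t. 4 * Q t - (\<Sum>i<K. (V1 i t)\<^sup>2) / 2"
  assumes K: "K > 0" and \<gamma>: "\<gamma> \<ge> 0"
    and G: "\<And>i t. G i t = exp (\<gamma> * t) * exp (V i t - V (nxt K i) t)"
    and V: "\<And>i t. i < K \<Longrightarrow> (V i has_real_derivative V1 i t) (at t)"
    and V1: "\<And>i t. i < K \<Longrightarrow> (V1 i has_real_derivative 4 * (G i t - G (prv K i) t)) (at t)"
    and sum: "\<And>t. (\<Sum>i<K. V i t) = c"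
    and growth: "\<And>\<epsilon>. \<epsilon> > 0 \<Longrightarrow> \<exists>T C. \<forall>i<K. \<forall>t\<ge>T. V i t \<le> \<epsilon> * t + C"
  shows "(P has_real_derivative 4 * \<gamma> * Q t) (at t)" "Q t \<ge> 0" "(P \<longlongrightarrow> 0) at_top"
proof -
  note [simp] = nxt_less[OF K] prv_less[OF K]
  have G': "G i = (\<lambda>t. exp (\<gamma> * t) * exp (V i t - V (nxt K i) t))" for i
    by (rule ext) (rule G)
  have contV: "continuous_on UNIV (V i)" if "i < K" for i
    using V[OF that] by (auto intro!: continuous_at_imp_continuous_on DERIV_isCont)
  have contG: "continuous_on UNIV (G i)" if "i < K" for i
    unfolding G' using that by (intro continuous_intros contV) auto
  have dG: "(G i has_real_derivative (\<gamma> + V1 i t - V1 (nxt K i) t) * G i t) (at t)" if "i < K" for i t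
  proof -
    note [derivative_intros] = V[OF that] V[of "nxt K i"]
    show ?thesis unfolding G' by (auto intro!: derivative_eq_intros simp: algebra_simps)
  qed
  have Q0: "Q t \<ge> 0" for t
  proof -
    have "(\<Sum>i<K. V i t - V (nxt K i) t) \<le> (\<Sum>i<K. exp (V i t - V (nxt K i) t) - 1)"
      using exp_ge_add_one_self[of "V _ t - V (nxt K _) t"] by (intro sum_mono) (simp add: algebra_simps)
    hence "0 \<le> (\<Sum>i<K. exp (V i t - V (nxt K i) t) - 1)" by (simp add: sum_subtractf sum_nxt[of "\<lambda>i. V i t"])
    hence "0 \<le> exp (\<gamma> * t) * (\<Sum>i<K. exp (V i t - V (nxt K i) t) - 1)" by simp
    also have "\<dots> = Q t" unfolding Q_def G sum_distrib_left by (simp add: algebra_simps)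
    finally show ?thesis .
  qed
  thus "Q t \<ge> 0" .
  have dP: "(P has_real_derivative 4 * \<gamma> * Q t) (at t)" for t
  proof -
    have "(P has_real_derivative 4 * (\<Sum>i<K. (\<gamma> + V1 i t - V1 (nxt K i) t) * G i t - \<gamma> * exp (\<gamma> * t))
        - (\<Sum>i<K. 2 * V1 i t * (4 * (G i t - G (prv K i) t))) / 2) (at t)"
      unfolding P_def Q_def
      by (auto intro!: derivative_eq_intros DERIV_sum dG V1 simp: mult_ac)
    also have "4 * (\<Sum>i<K. (\<gamma> + V1 i t - V1 (nxt K i) t) * G i t - \<gamma> * exp (\<gamma> * t))
        - (\<Sum>i<K. 2 * V1 i t * (4 * (G i t - G (prv K i) t))) / 2
      = 4 * (\<gamma> * Q t + (\<Sum>i<K. G i t * (V1 i t - V1 (nxt K i) t))) - 4 * (\<Sum>i<K. V1 i t * (G i t - G (prv K i) t))"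
    proof -
      have "(\<Sum>i<K. 2 * V1 i t * (4 * (G i t - G (prv K i) t))) / 2 = 4 * (\<Sum>i<K. V1 i t * (G i t - G (prv K i) t))"
        unfolding sum_divide_distrib sum_distrib_left by (intro sum.cong) auto
      thus ?thesis unfolding Q_def by (simp add: algebra_simps sum_distrib_left sum.distrib sum_subtractf)
    qed
    also have "\<dots> = 4 * \<gamma> * Q t"
      by (simp add: cyclic_summation_by_parts[of "\<lambda>i. V1 i t" "\<lambda>i. G i t"])
    finally show ?thesis .
  qed
  thus "(P has_real_derivative 4 * \<gamma> * Q t) (at t)" .

  have TV: "twice_diff 1 UNIV (V i) (V1 i) (\<lambda>t. 4 * (G i t - G (prv K i) t))" if "i \<in> {..<K}" for i
    using that by (intro twice_diff_real V V1 continuous_intros contG) auto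

  define L where "L t = ln (\<Sum>i<K. exp (V i t))" for t
  obtain L1 L2 where TL: "twice_diff 1 UNIV L L1 L2"
    and L2: "\<And>t. L2 t \<ge> (\<Sum>i<K. exp (V i t) * (4 * (G i t - G (prv K i) t))) / (\<Sum>i<K. exp (V i t))"
  proof (rule twice_diff_lse[OF _ _ TV])
    show "finite {..<K}" "{..<K} \<noteq> {}" using K by auto
  qed (auto simp: L_def[abs_def])
  have pos: "(\<Sum>i<K. exp (V i t)) > 0" for t using K by (intro sum_pos) auto
  have L2pos: "L2 t \<ge> 0" for t
  proof -
    have "(\<Sum>i<K. exp (V i t) * (4 * (G i t - G (prv K i) t))) = 4 * (\<Sum>i<K. exp (V i t) * (G i t - G (prv K i) t))"
      unfolding sum_distrib_left by (intro sum.cong) auto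
    also have "\<dots> = 4 * (\<Sum>i<K. G i t * (exp (V i t) - exp (V (nxt K i) t)))"
      by (simp add: cyclic_summation_by_parts[of "\<lambda>i. exp (V i t)" "\<lambda>i. G i t"])
    also have "\<dots> \<ge> 4 * (\<Sum>i<K. exp (\<gamma> * t) * (exp (V i t) - exp (V (nxt K i) t)))"
    proof (intro mult_left_mono sum_mono)
      fix i
      have "0 \<le> exp (\<gamma> * t) * (exp (V (nxt K i) t) * (exp (V i t - V (nxt K i) t) - 1)\<^sup>2)" by simp
      thus "exp (\<gamma> * t) * (exp (V i t) - exp (V (nxt K i) t)) \<le> G i t * (exp (V i t) - exp (V (nxt K i) t))"
        unfolding exp_diff_mult_nonneg[symmetric] G by (simp add: algebra_simps)
    qed auto
    also have "(\<Sum>i<K. exp (\<gamma> * t) * (exp (V i t) - exp (V (nxt K i) t))) = 0"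
      unfolding sum_distrib_left[symmetric] sum_subtractf by (simp add: sum_nxt[of "\<lambda>i. exp (V i t)"])
    finally have "0 \<le> (\<Sum>i<K. exp (V i t) * (4 * (G i t - G (prv K i) t))) / (\<Sum>i<K. exp (V i t))"
      using pos[of t] by simp
    thus ?thesis using L2[of t] by linarith
  qed
  have "L1 t \<le> 0" for t
  proof (rule convex_sublinear_nonincreasing[OF twice_diff_real_DERIV[OF TL] L2pos])
    fix \<epsilon> :: real assume "\<epsilon> > 0"
    from growth[OF this] obtain T C where T: "\<And>i t. i < K \<Longrightarrow> t \<ge> T \<Longrightarrow> V i t \<le> \<epsilon> * t + C" by blast
    have "L t \<le> \<epsilon> * t + (C + ln (real K))" if "t \<ge> T" for t
    proof -
      have "(\<Sum>i<K. exp (V i t)) \<le> (\<Sum>i<K. exp (\<epsilon> * t + C))" using T that by (intro sum_mono) auto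
      hence "L t \<le> ln (real K * exp (\<epsilon> * t + C))" unfolding L_def using pos[of t] K by simp
      also have "\<dots> = ln (real K) + (\<epsilon> * t + C)" using K by (simp add: ln_mult)
      finally show ?thesis by simp
    qed
    thus "\<exists>T C. \<forall>t\<ge>T. L t \<le> \<epsilon> * t + C" by blast
  qed
  hence L_le: "L t \<le> L 0" if "t \<ge> 0" for t
    using DERIV_nonpos_imp_nonincreasing[OF that, of L] twice_diff_real_DERIV(1)[OF TL] by blast
  have V_le: "V i t \<le> L 0" if "i < K" "t \<ge> 0" for i t
  proof -
    have "exp (V i t) \<le> (\<Sum>i<K. exp (V i t))" using that by (intro member_le_sum) auto
    hence "V i t \<le> L t" unfolding L_def using pos[of t] by (simp add: ln_ge_iff)
    thus ?thesis using L_le[OF that(2)] by simp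
  qed
  define M where "M = \<bar>c\<bar> + real K * \<bar>L 0\<bar>"
  have V_abs: "\<bar>V i t\<bar> \<le> M" if i: "i < K" and t: "t \<ge> 0" for i t
  proof -
    have "c = V i t + (\<Sum>j\<in>{..<K} - {i}. V j t)"
      using sum[of t] i by (subst (asm) sum.remove[of _ i]) auto
    also have "(\<Sum>j\<in>{..<K} - {i}. V j t) \<le> (\<Sum>j\<in>{..<K} - {i}. \<bar>L 0\<bar>)"
      using V_le t by (intro sum_mono) fastforce
    also have "\<dots> = real (card ({..<K} - {i})) * \<bar>L 0\<bar>" by simp
    also have "\<dots> \<le> real K * \<bar>L 0\<bar>"
      using card_mono[of "{..<K}" "{..<K} - {i}"] by (intro mult_right_mono) auto
    finally have "V i t \<ge> - M" unfolding M_def by linarith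
    moreover have "real K * \<bar>L 0\<bar> \<ge> 1 * \<bar>L 0\<bar>" using K by (intro mult_right_mono) auto
    hence "V i t \<le> M" using V_le[OF i t] unfolding M_def by linarith
    ultimately show ?thesis by simp
  qed

  define E where "E t = (\<Sum>i<K. (V i t)\<^sup>2)" for t
  define E1 where "E1 t = (\<Sum>i<K. 2 * V i t * V1 i t)" for t
  define E2 where "E2 t = (\<Sum>i<K. 2 * (V1 i t)\<^sup>2 + 2 * V i t * (4 * (G i t - G (prv K i) t)))" for t
  have TE: "twice_diff 1 UNIV E E1 E2"
    unfolding E_def E1_def E2_def by (intro twice_diff_sum twice_diff_square TV)
  have E2: "E2 t \<ge> \<bar>P t\<bar>" for t
  proof -
    have "E2 t = 2 * (\<Sum>i<K. (V1 i t)\<^sup>2) + 8 * (\<Sum>i<K. V i t * (G i t - G (prv K i) t))"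
      unfolding E2_def sum.distrib sum_distrib_left by (intro arg_cong2[where f = "(+)"] sum.cong) auto
    also have "\<dots> = 2 * (\<Sum>i<K. (V1 i t)\<^sup>2) + 8 * (\<Sum>i<K. G i t * (V i t - V (nxt K i) t))"
      by (simp add: cyclic_summation_by_parts[of "\<lambda>i. V i t" "\<lambda>i. G i t"])
    finally have e: "E2 t = 2 * (\<Sum>i<K. (V1 i t)\<^sup>2) + 8 * (\<Sum>i<K. G i t * (V i t - V (nxt K i) t))" .
    have "Q t \<le> (\<Sum>i<K. G i t * (V i t - V (nxt K i) t))"
      unfolding Q_def
    proof (intro sum_mono)
      fix i
      define d where "d = V i t - V (nxt K i) t"
      \<comment> \<open>this is \<open>exp d - 1 \<le> d * exp d\<close>, up to rearrangement\<close>
      have "exp d * (1 - d) \<le> exp d * exp (- d)"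
        using exp_ge_add_one_self[of "- d"] by (intro mult_left_mono) auto
      hence "exp d - 1 \<le> exp d * d" by (simp add: algebra_simps flip: exp_add)
      hence "exp (\<gamma> * t) * (exp d - 1) \<le> exp (\<gamma> * t) * (exp d * d)" by simp
      thus "G i t - exp (\<gamma> * t) \<le> G i t * (V i t - V (nxt K i) t)"
        unfolding G d_def by (simp add: algebra_simps)
    qed
    moreover have "(\<Sum>i<K. (V1 i t)\<^sup>2) \<ge> 0" by (intro sum_nonneg) auto
    ultimately show ?thesis unfolding e P_def using Q0[of t] by linarith
  qed
  have E1: "E1 t \<le> 0" for t
  proof (rule convex_sublinear_nonincreasing[OF twice_diff_real_DERIV[OF TE]])
    show "E2 t \<ge> 0" for t using E2[of t] by linarith
    fix \<epsilon> :: real assume e: "\<epsilon> > 0"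
    have "E t \<le> \<epsilon> * t + real K * M\<^sup>2" if "t \<ge> 0" for t
    proof -
      have "E t \<le> (\<Sum>i<K. M\<^sup>2)" unfolding E_def using V_abs[OF _ that]

        by (intro sum_mono abs_le_square_iff[THEN iffD1]) fastforce
      moreover have "\<epsilon> * t \<ge> 0" using e that by simp
      ultimately show ?thesis by simp
    qed
    thus "\<exists>T C. \<forall>t\<ge>T. E t \<le> \<epsilon> * t + C" by blast
  qed
  have no: False if m: "m > 0" and ge: "\<And>t. t \<ge> t0 \<Longrightarrow> E2 t \<ge> m" for m t0
  proof -
    define t where "t = t0 + (\<bar>E1 t0\<bar> + 1) / m"
    have "t \<ge> t0" using m by (simp add: t_def)
    from linear_lower_bound[OF twice_diff_real_DERIV(2)[OF TE] ge this]
    have "E1 t0 + m * (t - t0) \<le> 0" using E1[of t] by linarith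
    thus False using m by (simp add: t_def)
  qed
  have Pmono: "P s \<le> P t" if "s \<le> t" for s t
  proof (rule DERIV_nonneg_imp_nondecreasing[OF that])
    fix x show "\<exists>y. (P has_real_derivative y) (at x) \<and> y \<ge> 0"
      using dP[of x] Q0[of x] \<gamma> by (intro exI[of _ "4 * \<gamma> * Q x"]) auto
  qed
  have P_le: "P t \<le> 0" for t
  proof (rule ccontr)
    assume "\<not> P t \<le> 0"
    hence "P t > 0" by simp
    moreover have "E2 s \<ge> P t" if "s \<ge> t" for s using Pmono[OF that] E2[of s] by linarith
    ultimately show False by (rule no)
  qed
  show "(P \<longlongrightarrow> 0) at_top"
  proof (rule order_tendstoI)
    fix a :: real assume a: "a < 0"
    have "\<exists>t0. P t0 > a"
    proof (rule ccontr)
      assume "\<not> (\<exists>t0. P t0 > a)"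
      hence le: "P t \<le> a" for t by (simp add: not_less)
      have "E2 t \<ge> - a" for t using le[of t] E2[of t] by linarith
      thus False using no[of "- a" 0] a by simp
    qed
    then obtain t0 where t0: "P t0 > a" ..
    show "\<forall>\<^sub>F x in at_top. a < P x"
      using eventually_ge_at_top[of t0] by eventually_elim (use Pmono t0 in force)
  next
    fix a :: real assume "0 < a"
    thus "\<forall>\<^sub>F x in at_top. P x < a" using P_le by (intro always_eventually) (auto intro: le_less_trans)
  qed
qed

section \<open>Integration of functions of the modulus\<close>

lemma emeasure_log_annulus:
  fixes a b :: real
  assumes "a \<le> b"
  shows "emeasure lborel {z::complex. ln (norm z) \<in> {a<..b}} = ennreal (pi * exp (2 * b) - pi * exp (2 * a))"
proof -
  let ?A = "{z::complex. ln (norm z) \<in> {a<..b}}"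
  \<comment> \<open>the logarithm has the default value \<open>0\<close> at \<open>0\<close>, so the origin has to be left out\<close>
  have "AE z::complex in lborel. z \<noteq> 0" by (rule AE_lborel_singleton)
  hence ae: "AE z in lborel. z \<in> ?A \<longleftrightarrow> z \<in> cball 0 (exp b) - cball 0 (exp a)"
  proof eventually_elim
    case (elim z)
    hence "norm z > 0" by simp
    hence "ln (norm z) \<le> b \<longleftrightarrow> norm z \<le> exp b" "a < ln (norm z) \<longleftrightarrow> exp a < norm z"
      by (metis exp_le_cancel_iff exp_ln) (metis \<open>norm z > 0\<close> exp_less_cancel_iff exp_ln)
    thus ?case by auto
  qed
  have "emeasure lborel ?A = emeasure lborel (cball 0 (exp b) - cball 0 (exp a) :: complex set)"
    by (rule emeasure_eq_AE[OF ae]) measurable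
  also have "\<dots> = emeasure lborel (cball 0 (exp b) :: complex set) - emeasure lborel (cball 0 (exp a) :: complex set)"
    using assms order_trans[of _ "exp a" "exp b"] by (intro emeasure_Diff) (auto simp: emeasure_cball)
  also have "\<dots> = ennreal (pi * exp (2 * b) - pi * exp (2 * a))"
    by (simp add: emeasure_cball unit_ball_vol_2 exp_double ennreal_minus)
  finally show ?thesis .
qed

text \<open>
  Polar coordinates for functions of the modulus: the area \<open>2 * pi * r dr\<close> becomes \<open>2 * pi * exp (2 * t) dt\<close>
  in \<open>t = ln r\<close>. The two measures agree on half-open intervals, that is on annuli.
\<close>

lemma distr_log_norm:
  "distr lborel borel (\<lambda>z::complex. ln (norm z)) = density lborel (\<lambda>t. ennreal (2 * pi * exp (2 * t)))"
  (is "?M = ?N")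
proof (rule measure_eqI_generator_eq)
  let ?E = "range (\<lambda>(a, b). {a <.. b::real})"
  show "Int_stable ?E"
  proof (rule Int_stableI)
    fix X Y assume "X \<in> ?E" "Y \<in> ?E"
    then obtain a b c d where "X = {a<..b}" "Y = {c<..d}" by auto
    hence "X \<inter> Y = {max a c<..min b d}" by auto
    thus "X \<inter> Y \<in> ?E" by auto
  qed
  show "?E \<subseteq> Pow UNIV" by simp
  have "sets (borel :: real measure) = sigma_sets UNIV ?E"
    unfolding borel_sigma_sets_Ioc by (rule sets_measure_of) simp
  thus "sets ?M = sigma_sets UNIV ?E" "sets ?N = sigma_sets UNIV ?E" by simp_all
  have eM: "emeasure ?M {a<..b} = ennreal (pi * exp (2 * b) - pi * exp (2 * a))" if "a \<le> b" for a b
    using emeasure_log_annulus[OF that] by (subst emeasure_distr) (auto simp: vimage_def)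
  show "emeasure ?M X = emeasure ?N X" if "X \<in> ?E" for X
  proof -
    from that obtain a b where X: "X = {a<..b}" by (auto simp: image_iff)
    show ?thesis
    proof (cases "a \<le> b")
      case True
      have "emeasure ?N X = (\<integral>\<^sup>+t. ennreal (2 * pi * exp (2 * t)) * indicator {a<..b} t \<partial>lborel)"
        unfolding X by (rule emeasure_density) auto
      also have "\<dots> = (\<integral>\<^sup>+t. ennreal (2 * pi * exp (2 * t)) * indicator {a..b} t \<partial>lborel)"
        by (rule nn_integral_cong_AE, rule AE_mp[OF AE_lborel_singleton[of a]])
           (auto split: split_indicator)
      also have "\<dots> = ennreal (pi * exp (2 * b) - pi * exp (2 * a))"
        by (rule nn_integral_FTC_Icc[OF _ _ _ True]) (auto intro!: derivative_eq_intros)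
      finally show ?thesis using eM[OF True] by (simp add: X)
    qed (simp add: X)
  qed
  let ?A = "\<lambda>n. {- real n<..real n}"
  show "range ?A \<subseteq> ?E" by auto
  show "(\<Union>n. ?A n) = UNIV"
  proof (intro equalityI subsetI UNIV_I)
    fix x :: real
    obtain n where "\<bar>x\<bar> < real n" using reals_Archimedean2 by blast
    hence "x \<in> ?A n" by auto
    thus "x \<in> (\<Union>n. ?A n)" by blast
  qed
  show "emeasure ?M (?A n) \<noteq> \<infinity>" for n by (subst eM) auto
qed

lemma FTC_nonneg_UNIV:
  fixes f F :: "real \<Rightarrow> real"
  assumes F: "\<And>x. (F has_real_derivative f x) (at x)" and f: "continuous_on UNIV f" "\<And>x. f x \<ge> 0"
    and lim: "(F \<longlongrightarrow> A) at_bot" "(F \<longlongrightarrow> B) at_top"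
  shows "integrable lborel f" "(\<integral>x. f x \<partial>lborel) = B - A"
proof -
  have U: "einterval (-\<infinity>) \<infinity> = UNIV" by (auto simp: einterval_iff)
  have c: "isCont f x" for x using f(1) by (simp add: continuous_on_eq_continuous_at)
  note I = interval_integral_FTC_nonneg[of "-\<infinity>" \<infinity> F f A B]
  have "set_integrable lborel (einterval (-\<infinity>) \<infinity>) f"
    by (rule I(1)) (use F c f(2) lim in \<open>auto simp: ereal_tendsto_simps\<close>)
  moreover have "(LBINT x=-\<infinity>..\<infinity>. f x) = B - A"
    by (rule I(2)) (use F c f(2) lim in \<open>auto simp: ereal_tendsto_simps\<close>)
  ultimately show "integrable lborel f" "(\<integral>x. f x \<partial>lborel) = B - A"
    by (simp_all add: U set_integrable_def set_lebesgue_integral_def interval_lebesgue_integral_def)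
qed

lemma integral_radial:
  fixes \<rho> :: "complex \<Rightarrow> real" and g F :: "real \<Rightarrow> real"
  assumes \<rho>: "\<rho> \<in> borel_measurable borel" "\<And>z. z \<noteq> 0 \<Longrightarrow> \<rho> z = g (ln (norm z))"
    and g: "continuous_on UNIV g" "\<And>t. g t \<ge> 0"
    and F: "\<And>t. (F has_real_derivative exp (2 * t) * g t) (at t)"
    and lim: "(F \<longlongrightarrow> A) at_bot" "(F \<longlongrightarrow> B) at_top"
  shows "integrable lborel \<rho>" "(\<integral>z. \<rho> z \<partial>lborel) = 2 * pi * (B - A)"
proof -
  have gm [measurable]: "g \<in> borel_measurable borel" using g(1) by (rule borel_measurable_continuous_onI)
  have ae: "AE z in lborel. \<rho> z = g (ln (norm z))"
    using AE_lborel_singleton[of 0] by eventually_elim (rule \<rho>(2))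
  note FTC = FTC_nonneg_UNIV[OF F _ _ lim]
  have c: "continuous_on UNIV (\<lambda>t. exp (2 * t) * g t)" by (intro continuous_intros g)
  have "integrable (density lborel (\<lambda>t. ennreal (2 * pi * exp (2 * t)))) g"
    using FTC(1)[OF c] g(2) by (subst integrable_density) (auto simp: mult.assoc)
  hence "integrable lborel (\<lambda>z::complex. g (ln (norm z)))"
    unfolding distr_log_norm[symmetric] by (subst (asm) integrable_distr_eq) auto
  thus "integrable lborel \<rho>"
    using ae \<rho>(1) by (subst integrable_cong_AE[of _ _ "\<lambda>z. g (ln (norm z))"]) auto
  have "(\<integral>z. \<rho> z \<partial>lborel) = (\<integral>z. g (ln (norm (z::complex))) \<partial>lborel)"
    using ae \<rho>(1) by (intro integral_cong_AE) auto
  also have "\<dots> = (\<integral>t. g t \<partial>density lborel (\<lambda>t. ennreal (2 * pi * exp (2 * t))))"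
    unfolding distr_log_norm[symmetric] by (subst integral_distr) auto
  also have "\<dots> = (\<integral>t. 2 * pi * (exp (2 * t) * g t) \<partial>lborel)"
    by (subst integral_density) (auto simp: mult.assoc)
  also have "\<dots> = 2 * pi * (B - A)" using FTC(2)[OF c] g(2) by simp
  finally show "(\<integral>z. \<rho> z \<partial>lborel) = 2 * pi * (B - A)" .
qed

section \<open>Cyclic Toda subsolutions on the plane\<close>

text \<open>
  For metrics with \<open>exp (u i)\<close> as the squared norm of the frame vector \<open>i\<close>, this is the squared norm
  of the component of the cyclic Higgs field that maps the frame vector \<open>nxt K i\<close> to the frame vector \<open>i\<close>.
\<close>

definition toda_term :: "nat \<Rightarrow> (nat \<Rightarrow> nat) \<Rightarrow> (nat \<Rightarrow> complex \<Rightarrow> real) \<Rightarrow> nat \<Rightarrow> complex \<Rightarrow> real" where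
  "toda_term K b u i z = norm z ^ (2 * b i) * exp (u i z - u (nxt K i) z)"

lemma twice_diff_dilate:
  fixes c d :: complex
  assumes "twice_diff (c * d) UNIV f f1 f2"
  shows "twice_diff d UNIV (\<lambda>z. f (c * z)) (\<lambda>z. f1 (c * z)) (\<lambda>z. f2 (c * z))"
proof -
  note D = twice_diffD[OF assms]
  have e: "c * (x + t *\<^sub>R d) = c * x + t *\<^sub>R (c * d)" for x t by (simp add: distrib_left)
  have c: "continuous_on UNIV (\<lambda>z. g (c * z))" if "continuous_on UNIV g" for g :: "complex \<Rightarrow> real"
    by (rule continuous_on_compose2[OF that]) (auto intro!: continuous_intros)
  show ?thesis unfolding twice_diff_def e
    by (intro conjI ballI c D UNIV_I)
qed

lemma uniform_upper_bounds:
  fixes f g :: "nat \<Rightarrow> complex \<Rightarrow> real"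
  assumes "\<And>i. i < K \<Longrightarrow> \<exists>R C. \<forall>z. norm z \<ge> R \<longrightarrow> f i z \<le> g i z + C"
  shows "\<exists>R C. R \<ge> 1 \<and> C \<ge> 0 \<and> (\<forall>i<K. \<forall>z. norm z \<ge> R \<longrightarrow> f i z \<le> g i z + C)"
proof -
  from assms have "\<forall>i. \<exists>R C. i < K \<longrightarrow> (\<forall>z. norm z \<ge> R \<longrightarrow> f i z \<le> g i z + C)" by blast
  then obtain R C where RC: "\<And>i z. i < K \<Longrightarrow> norm z \<ge> R i \<Longrightarrow> f i z \<le> g i z + C i"
    unfolding choice_iff by blast
  have R: "R i \<le> 1 + (\<Sum>i<K. \<bar>R i\<bar>)" and C: "C i \<le> (\<Sum>i<K. \<bar>C i\<bar>)" if "i < K" for i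
    using member_le_sum[of i "{..<K}" "\<lambda>i. \<bar>R i\<bar>"] member_le_sum[of i "{..<K}" "\<lambda>i. \<bar>C i\<bar>"] that by auto
  have "f i z \<le> g i z + (\<Sum>i<K. \<bar>C i\<bar>)" if "i < K" "norm z \<ge> 1 + (\<Sum>i<K. \<bar>R i\<bar>)" for i z
    using RC[OF that(1), of z] R[OF that(1)] C[OF that(1)] that(2) by linarith
  thus ?thesis by (intro exI[of _ "1 + (\<Sum>i<K. \<bar>R i\<bar>)"] exI[of _ "\<Sum>i<K. \<bar>C i\<bar>"]) (auto intro: sum_nonneg)
qed

text \<open>
  \<open>D d i\<close> and \<open>DD d i\<close> are the first and second derivatives of \<open>u i\<close> in the direction \<open>d\<close>, and \<open>lap i\<close> is
  its Laplacian, computed from any orthonormal pair of directions. A differential inequality and a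
  one-sided growth bound are assumed; the Toda equation and the two-sided bound are consequences.
\<close>

locale cyclic_toda_subsolution =
  fixes K N :: nat and b :: "nat \<Rightarrow> nat" and \<alpha> :: "nat \<Rightarrow> real"
    and u :: "nat \<Rightarrow> complex \<Rightarrow> real" and D DD :: "complex \<Rightarrow> nat \<Rightarrow> complex \<Rightarrow> real" and lap :: "nat \<Rightarrow> complex \<Rightarrow> real"
  assumes K: "K > 0" and weights: "filtration_weights K N b \<alpha>"
    and smooth: "\<And>d i. i < K \<Longrightarrow> twice_diff d UNIV (u i) (D d i) (DD d i)"
    and lap: "\<And>c i z. i < K \<Longrightarrow> norm c = 1 \<Longrightarrow> DD c i z + DD (c * \<i>) i z = lap i z"
    and subsolution: "\<And>i z. i < K \<Longrightarrow> 4 * (toda_term K b u i z - toda_term K b u (prv K i) z) \<le> lap i z"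
    and growth: "\<And>i \<epsilon>. i < K \<Longrightarrow> \<epsilon> > 0 \<Longrightarrow>
      \<exists>R C. \<forall>z. norm z \<ge> R \<longrightarrow> u i z \<le> (\<epsilon> - 2 * \<alpha> i) * ln (norm z) + C"
begin

abbreviation "w \<equiv> toda_term K b u"

lemmas nxt_less_K [simp] = nxt_less[OF K] and prv_less_K [simp] = prv_less[OF K]

lemma weight_sum: "(\<Sum>i<K. \<alpha> i) = 0"
  and weight_diff: "i < K \<Longrightarrow> real (b i) - real N / real K = \<alpha> i - \<alpha> (nxt K i)"
  using weights unfolding filtration_weights_def nxt_def by blast+

lemma lap_1: "i < K \<Longrightarrow> DD 1 i z + DD \<i> i z = lap i z"
  using lap[of i 1 z] by simp

lemma uniform_growth:
  assumes "\<epsilon> > 0"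
  shows "\<exists>R C. R \<ge> 1 \<and> C \<ge> 0 \<and> (\<forall>i<K. \<forall>z. norm z \<ge> R \<longrightarrow> u i z \<le> (\<epsilon> - 2 * \<alpha> i) * ln (norm z) + C)"
  by (rule uniform_upper_bounds, rule growth[OF _ assms])

text \<open>
  The sum \<open>S\<close> of the \<open>u i\<close> is subharmonic, because the Toda terms cancel cyclically, and has sublogarithmic
  growth, because the weights sum to zero. The Liouville theorem is applied to \<open>ln (1 + exp S)\<close>, a strictly
  convex increasing function of \<open>S\<close>: its Laplacian also sees the gradient of \<open>S\<close>, which must vanish too.
\<close>

lemma sum_u_critical: "(\<Sum>i<K. lap i z) = 0" "(\<Sum>i<K. D 1 i z) = 0" "(\<Sum>i<K. D \<i> i z) = 0"
proof -
  define S where "S z = (\<Sum>i<K. u i z)" for z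
  define S1 where "S1 d z = (\<Sum>i<K. D d i z)" for d z
  define S2 where "S2 d z = (\<Sum>i<K. DD d i z)" for d z
  have S: "twice_diff d UNIV S (S1 d) (S2 d)" for d
    unfolding S_def S1_def S2_def by (intro twice_diff_sum smooth) auto
  have lapS: "S2 1 z + S2 \<i> z = (\<Sum>i<K. lap i z)" for z
    unfolding S2_def sum.distrib[symmetric] by (intro sum.cong) (auto simp: lap_1)
  have lapS0: "(\<Sum>i<K. lap i z) \<ge> 0" for z
  proof -
    have "(\<Sum>i<K. lap i z) \<ge> (\<Sum>i<K. 4 * (w i z - w (prv K i) z))"
      by (intro sum_mono subsolution) auto
    also have "(\<Sum>i<K. 4 * (w i z - w (prv K i) z)) = 0"
      unfolding sum_distrib_left[symmetric] sum_subtractf by (simp add: sum_prv[of "\<lambda>i. w i z"])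
    finally show ?thesis .
  qed
  define p where "p z = exp (S z) / (1 + exp (S z))" for z
  have den: "1 + exp (S z) > 0" for z by (simp add: add_pos_pos)
  note F = twice_diff_ln[OF twice_diff_add[OF twice_diff_const[of _ _ 1] twice_diff_exp[OF S]], OF den]
  have F2: "(0 + exp (S z) * ((S1 d z)\<^sup>2 + S2 d z)) / (1 + exp (S z)) - ((0 + exp (S z) * S1 d z) / (1 + exp (S z)))\<^sup>2
    = p z * (1 - p z) * (S1 d z)\<^sup>2 + p z * S2 d z" for d z
    by (simp add: p_def power2_eq_square algebra_simps add_divide_distrib)
  have p: "p z > 0" "p z < 1" for z using den[of z] by (auto simp: p_def)
  have pq: "p z * (1 - p z) > 0" for z using p[of z] by simp
  have "(p z * (1 - p z) * (S1 1 z)\<^sup>2 + p z * S2 1 z) + (p z * (1 - p z) * (S1 \<i> z)\<^sup>2 + p z * S2 \<i> z) = 0" for z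
  proof (rule subharmonic_sublogarithmic[OF F[unfolded F2] F[unfolded F2]])
    fix z
    have "(p z * (1 - p z) * (S1 1 z)\<^sup>2 + p z * S2 1 z) + (p z * (1 - p z) * (S1 \<i> z)\<^sup>2 + p z * S2 \<i> z)
      = p z * (1 - p z) * ((S1 1 z)\<^sup>2 + (S1 \<i> z)\<^sup>2) + p z * (\<Sum>i<K. lap i z)"
      unfolding lapS[symmetric] by (simp add: algebra_simps)
    also have "\<dots> \<ge> 0" using pq[of z] p[of z] lapS0[of z] by (intro add_nonneg_nonneg mult_nonneg_nonneg) auto
    finally show "(p z * (1 - p z) * (S1 1 z)\<^sup>2 + p z * S2 1 z) + (p z * (1 - p z) * (S1 \<i> z)\<^sup>2 + p z * S2 \<i> z) \<ge> 0" .
  next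
    fix \<epsilon> :: real assume e: "\<epsilon> > 0"
    from uniform_growth[of "\<epsilon> / real K"] e K obtain R C where RC: "R \<ge> 1" "C \<ge> 0"
      "\<And>i z. i < K \<Longrightarrow> norm z \<ge> R \<Longrightarrow> u i z \<le> (\<epsilon> / real K - 2 * \<alpha> i) * ln (norm z) + C" by auto
    have "ln (1 + exp (S z)) \<le> \<epsilon> * ln (norm z) + (ln 2 + real K * C)" if z: "norm z \<ge> R" for z
    proof -
      have "S z \<le> (\<Sum>i<K. (\<epsilon> / real K - 2 * \<alpha> i) * ln (norm z) + C)"
        unfolding S_def using RC(3) z by (intro sum_mono) auto
      also have "\<dots> = (\<Sum>i<K. \<epsilon> / real K - 2 * \<alpha> i) * ln (norm z) + real K * C"
        by (simp add: sum.distrib sum_distrib_right)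
      also have "(\<Sum>i<K. \<epsilon> / real K - 2 * \<alpha> i) = \<epsilon>"
        using K by (simp add: sum_subtractf weight_sum flip: sum_distrib_left)
      finally have s: "S z \<le> \<epsilon> * ln (norm z) + real K * C" .
      define M where "M = \<epsilon> * ln (norm z) + real K * C"
      have "M \<ge> 0" using e z RC unfolding M_def by (intro add_nonneg_nonneg mult_nonneg_nonneg) auto
      hence "1 + exp (S z) \<le> 2 * exp M" using s exp_ge_zero[of M] unfolding M_def[symmetric]
        by (smt (verit, best) exp_le_cancel_iff one_le_exp_iff)
      hence "ln (1 + exp (S z)) \<le> ln (2 * exp M)" using den[of z] by (subst ln_le_cancel_iff) auto
      also have "\<dots> = ln 2 + M" by (simp add: ln_mult)
      finally show ?thesis by (simp add: M_def)
    qed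
    thus "\<exists>R C. \<forall>z. norm z \<ge> R \<longrightarrow> ln (1 + exp (S z)) \<le> \<epsilon> * ln (norm z) + C" by blast
  qed
  hence "p z * (1 - p z) * ((S1 1 z)\<^sup>2 + (S1 \<i> z)\<^sup>2) + p z * (\<Sum>i<K. lap i z) = 0"
    unfolding lapS[symmetric] by (simp add: algebra_simps)
  moreover have "p z * (1 - p z) * ((S1 1 z)\<^sup>2 + (S1 \<i> z)\<^sup>2) \<ge> 0" "p z * (\<Sum>i<K. lap i z) \<ge> 0"
    using pq[of z] p[of z] lapS0[of z] by (auto intro!: mult_nonneg_nonneg)
  ultimately have "p z * (1 - p z) * ((S1 1 z)\<^sup>2 + (S1 \<i> z)\<^sup>2) = 0" "p z * (\<Sum>i<K. lap i z) = 0" by linarith+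
  thus "(\<Sum>i<K. lap i z) = 0" "(\<Sum>i<K. D 1 i z) = 0" "(\<Sum>i<K. D \<i> i z) = 0"
    using pq[of z] p[of z] by (auto simp: S1_def sum_power2_eq_zero_iff)
qed

text \<open>
  The defects in the differential inequalities are nonnegative and sum to the Laplacian of the
  sum of the \<open>u i\<close>, which is zero.
\<close>

lemma toda_equation:
  assumes "i < K"
  shows "lap i z = 4 * (w i z - w (prv K i) z)"
proof -
  have "(\<Sum>i<K. lap i z - 4 * (w i z - w (prv K i) z)) = 0"
    by (simp add: sum_subtractf sum_u_critical(1) sum_prv[of "\<lambda>i. w i z"] flip: sum_distrib_left)
  moreover have "lap i z - 4 * (w i z - w (prv K i) z) \<ge> 0" if "i < K" for i
    using subsolution[OF that, of z] by simp
  ultimately have "\<forall>i\<in>{..<K}. lap i z - 4 * (w i z - w (prv K i) z) = 0"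
    by (subst (asm) sum_nonneg_eq_0_iff) auto
  thus ?thesis using assms by auto
qed

lemma sum_u_constant: "(\<Sum>i<K. u i z) = (\<Sum>i<K. u i 0)"
proof -
  define S where "S z = (\<Sum>i<K. u i z)" for z
  have line: "S (z + t *\<^sub>R d) = S z" if "d = 1 \<or> d = \<i>" for z d and t :: real
  proof -
    have T: "twice_diff d UNIV S (\<lambda>z. \<Sum>i<K. D d i z) (\<lambda>z. \<Sum>i<K. DD d i z)" for d
      unfolding S_def by (intro twice_diff_sum smooth) auto
    have "((\<lambda>t. S (z + t *\<^sub>R d)) has_real_derivative 0) (at t)" for t
    proof -
      have "((\<lambda>s. S ((z + t *\<^sub>R d) + s *\<^sub>R d)) has_real_derivative 0) (at 0)"
        using twice_diffD(4)[OF T, of "z + t *\<^sub>R d" d] that sum_u_critical(2,3) by auto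
      hence "((\<lambda>s. S (z + (s + t) *\<^sub>R d)) has_real_derivative 0) (at 0)"
        by (simp add: algebra_simps)
      thus ?thesis using DERIV_shift[of "\<lambda>t. S (z + t *\<^sub>R d)" 0 0 t] by simp
    qed
    hence "(\<lambda>t. S (z + t *\<^sub>R d)) t = (\<lambda>t. S (z + t *\<^sub>R d)) 0" by (intro DERIV_isconst_all) auto
    thus ?thesis by simp
  qed
  have "z = 0 + Re z *\<^sub>R 1 + Im z *\<^sub>R \<i>" by (simp add: complex_eq_iff)
  hence "S z = S 0" using line by metis
  thus ?thesis by (simp add: S_def)
qed

text \<open>
  Upper bounds for all other components bound each component from below, since the sum is constant.
\<close>

lemma lower_growth:
  assumes e: "\<epsilon> > 0"
  shows "\<exists>R C. R \<ge> 1 \<and> (\<forall>i<K. \<forall>z. norm z \<ge> R \<longrightarrow> (- \<epsilon> - 2 * \<alpha> i) * ln (norm z) - C \<le> u i z)"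
proof -
  from uniform_growth[of "\<epsilon> / real K"] e K obtain R C where RC: "R \<ge> 1" "C \<ge> 0"
    "\<And>i z. i < K \<Longrightarrow> norm z \<ge> R \<Longrightarrow> u i z \<le> (\<epsilon> / real K - 2 * \<alpha> i) * ln (norm z) + C" by auto
  let ?s = "\<Sum>i<K. u i 0"
  have "(- \<epsilon> - 2 * \<alpha> i) * ln (norm z) - (real K * C - ?s) \<le> u i z" if i: "i < K" and z: "norm z \<ge> R" for i z
  proof -
    let ?J = "{..<K} - {i}"
    have l: "ln (norm z) \<ge> 0" using z RC by simp
    have "?s = u i z + (\<Sum>j\<in>?J. u j z)"
      using sum_u_constant[of z] i by (subst (asm) sum.remove[of _ i]) auto
    also have "(\<Sum>j\<in>?J. u j z) \<le> (\<Sum>j\<in>?J. (\<epsilon> / real K - 2 * \<alpha> j) * ln (norm z) + C)"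
      using RC(3) z by (intro sum_mono) auto
    also have "\<dots> = (\<Sum>j<K. (\<epsilon> / real K - 2 * \<alpha> j) * ln (norm z) + C) - ((\<epsilon> / real K - 2 * \<alpha> i) * ln (norm z) + C)"
      using i by (subst (2) sum.remove[of _ i]) auto
    also have "(\<Sum>j<K. (\<epsilon> / real K - 2 * \<alpha> j) * ln (norm z) + C)
      = (\<Sum>j<K. \<epsilon> / real K - 2 * \<alpha> j) * ln (norm z) + real K * C"
      by (simp add: sum.distrib sum_distrib_right)
    also have "(\<Sum>j<K. \<epsilon> / real K - 2 * \<alpha> j) = \<epsilon>"
      using K by (simp add: sum_subtractf weight_sum flip: sum_distrib_left)
    finally have "?s \<le> u i z + \<epsilon> * ln (norm z) + real K * C - (\<epsilon> / real K * ln (norm z) - 2 * \<alpha> i * ln (norm z) + C)"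
      by (simp add: algebra_simps)
    moreover have "\<epsilon> / real K * ln (norm z) \<ge> 0" using e K l by simp
    ultimately show ?thesis using RC(2) by (simp add: algebra_simps)
  qed
  thus ?thesis using RC(1) by blast
qed

text \<open>
  The rotated functions solve the same equations, as only \<open>norm z\<close> enters them. The log-sum-exp of
  the differences \<open>\<delta> i\<close> is subharmonic with sublogarithmic growth, so its Laplacian vanishes, and this
  forces \<open>\<delta> i\<close> and \<open>\<delta> (nxt K i)\<close> to agree where the Toda terms are positive. As the \<open>\<delta> i\<close> sum to zero, all vanish.
\<close>

lemma radial:
  assumes c: "norm c = 1" and i: "i < K"
  shows "u i (c * z) = u i z"
proof (cases "z = 0")
  case False
  define \<delta> where "\<delta> i z = u i (c * z) - u i z" for i z
  have T: "twice_diff d UNIV (\<delta> i) (\<lambda>z. D (c * d) i (c * z) - D d i z) (\<lambda>z. DD (c * d) i (c * z) - DD d i z)"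
    if "i \<in> {..<K}" for i d
    unfolding \<delta>_def using that by (intro twice_diff_diff twice_diff_dilate smooth) auto
  have ne: "{..<K} \<noteq> {}" using K by auto
  let ?G = "\<lambda>z. \<Sum>i<K. exp (\<delta> i z)"
  let ?d2 = "\<lambda>d i z. DD (c * d) i (c * z) - DD d i z"
  have pos: "?G z > 0" for z using K by (intro sum_pos) auto
  obtain Lx Lxx where Lx: "twice_diff 1 UNIV (\<lambda>z. ln (?G z)) Lx Lxx"
      "\<And>z. Lxx z \<ge> (\<Sum>i<K. exp (\<delta> i z) * ?d2 1 i z) / ?G z"
    by (rule twice_diff_lse[OF finite_lessThan ne T[of _ 1]]) auto
  obtain Ly Lyy where Ly: "twice_diff \<i> UNIV (\<lambda>z. ln (?G z)) Ly Lyy"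
      "\<And>z. Lyy z \<ge> (\<Sum>i<K. exp (\<delta> i z) * ?d2 \<i> i z) / ?G z"
    by (rule twice_diff_lse[OF finite_lessThan ne T[of _ \<i>]]) auto
  define a where "a i z = w i z * (exp (\<delta> i z - \<delta> (nxt K i) z) - 1)" for i z
  have w_rot: "w i (c * z) - w i z = a i z" for i z
    using c by (simp add: a_def toda_term_def \<delta>_def norm_mult algebra_simps flip: exp_add)
  have d2: "?d2 1 i z + ?d2 \<i> i z = 4 * (a i z - a (prv K i) z)" if "i < K" for i z
  proof -
    have "?d2 1 i z + ?d2 \<i> i z = lap i (c * z) - lap i z"
      using lap[OF that c, of "c * z"] lap_1[OF that, of z] by simp
    thus ?thesis using that by (simp add: toda_equation flip: w_rot)
  qed
  have prod_eq: "a i z * (exp (\<delta> i z) - exp (\<delta> (nxt K i) z))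
    = w i z * (exp (\<delta> (nxt K i) z) * (exp (\<delta> i z - \<delta> (nxt K i) z) - 1)\<^sup>2)" for i z
    unfolding a_def exp_diff_mult_nonneg[symmetric] by (simp add: mult_ac)
  have w0: "w i z \<ge> 0" for i z by (simp add: toda_term_def)
  have t0: "a i z * (exp (\<delta> i z) - exp (\<delta> (nxt K i) z)) \<ge> 0" for i z
    unfolding prod_eq using w0 by (intro mult_nonneg_nonneg) auto
  define A where "A z = (\<Sum>i<K. a i z * (exp (\<delta> i z) - exp (\<delta> (nxt K i) z)))" for z
  have A0: "A z \<ge> 0" for z unfolding A_def using t0 by (intro sum_nonneg) auto
  have L_ge: "Lxx z + Lyy z \<ge> 4 * A z / ?G z" for z
  proof -
    have "(\<Sum>i<K. exp (\<delta> i z) * ?d2 1 i z) + (\<Sum>i<K. exp (\<delta> i z) * ?d2 \<i> i z)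
      = (\<Sum>i<K. exp (\<delta> i z) * (?d2 1 i z + ?d2 \<i> i z))"
      by (simp only: sum.distrib distrib_left)
    also have "\<dots> = (\<Sum>i<K. 4 * (exp (\<delta> i z) * (a i z - a (prv K i) z)))"
      using d2 by (intro sum.cong refl) (simp only: lessThan_iff mult.left_commute)
    also have "\<dots> = 4 * (\<Sum>i<K. exp (\<delta> i z) * (a i z - a (prv K i) z))"
      by (rule sum_distrib_left[symmetric])
    also have "\<dots> = 4 * A z"
      unfolding A_def by (rule arg_cong[OF cyclic_summation_by_parts])
    finally have "4 * A z / ?G z = (\<Sum>i<K. exp (\<delta> i z) * ?d2 1 i z) / ?G z + (\<Sum>i<K. exp (\<delta> i z) * ?d2 \<i> i z) / ?G z"
      by (simp only: add_divide_distrib[symmetric])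
    thus ?thesis using Lx(2)[of z] Ly(2)[of z] by linarith
  qed
  have "Lxx z + Lyy z = 0" for z
  proof (rule subharmonic_sublogarithmic[OF Lx(1) Ly(1)])
    show "Lxx z + Lyy z \<ge> 0" for z using L_ge[of z] A0[of z] pos[of z]
      by (meson divide_nonneg_pos mult_nonneg_nonneg order_trans zero_le_numeral)
    fix \<epsilon> :: real assume e: "\<epsilon> > 0"
    from uniform_growth[of "\<epsilon>/2"] e obtain R1 C1 where 1: "R1 \<ge> 1"
      "\<And>i z. i < K \<Longrightarrow> norm z \<ge> R1 \<Longrightarrow> u i z \<le> (\<epsilon>/2 - 2 * \<alpha> i) * ln (norm z) + C1" by auto
    from lower_growth[of "\<epsilon>/2"] e obtain R2 C2 where 2: "R2 \<ge> 1"
      "\<And>i z. i < K \<Longrightarrow> norm z \<ge> R2 \<Longrightarrow> (- (\<epsilon>/2) - 2 * \<alpha> i) * ln (norm z) - C2 \<le> u i z" by auto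
    have "ln (?G z) \<le> \<epsilon> * ln (norm z) + (ln (real K) + C1 + C2)" if z: "norm z \<ge> max R1 R2" for z
    proof -
      have "\<delta> i z \<le> \<epsilon> * ln (norm z) + C1 + C2" if "i < K" for i
        using 1(2)[OF that, of "c * z"] 2(2)[OF that, of z] z c
        by (simp add: \<delta>_def norm_mult algebra_simps)
      hence "?G z \<le> (\<Sum>i<K. exp (\<epsilon> * ln (norm z) + C1 + C2))" by (intro sum_mono) auto
      hence "ln (?G z) \<le> ln (real K * exp (\<epsilon> * ln (norm z) + C1 + C2))" using pos[of z] K by simp
      also have "\<dots> = ln (real K) + (\<epsilon> * ln (norm z) + C1 + C2)" using K by (simp add: ln_mult)
      finally show ?thesis by simp
    qed
    thus "\<exists>R C. \<forall>z. norm z \<ge> R \<longrightarrow> ln (?G z) \<le> \<epsilon> * ln (norm z) + C" by blast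
  qed
  hence "4 * A z / ?G z \<le> 0" using L_ge[of z] by simp
  hence "A z = 0" using A0[of z] pos[of z] by (simp add: divide_le_0_iff)
  hence eq0: "a i z * (exp (\<delta> i z) - exp (\<delta> (nxt K i) z)) = 0" if "i < K" for i
    using t0 that unfolding A_def by (subst (asm) sum_nonneg_eq_0_iff) auto
  have step: "\<delta> (nxt K i) z = \<delta> i z" if "i < K" for i
    using eq0[OF that] False unfolding prod_eq by (auto simp: toda_term_def)
  have "\<delta> i z = \<delta> 0 z" if "i < K" for i
    using that
  proof (induction i)
    case (Suc i)
    thus ?case using step[of i] by (simp add: nxt_def)
  qed auto
  note eq = this
  have "0 = (\<Sum>i<K. \<delta> i z)"
    unfolding \<delta>_def sum_subtractf using sum_u_constant[of z] sum_u_constant[of "c * z"] by linarith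
  also have "\<dots> = (\<Sum>i<K. \<delta> 0 z)" by (intro sum.cong refl eq) auto
  also have "\<dots> = real K * \<delta> 0 z" by simp
  finally have "\<delta> 0 z = 0" using K by simp
  thus ?thesis using eq[OF i] unfolding \<delta>_def by linarith
qed simp

end

section \<open>Radial reduction and the Pohozaev identity\<close>

context cyclic_toda_subsolution
begin

lemma u_norm: "i < K \<Longrightarrow> u i (of_real (norm z)) = u i z"
proof (cases "z = 0")
  case False
  assume i: "i < K"
  have "norm (of_real (norm z) / z) = 1" using False by (simp add: norm_divide)
  from radial[OF this i, of z] show ?thesis using False by simp
qed simp

lemma w_norm: "i < K \<Longrightarrow> w i (of_real (norm z)) = w i z"
  using u_norm[of i z] u_norm[of "nxt K i" z] by (simp add: toda_term_def)

lemma DERIV_u_axis: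
  assumes "i < K"
  shows "((\<lambda>r. u i (of_real r)) has_real_derivative D 1 i (of_real r)) (at r)"
    "((\<lambda>r. D 1 i (of_real r)) has_real_derivative DD 1 i (of_real r)) (at r)"
  using twice_diffD(4,5)[OF smooth[OF assms, of 1], of "of_real r"]
    DERIV_shift[of "\<lambda>r. u i (of_real r)" "D 1 i (of_real r)" 0 r]
    DERIV_shift[of "\<lambda>r. D 1 i (of_real r)" "DD 1 i (of_real r)" 0 r]
  by (simp_all add: scaleR_conv_of_real add.commute)

text \<open>
  The angular part of the Laplacian in polar coordinates: on the line through \<open>r\<close> orthogonal to the
  radius, the transversal derivative is \<open>y\<close> times a continuous function of \<open>y\<close>.
\<close>

lemma DD_transversal:
  assumes i: "i < K" and r: "r > 0"
  shows "DD \<i> i (of_real r) = D 1 i (of_real r) / r"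
proof -
  define R where "R y = sqrt (r\<^sup>2 + y\<^sup>2)" for y
  have R0: "R y > 0" for y using r by (simp add: R_def add_pos_nonneg)
  have nR: "norm (of_real r + y *\<^sub>R \<i>) = R y" for y by (simp add: R_def cmod_def)
  have D\<i>: "D \<i> i (of_real r + y *\<^sub>R \<i>) = y * (D 1 i (of_real (R y)) / R y)" for y
  proof (rule DERIV_unique)
    show "((\<lambda>t. u i ((of_real r + y *\<^sub>R \<i>) + t *\<^sub>R \<i>)) has_real_derivative D \<i> i (of_real r + y *\<^sub>R \<i>)) (at 0)"
      by (rule twice_diffD(4)[OF smooth[OF i]]) simp
    have dR: "((\<lambda>t. R (y + t)) has_real_derivative y / R y) (at 0)"
      using R0[of y] unfolding R_def by (auto intro!: derivative_eq_intros simp: field_simps)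
    have "((\<lambda>t. u i (of_real (R (y + t)))) has_real_derivative D 1 i (of_real (R y)) * (y / R y)) (at 0)"
      by (rule DERIV_chain2[OF _ dR]) (use DERIV_u_axis(1)[OF i, of "R y"] in simp)
    also have "(\<lambda>t. u i (of_real (R (y + t)))) = (\<lambda>t. u i ((of_real r + y *\<^sub>R \<i>) + t *\<^sub>R \<i>))"
      unfolding nR[symmetric] u_norm[OF i] by (simp add: algebra_simps)
    finally show "((\<lambda>t. u i ((of_real r + y *\<^sub>R \<i>) + t *\<^sub>R \<i>)) has_real_derivative y * (D 1 i (of_real (R y)) / R y)) (at 0)"
      by (simp add: mult.commute)
  qed
  have cD: "continuous_on UNIV (D 1 i)" by (rule twice_diffD(2)[OF smooth[OF i]])
  have "isCont (\<lambda>y. D 1 i (of_real (R y)) / R y) 0"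
    using R0 unfolding R_def
    by (intro continuous_at_imp_continuous_on continuous_intros isCont_o2[OF _ cD[THEN continuous_on_interior]])
       (auto simp: order_less_imp_not_eq2)
  hence "((\<lambda>y. y * (D 1 i (of_real (R y)) / R y)) has_real_derivative D 1 i (of_real (R 0)) / R 0) (at 0)"
    unfolding CARAT_DERIV by (intro exI[of _ "\<lambda>y. D 1 i (of_real (R y)) / R y"]) (auto simp: mult.commute)
  moreover have "((\<lambda>y. D \<i> i (of_real r + y *\<^sub>R \<i>)) has_real_derivative DD \<i> i (of_real r)) (at 0)"
    by (rule twice_diffD(5)[OF smooth[OF i]]) simp
  ultimately have "DD \<i> i (of_real r) = D 1 i (of_real (R 0)) / R 0"
    unfolding D\<i> by (metis DERIV_unique)
  thus ?thesis using r by (simp add: R_def)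
qed

text \<open>
  In \<open>t = ln r\<close>, the shift by \<open>2 * \<alpha> i * t\<close> turns all the different powers of \<open>r\<close> in the Toda terms into
  the single factor \<open>exp (\<gamma> * t)\<close>, by the equations for the weights.
\<close>

definition "\<gamma> = 2 + 2 * real N / real K"
definition "V i t = u i (of_real (exp t)) + 2 * \<alpha> i * t"
definition "V1 i t = exp t * D 1 i (of_real (exp t)) + 2 * \<alpha> i"
definition "G i t = exp (\<gamma> * t) * exp (V i t - V (nxt K i) t)"

lemma \<gamma>_pos: "\<gamma> > 0" by (simp add: \<gamma>_def add_pos_nonneg)

lemma G_eq: "i < K \<Longrightarrow> G i t = exp (2 * t) * w i (of_real (exp t))"
proof -
  assume i: "i < K"
  have "\<gamma> * t + (V i t - V (nxt K i) t)
    = 2 * t + (real (2 * b i) * t + (u i (of_real (exp t)) - u (nxt K i) (of_real (exp t))))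
      + 2 * t * ((\<alpha> i - \<alpha> (nxt K i)) - (real (b i) - real N / real K))"
    by (simp add: \<gamma>_def V_def algebra_simps)
  also have "\<dots> = 2 * t + (real (2 * b i) * t + (u i (of_real (exp t)) - u (nxt K i) (of_real (exp t))))"
    using weight_diff[OF i] by simp
  finally have e: "exp (\<gamma> * t + (V i t - V (nxt K i) t)) = exp \<dots>" by (rule arg_cong)
  show "G i t = exp (2 * t) * w i (of_real (exp t))"
    using e unfolding G_def toda_term_def
    by (simp only: exp_add exp_of_nat_mult norm_of_real abs_exp_cancel)
qed

lemma DERIV_V:
  assumes i: "i < K"
  shows "(V i has_real_derivative V1 i t) (at t)"
    "(V1 i has_real_derivative 4 * (G i t - G (prv K i) t)) (at t)"
proof -
  have 1: "((\<lambda>t. u i (of_real (exp t))) has_real_derivative D 1 i (of_real (exp t)) * exp t) (at t)"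
    by (rule DERIV_chain2[OF DERIV_u_axis(1)[OF i] DERIV_exp])
  have 2: "((\<lambda>t. D 1 i (of_real (exp t))) has_real_derivative DD 1 i (of_real (exp t)) * exp t) (at t)"
    by (rule DERIV_chain2[OF DERIV_u_axis(2)[OF i] DERIV_exp])
  show "(V i has_real_derivative V1 i t) (at t)"
    unfolding V_def[abs_def] V1_def by (auto intro!: derivative_eq_intros 1 simp del: of_real_exp)
  have "(V1 i has_real_derivative exp t * D 1 i (of_real (exp t)) + exp t * (DD 1 i (of_real (exp t)) * exp t)) (at t)"
    unfolding V1_def[abs_def] by (auto intro!: derivative_eq_intros 2 simp del: of_real_exp)
  also have "exp t * D 1 i (of_real (exp t)) + exp t * (DD 1 i (of_real (exp t)) * exp t)
     = exp (2 * t) * lap i (of_real (exp t))"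
  proof -
    have e2: "exp (2 * t) = exp t * exp t" by (simp flip: exp_add)
    show ?thesis unfolding lap_1[OF i, symmetric] DD_transversal[OF i exp_gt_zero] e2
      by (simp add: field_simps del: of_real_exp)
  qed
  also have "\<dots> = 4 * (G i t - G (prv K i) t)"
    using i by (simp add: toda_equation G_eq algebra_simps del: of_real_exp)
  finally show "(V1 i has_real_derivative 4 * (G i t - G (prv K i) t)) (at t)" .
qed

lemma V_growth:
  assumes "\<epsilon> > 0"
  shows "\<exists>T C. \<forall>i<K. \<forall>t\<ge>T. V i t \<le> \<epsilon> * t + C"
proof -
  from uniform_growth[OF assms] obtain R C where RC: "R \<ge> 1"
    "\<And>i z. i < K \<Longrightarrow> norm z \<ge> R \<Longrightarrow> u i z \<le> (\<epsilon> - 2 * \<alpha> i) * ln (norm z) + C" by auto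
  have "V i t \<le> \<epsilon> * t + C" if "i < K" "t \<ge> ln R" for i t
  proof -
    have "exp (ln R) \<le> exp t" using that(2) by simp
    hence "exp t \<ge> R" using RC(1) by simp
    hence "u i (of_real (exp t)) \<le> (\<epsilon> - 2 * \<alpha> i) * t + C"
      using RC(2)[OF that(1), of "of_real (exp t)"] by (simp del: of_real_exp)
    thus ?thesis by (simp add: V_def algebra_simps del: of_real_exp)
  qed
  thus ?thesis by blast
qed

text \<open>
  The Pohozaev quantity \<open>P\<close> tends to \<open>0\<close> at infinity. At the origin the functions \<open>u i\<close> are smooth, so only
  the shifts contribute and \<open>P\<close> tends to \<open>- 2 * (\<Sum>i<K. (\<alpha> i)\<^sup>2)\<close>. Up to a constant
  factor, the difference is the integral.
\<close>

theorem integral_regulated: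
  defines "\<rho> \<equiv> \<lambda>z. (\<Sum>i<K. w i z) - real K * norm z powr (2 * real N / real K)"
  shows "integrable lborel \<rho>"
    "(\<integral>z. \<rho> z \<partial>lborel) = pi * real K / (2 * real (K + N)) * (\<Sum>i<K. (\<alpha> i)\<^sup>2)"
proof -
  define Q where "Q t = (\<Sum>i<K. G i t - exp (\<gamma> * t))" for t
  define P where "P t = 4 * Q t - (\<Sum>i<K. (V1 i t)\<^sup>2) / 2" for t
  have sumV: "(\<Sum>i<K. V i t) = (\<Sum>i<K. u i 0)" for t
    unfolding V_def sum.distrib sum_u_constant[of "of_real (exp t)"]
    by (simp add: weight_sum flip: sum_distrib_left sum_distrib_right)
  note ode = cyclic_toda_ode[OF K less_imp_le[OF \<gamma>_pos] G_def DERIV_V sumV V_growth, folded Q_def, folded P_def]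
  have Q: "Q t = exp (2 * t) * ((\<Sum>i<K. w i (of_real (exp t))) - real K * exp (2 * real N / real K * t))" for t
    unfolding Q_def by (simp add: G_eq \<gamma>_def sum_subtractf sum_distrib_left algebra_simps exp_add del: of_real_exp)
  define g where "g t = (\<Sum>i<K. w i (of_real (exp t))) - real K * exp (2 * real N / real K * t)" for t
  have contu: "continuous_on UNIV (u i)" and contD: "continuous_on UNIV (D 1 i)" if "i < K" for i
    using twice_diffD(1,2)[OF smooth[OF that, of 1]] by auto
  have contw: "continuous_on UNIV (w i)" if "i < K" for i
    unfolding toda_term_def[abs_def] using that by (intro continuous_intros contu) auto
  have g: "continuous_on UNIV g"
    unfolding g_def
    by (intro continuous_intros continuous_on_compose2[OF contw]) auto
  have g0: "g t \<ge> 0" for t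
    using ode(2)[of t] by (simp add: Q g_def zero_le_mult_iff)
  have dF: "((\<lambda>t. P t / (4 * \<gamma>)) has_real_derivative exp (2 * t) * g t) (at t)" for t
    using DERIV_cdivide[OF ode(1)[of t], of "4 * \<gamma>"] \<gamma>_pos by (simp add: Q g_def)
  have lim_top: "((\<lambda>t. P t / (4 * \<gamma>)) \<longlongrightarrow> 0) at_top"
    using tendsto_divide[OF ode(3) tendsto_const[of "4 * \<gamma>"]] \<gamma>_pos by simp
  have e0: "((\<lambda>t. complex_of_real (exp t)) \<longlongrightarrow> 0) at_bot"
    using tendsto_of_real[OF exp_at_bot] by simp
  have comp0: "((\<lambda>t. f (complex_of_real (exp t))) \<longlongrightarrow> f 0) at_bot" if "continuous_on UNIV f" for f :: "complex \<Rightarrow> real"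
    using that e0 by (intro isCont_tendsto_compose[of 0 f]) (auto simp: continuous_on_eq_continuous_at)
  have eb: "((\<lambda>t. exp (c * t)) \<longlongrightarrow> 0) at_bot" if "c > 0" for c :: real
    by (rule filterlim_compose[OF exp_at_bot]) (use that in \<open>simp add: filterlim_tendsto_pos_mult_at_bot[OF tendsto_const _ filterlim_ident]\<close>)
  have "(Q \<longlongrightarrow> (\<Sum>i<K. 0 * w i 0 - 0)) at_bot"
    unfolding Q_def[abs_def]
  proof (intro tendsto_sum tendsto_diff eb \<gamma>_pos)
    fix i assume "i \<in> {..<K}"
    hence i: "i < K" by simp
    have "((\<lambda>t. exp (2 * t) * w i (complex_of_real (exp t))) \<longlongrightarrow> 0 * w i 0) at_bot"
      by (intro tendsto_mult eb comp0 contw i) simp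
    also have "(\<lambda>t. exp (2 * t) * w i (complex_of_real (exp t))) = G i" using G_eq[OF i] by (intro ext) simp
    finally show "(G i \<longlongrightarrow> 0 * w i 0) at_bot" .
  qed
  moreover have "((\<lambda>t. \<Sum>i<K. (V1 i t)\<^sup>2) \<longlongrightarrow> (\<Sum>i<K. (0 * D 1 i 0 + 2 * \<alpha> i)\<^sup>2)) at_bot"
    unfolding V1_def by (intro tendsto_intros exp_at_bot comp0 contD) auto
  ultimately have "(P \<longlongrightarrow> 4 * (\<Sum>i<K. 0 * w i 0 - 0) - (\<Sum>i<K. (0 * D 1 i 0 + 2 * \<alpha> i)\<^sup>2) / 2) at_bot"
    unfolding P_def[abs_def] by (intro tendsto_diff tendsto_mult tendsto_divide tendsto_const) simp_all
  hence "(P \<longlongrightarrow> - 2 * (\<Sum>i<K. (\<alpha> i)\<^sup>2)) at_bot"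
    by (simp add: power_mult_distrib flip: sum_distrib_left)
  hence lim_bot: "((\<lambda>t. P t / (4 * \<gamma>)) \<longlongrightarrow> - 2 * (\<Sum>i<K. (\<alpha> i)\<^sup>2) / (4 * \<gamma>)) at_bot"
    using \<gamma>_pos by (intro tendsto_divide) auto
  have \<rho>m: "\<rho> \<in> borel_measurable borel"
  proof -
    have "(\<lambda>z. \<Sum>i<K. w i z) \<in> borel_measurable borel"
      by (intro borel_measurable_sum borel_measurable_continuous_onI contw) auto
    moreover have "(\<lambda>z::complex. real K * norm z powr (2 * real N / real K)) \<in> borel_measurable borel"
      by measurable
    ultimately show ?thesis unfolding \<rho>_def by (rule borel_measurable_diff)
  qed
  have \<rho>g: "\<rho> z = g (ln (norm z))" if "z \<noteq> 0" for z
    using that by (simp add: \<rho>_def g_def w_norm powr_def del: of_real_exp)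
  note I = integral_radial[OF \<rho>m \<rho>g g g0 dF lim_bot lim_top]
  show "integrable lborel \<rho>" by (rule I(1))
  have "2 * pi * (0 - - 2 * (\<Sum>i<K. (\<alpha> i)\<^sup>2) / (4 * \<gamma>)) = pi / \<gamma> * (\<Sum>i<K. (\<alpha> i)\<^sup>2)"
    using \<gamma>_pos by (simp add: field_simps)
  also have "pi / \<gamma> = pi * real K / (2 * real (K + N))"
    using K by (simp add: \<gamma>_def field_simps)
  finally show "(\<integral>z. \<rho> z \<partial>lborel) = pi * real K / (2 * real (K + N)) * (\<Sum>i<K. (\<alpha> i)\<^sup>2)"
    using I(2) by simp
qed

end

section \<open>Hermitian forms\<close>

lemma mult_mat_vec_eq_sum:
  "A \<in> carrier_mat n K \<Longrightarrow> v \<in> carrier_vec K \<Longrightarrow> i < n \<Longrightarrow> (A *\<^sub>v v) $ i = (\<Sum>j<K. A $$ (i, j) * v $ j)"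
  by (auto simp: scalar_prod_def lessThan_atLeast0 intro!: sum.cong)

lemma mult_mat_eq_sum:
  "A \<in> carrier_mat n K \<Longrightarrow> B \<in> carrier_mat K m \<Longrightarrow> i < n \<Longrightarrow> j < m \<Longrightarrow>
    (A * B) $$ (i, j) = (\<Sum>l<K. A $$ (i, l) * B $$ (l, j))"
  by (auto simp: scalar_prod_def lessThan_atLeast0 intro!: sum.cong)

lemma mult_unit_vec:
  fixes A :: "'a::semiring_1 mat"
  assumes "A \<in> carrier_mat n K" "i < n" "j < K"
  shows "(A *\<^sub>v unit_vec K j) $ i = A $$ (i, j)"
proof -
  have "(A *\<^sub>v unit_vec K j) $ i = (\<Sum>l<K. if l = j then A $$ (i, l) else 0)"
    unfolding mult_mat_vec_eq_sum[OF assms(1) unit_vec_carrier assms(2)]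
    using assms(3) by (intro sum.cong) (auto simp: unit_vec_def)
  thus ?thesis using assms(3) by simp
qed

lemma herm_eq_sum:
  assumes "H \<in> carrier_mat K K" "v \<in> carrier_vec K" "w \<in> carrier_vec K"
  shows "herm H v w = (\<Sum>i<K. (\<Sum>j<K. H $$ (i, j) * v $ j) * cnj (w $ i))"
proof -
  have "herm H v w = (\<Sum>i<K. (H *\<^sub>v v) $ i * cnj (w $ i))"
    using assms by (auto simp: herm_def scalar_prod_def lessThan_atLeast0 conjugate_complex_def intro!: sum.cong)
  also have "\<dots> = (\<Sum>i<K. (\<Sum>j<K. H $$ (i, j) * v $ j) * cnj (w $ i))"
    using assms by (intro sum.cong) (auto simp: mult_mat_vec_eq_sum simp del: index_mult_mat_vec)
  finally show ?thesis .
qed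

lemma herm_unit_vec:
  assumes "H \<in> carrier_mat K K" "i < K" "j < K"
  shows "herm H (unit_vec K j) (unit_vec K i) = H $$ (i, j)"
proof -
  have "herm H (unit_vec K j) (unit_vec K i)
    = (\<Sum>k<K. (\<Sum>l<K. if l = j then H $$ (k, l) else 0) * (if k = i then 1 else 0))"
    using assms by (subst herm_eq_sum)
      (auto intro!: sum.cong arg_cong2[where f = "(*)"] simp: unit_vec_def if_distrib cong: if_cong)
  also have "\<dots> = (\<Sum>k<K. if k = i then H $$ (k, j) else 0)"
    using assms by (intro sum.cong) (auto simp: if_distrib cong: if_cong)
  also have "\<dots> = H $$ (i, j)" using assms by simp
  finally show ?thesis .
qed

locale hermitian_form =
  fixes K :: nat and H :: "complex mat"
  assumes hermitian: "hermitian_inner_product K H"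
begin

abbreviation ip :: "complex vec \<Rightarrow> complex vec \<Rightarrow> complex" where "ip v w \<equiv> herm H v w"

lemma H_carrier [simp]: "H \<in> carrier_mat K K"
  using hermitian by (simp add: hermitian_inner_product_def)

lemmas ip_eq_sum = herm_eq_sum[OF H_carrier]

lemma ip_sym: "v \<in> carrier_vec K \<Longrightarrow> w \<in> carrier_vec K \<Longrightarrow> ip w v = cnj (ip v w)"
  using hermitian unfolding hermitian_inner_product_def by blast

lemma ip_pos: "v \<in> carrier_vec K \<Longrightarrow> v \<noteq> 0\<^sub>v K \<Longrightarrow> Re (ip v v) > 0"
  using hermitian unfolding hermitian_inner_product_def by blast

lemma ip_diff_left:
  assumes "v \<in> carrier_vec K" "w \<in> carrier_vec K" "x \<in> carrier_vec K"
  shows "ip (v - w) x = ip v x - ip w x"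
  using assms by (simp add: ip_eq_sum right_diff_distrib left_diff_distrib sum_subtractf)

lemma ip_smult_left:
  assumes "v \<in> carrier_vec K" "x \<in> carrier_vec K"
  shows "ip (c \<cdot>\<^sub>v v) x = c * ip v x"
  using assms by (simp add: ip_eq_sum sum_distrib_left sum_distrib_right mult_ac)

lemma ip_diff_right:
  assumes "v \<in> carrier_vec K" "w \<in> carrier_vec K" "x \<in> carrier_vec K"
  shows "ip x (v - w) = ip x v - ip x w"
  using assms by (simp add: ip_eq_sum right_diff_distrib left_diff_distrib sum_subtractf)

lemma ip_smult_right:
  assumes "v \<in> carrier_vec K" "x \<in> carrier_vec K"
  shows "ip x (c \<cdot>\<^sub>v v) = cnj c * ip x v"
  using assms by (simp add: ip_eq_sum sum_distrib_left mult_ac)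

lemma ip_zero: "x \<in> carrier_vec K \<Longrightarrow> ip (0\<^sub>v K) x = 0"
  by (simp add: ip_eq_sum)

lemma ip_self_real: "v \<in> carrier_vec K \<Longrightarrow> ip v v = of_real (Re (ip v v))"
  using ip_sym[of v v] by (simp add: complex_eq_iff)

lemma ip_nonneg: "v \<in> carrier_vec K \<Longrightarrow> Re (ip v v) \<ge> 0"
  using ip_pos[of v] ip_zero[of v] by (cases "v = 0\<^sub>v K") auto

lemma ip_expand_left:
  assumes "v \<in> carrier_vec K" "x \<in> carrier_vec K"
  shows "ip v x = (\<Sum>j<K. v $ j * ip (unit_vec K j) x)"
proof -
  have "ip (unit_vec K j) x = (\<Sum>i<K. H $$ (i, j) * cnj (x $ i))" if "j < K" for j
  proof -
    have "(\<Sum>l<K. H $$ (i, l) * unit_vec K j $ l) = H $$ (i, j)" for i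
    proof -
      have "(\<Sum>l<K. H $$ (i, l) * unit_vec K j $ l) = (\<Sum>l<K. if l = j then H $$ (i, l) else 0)"
        by (intro sum.cong) (use that in \<open>auto simp: unit_vec_def\<close>)
      thus ?thesis using that by simp
    qed
    thus ?thesis using assms by (simp add: ip_eq_sum del: index_unit_vec)
  qed
  hence "(\<Sum>j<K. v $ j * ip (unit_vec K j) x) = (\<Sum>j<K. \<Sum>i<K. v $ j * (H $$ (i, j) * cnj (x $ i)))"
    by (simp add: sum_distrib_left)
  also have "\<dots> = (\<Sum>i<K. \<Sum>j<K. v $ j * (H $$ (i, j) * cnj (x $ i)))" by (rule sum.swap)
  also have "\<dots> = ip v x" unfolding ip_eq_sum[OF assms] sum_distrib_right
    by (intro sum.cong refl) simp
  finally show ?thesis by simp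
qed

text \<open>
  The squared length of the component of \<open>v\<close> orthogonal to \<open>w\<close> is nonnegative, and zero only if
  \<open>v\<close> is a multiple of \<open>w\<close>.
\<close>

lemma Cauchy_Schwarz:
  assumes v: "v \<in> carrier_vec K" and w: "w \<in> carrier_vec K" "w \<noteq> 0\<^sub>v K"
  shows "(norm (ip v w))\<^sup>2 \<le> Re (ip v v) * Re (ip w w)"
    and "(norm (ip v w))\<^sup>2 = Re (ip v v) * Re (ip w w) \<Longrightarrow> v = (ip v w / ip w w) \<cdot>\<^sub>v w"
proof -
  define q where "q = Re (ip w w)"
  have q: "q > 0" "ip w w = of_real q" using ip_pos[OF w] ip_self_real[OF w(1)] by (simp_all add: q_def)
  define c where "c = ip v w / ip w w"
  define x where "x = v - c \<cdot>\<^sub>v w"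
  have x: "x \<in> carrier_vec K" using v w by (simp add: x_def)
  have "ip x w = 0"
    unfolding x_def using v w q by (simp add: ip_diff_left ip_smult_left c_def)
  hence "ip x x = ip x v"
    using v w x by (subst (2) x_def) (simp add: ip_diff_right ip_smult_right)
  also have "\<dots> = ip v v - c * ip w v"
    unfolding x_def using v w by (simp add: ip_diff_left ip_smult_left)
  also have "c * ip w v = of_real ((norm (ip v w))\<^sup>2 / q)"
    using ip_sym[OF v w(1)] q complex_norm_square[of "ip v w"] by (simp add: c_def)
  finally have xx: "Re (ip x x) = Re (ip v v) - (norm (ip v w))\<^sup>2 / q" by simp
  show "(norm (ip v w))\<^sup>2 \<le> Re (ip v v) * Re (ip w w)"
    using ip_nonneg[OF x] q(1) by (simp add: xx q_def[symmetric] field_simps)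
  assume "(norm (ip v w))\<^sup>2 = Re (ip v v) * Re (ip w w)"
  hence "Re (ip x x) = 0" using q(1) by (simp add: xx q_def[symmetric])
  hence "x = 0\<^sub>v K" using ip_pos[OF x] by fastforce
  show "v = (ip v w / ip w w) \<cdot>\<^sub>v w"
  proof (rule eq_vecI)
    fix i assume "i < dim_vec ((ip v w / ip w w) \<cdot>\<^sub>v w)"
    hence i: "i < K" using w by simp
    have "x $ i = 0" using \<open>x = 0\<^sub>v K\<close> i by simp
    thus "v $ i = ((ip v w / ip w w) \<cdot>\<^sub>v w) $ i" using i v w by (simp add: x_def c_def)
  qed (use v w in simp)
qed

lemma det_nonzero: "det H \<noteq> 0"
proof
  assume "det H = 0"
  then obtain v where v: "v \<in> carrier_vec K" "v \<noteq> 0\<^sub>v K" "H *\<^sub>v v = 0\<^sub>v K"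
    using det_0_iff_vec_prod_zero[OF H_carrier] by auto
  have "ip v v = 0" using v by (simp add: herm_def)
  thus False using ip_pos[OF v(1,2)] by simp
qed

text \<open>
  The adjoint is \<open>H\<inverse> A\<^sup>* H\<close>, with \<open>A\<^sup>*\<close> the conjugate transpose.
\<close>

lemma adjoint_exists:
  assumes A: "A \<in> carrier_mat K K"
  obtains B where "B \<in> carrier_mat K K"
    "\<And>v w. v \<in> carrier_vec K \<Longrightarrow> w \<in> carrier_vec K \<Longrightarrow> ip (A *\<^sub>v v) w = ip v (B *\<^sub>v w)"
proof -
  define Ac where "Ac = mat K K (\<lambda>(i, j). cnj (A $$ (j, i)))"
  have AcE: "Ac $$ (i, k) = cnj (A $$ (k, i))" if "i < K" "k < K" for i k using that by (simp add: Ac_def)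
  define J where "J = (1 / det H) \<cdot>\<^sub>m adj_mat H"
  define B where "B = J * (Ac * H)"
  have c: "Ac \<in> carrier_mat K K" "J \<in> carrier_mat K K"
    using adj_mat(1)[OF H_carrier] by (auto simp: Ac_def J_def)
  have c3: "B \<in> carrier_mat K K" and AcH: "Ac * H \<in> carrier_mat K K" using c by (auto simp: B_def)
  have "H * J = 1 / det H \<cdot>\<^sub>m (H * adj_mat H)"
    unfolding J_def by (rule mult_smult_distrib[OF H_carrier adj_mat(1)[OF H_carrier]])
  also have "\<dots> = 1\<^sub>m K" using adj_mat(2)[OF H_carrier] det_nonzero by (auto intro!: eq_matI)
  finally have "H * J = 1\<^sub>m K" .
  hence HB: "H * B = Ac * H"
    unfolding B_def assoc_mult_mat[OF H_carrier c(2) AcH, symmetric] by (simp only: left_mult_one_mat[OF AcH])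
  show thesis
  proof (rule that[OF c3])
    fix v w :: "complex vec" assume v: "v \<in> carrier_vec K" and w: "w \<in> carrier_vec K"
    define x where "x = H *\<^sub>v w"
    have x: "x \<in> carrier_vec K" unfolding x_def by (rule mult_mat_vec_carrier[OF H_carrier w])
    have Bw: "B *\<^sub>v w \<in> carrier_vec K" and Av: "A *\<^sub>v v \<in> carrier_vec K" using c3 A v w by auto
    have "H *\<^sub>v (B *\<^sub>v w) = Ac *\<^sub>v x"
      unfolding x_def assoc_mult_mat_vec[OF H_carrier c3 w, symmetric] assoc_mult_mat_vec[OF c(1) H_carrier w, symmetric]
      by (simp only: HB)
    hence "ip (B *\<^sub>v w) v = (\<Sum>i<K. (Ac *\<^sub>v x) $ i * cnj (v $ i))"
      using v by (auto simp: herm_def scalar_prod_def lessThan_atLeast0 conjugate_complex_def intro!: sum.cong)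
    also have "\<dots> = (\<Sum>i<K. \<Sum>k<K. cnj (A $$ (k, i)) * x $ k * cnj (v $ i))"
      by (intro sum.cong refl) (simp add: mult_mat_vec_eq_sum[OF c(1) x] sum_distrib_right AcE del: index_mult_mat_vec)
    also have "\<dots> = (\<Sum>k<K. \<Sum>i<K. cnj (A $$ (k, i)) * x $ k * cnj (v $ i))" by (rule sum.swap)
    also have "\<dots> = (\<Sum>k<K. x $ k * cnj ((A *\<^sub>v v) $ k))"
      using v A by (intro sum.cong) (auto simp: mult_mat_vec_eq_sum[OF A v] sum_distrib_left mult_ac simp del: index_mult_mat_vec)
    also have "\<dots> = ip w (A *\<^sub>v v)"
      using carrier_vecD[OF Av]
      by (simp add: herm_def scalar_prod_def lessThan_atLeast0 conjugate_complex_def x_def[symmetric] del: dim_mult_mat_vec index_mult_mat_vec)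
    finally have "ip (B *\<^sub>v w) v = ip w (A *\<^sub>v v)" .
    thus "ip (A *\<^sub>v v) w = ip v (B *\<^sub>v w)"
      using ip_sym[OF Av w] ip_sym[OF Bw v] ip_sym[OF v Bw] by (metis complex_cnj_cnj)
  qed
qed

lemma herm_adjoint:
  assumes A: "A \<in> carrier_mat K K"
  shows "herm_adjoint K H A \<in> carrier_mat K K"
    "v \<in> carrier_vec K \<Longrightarrow> w \<in> carrier_vec K \<Longrightarrow> ip (A *\<^sub>v v) w = ip v (herm_adjoint K H A *\<^sub>v w)"
proof -
  let ?P = "\<lambda>B. B \<in> carrier_mat K K \<and> (\<forall>v\<in>carrier_vec K. \<forall>w\<in>carrier_vec K. ip (A *\<^sub>v v) w = ip v (B *\<^sub>v w))"
  obtain B where B: "?P B" using adjoint_exists[OF A] by metis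
  have "C = B" if C: "?P C" for C
  proof -
    have eq: "C *\<^sub>v w = B *\<^sub>v w" if w: "w \<in> carrier_vec K" for w
    proof -
      define v where "v = C *\<^sub>v w - B *\<^sub>v w"
      have Cw: "C *\<^sub>v w \<in> carrier_vec K" and Bw: "B *\<^sub>v w \<in> carrier_vec K" using B C w by auto
      have v: "v \<in> carrier_vec K" using Cw Bw by (simp add: v_def)
      have "ip v v = ip v (C *\<^sub>v w) - ip v (B *\<^sub>v w)"
        by (subst (2) v_def) (rule ip_diff_right[OF Cw Bw v])
      also have "\<dots> = 0" using B C v w by (metis cancel_comm_monoid_add_class.diff_cancel)
      finally have "v = 0\<^sub>v K" using ip_pos[OF v] by fastforce
      show ?thesis
      proof (rule eq_vecI)
        have d: "dim_vec (C *\<^sub>v w) = K" "dim_vec (B *\<^sub>v w) = K"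
          using Cw Bw by (blast dest: carrier_vecD)+
        show "dim_vec (C *\<^sub>v w) = dim_vec (B *\<^sub>v w)" by (simp only: d)
        fix i assume "i < dim_vec (B *\<^sub>v w)"
        hence i: "i < K" by (simp only: d)
        have "v $ i = (C *\<^sub>v w) $ i - (B *\<^sub>v w) $ i"
          unfolding v_def by (rule index_minus_vec) (simp only: d i)
        thus "(C *\<^sub>v w) $ i = (B *\<^sub>v w) $ i" using \<open>v = 0\<^sub>v K\<close> i by simp
      qed
    qed
    show "C = B"
    proof (rule eq_matI)
      have d: "dim_row B = K" "dim_col B = K" "dim_row C = K" "dim_col C = K"
        using B C by auto
      thus "dim_row C = dim_row B" "dim_col C = dim_col B" by simp_all
      fix i j assume "i < dim_row B" "j < dim_col B"
      hence ij: "i < K" "j < K" by (simp_all add: d)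
      show "C $$ (i, j) = B $$ (i, j)"
        using eq[OF unit_vec_carrier, of j] B C ij mult_unit_vec by metis
    qed
  qed
  hence "herm_adjoint K H A = B" unfolding herm_adjoint_def using B by (intro the_equality) blast+
  thus "herm_adjoint K H A \<in> carrier_mat K K"
    "v \<in> carrier_vec K \<Longrightarrow> w \<in> carrier_vec K \<Longrightarrow> ip (A *\<^sub>v v) w = ip v (herm_adjoint K H A *\<^sub>v w)"
    using B by auto
qed

end

section \<open>Wirtinger calculus\<close>

abbreviation dderiv :: "complex \<Rightarrow> (complex \<Rightarrow> complex) \<Rightarrow> complex \<Rightarrow> complex" where
  "dderiv d f z \<equiv> frechet_derivative f (at z) d"

lemma dderiv_decompose:
  assumes "f differentiable (at z)"
  shows "dderiv d f z = of_real (Re d) * dderiv 1 f z + of_real (Im d) * dderiv \<i> f z"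
proof -
  interpret linear "frechet_derivative f (at z)" using assms by (rule linear_frechet_derivative)
  have "d = Re d *\<^sub>R 1 + Im d *\<^sub>R \<i>" by (simp add: complex_eq_iff)
  hence "dderiv d f z = dderiv (Re d *\<^sub>R 1 + Im d *\<^sub>R \<i>) f z" by (rule arg_cong)
  also have "\<dots> = Re d *\<^sub>R dderiv 1 f z + Im d *\<^sub>R dderiv \<i> f z" by (simp only: add scale)
  finally show ?thesis by (simp add: scaleR_conv_of_real)
qed

lemma DERIV_line:
  assumes "f differentiable (at z)"
  shows "((\<lambda>t. Re (f (z + t *\<^sub>R d))) has_real_derivative Re (dderiv d f z)) (at 0)"
proof -
  interpret linear "frechet_derivative f (at z)" using assms by (rule linear_frechet_derivative)
  have "((\<lambda>t::real. z + t *\<^sub>R d) has_derivative (\<lambda>t. t *\<^sub>R d)) (at 0)"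
    by (auto intro!: derivative_eq_intros)
  moreover have "(f has_derivative frechet_derivative f (at z)) (at (z + 0 *\<^sub>R d))"
    using assms by (simp add: frechet_derivative_works)
  ultimately have "((\<lambda>t. f (z + t *\<^sub>R d)) has_derivative (\<lambda>t. dderiv (t *\<^sub>R d) f z)) (at 0)"
    using diff_chain_at[of "\<lambda>t::real. z + t *\<^sub>R d" "\<lambda>t. t *\<^sub>R d" 0 f "frechet_derivative f (at z)"]
    by (simp add: o_def)
  hence "((\<lambda>t. Re (f (z + t *\<^sub>R d))) has_derivative (\<lambda>t. Re (dderiv (t *\<^sub>R d) f z))) (at 0)"
    by (rule has_derivative_Re)
  moreover have "(\<lambda>t. Re (dderiv (t *\<^sub>R d) f z)) = (*) (Re (dderiv d f z))"
    by (rule ext) (simp add: scale)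
  ultimately show ?thesis by (simp add: has_field_derivative_def)
qed

lemma Ck_continuous: "Ck k f \<Longrightarrow> continuous_on UNIV f"
  by (cases k) (auto intro!: continuous_at_imp_continuous_on differentiable_imp_continuous_within)

lemma Ck_2_differentiable:
  assumes "Ck 2 f"
  shows "f differentiable (at z)" "dderiv d f differentiable (at z)"
proof -
  have f: "\<And>z. f differentiable (at z)" and g: "\<And>z. dderiv 1 f differentiable (at z)" "\<And>z. dderiv \<i> f differentiable (at z)"
    using assms unfolding numeral_2_eq_2 by auto
  show "f differentiable (at z)" by (rule f)
  have "(\<lambda>z. of_real (Re d) * dderiv 1 f z + of_real (Im d) * dderiv \<i> f z) differentiable (at z)"
    by (intro differentiable_add differentiable_mult differentiable_const g)
  thus "dderiv d f differentiable (at z)" by (simp only: dderiv_decompose[OF f, where d = d])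
qed

lemma dderiv2_decompose:
  assumes "Ck 2 f"
  shows "dderiv e (dderiv d f) z = of_real (Re d) * dderiv e (dderiv 1 f) z + of_real (Im d) * dderiv e (dderiv \<i> f) z"
proof -
  note g = Ck_2_differentiable[OF assms]
  let ?f' = "\<lambda>h. of_real (Re d) * dderiv h (dderiv 1 f) z + of_real (Im d) * dderiv h (dderiv \<i> f) z"
  have "((\<lambda>z. of_real (Re d) * dderiv 1 f z + of_real (Im d) * dderiv \<i> f z) has_derivative ?f') (at z)"
    by (auto intro!: derivative_eq_intros g(2)[unfolded frechet_derivative_works])
  hence "(dderiv d f has_derivative ?f') (at z)"
    by (simp only: dderiv_decompose[OF g(1), where d = d])
  hence "frechet_derivative (dderiv d f) (at z) = ?f'" by (rule frechet_derivative_at[symmetric])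
  thus ?thesis by (rule fun_cong)
qed

lemma Ck_2_continuous_derivatives:
  assumes "Ck 2 f"
  shows "continuous_on UNIV (dderiv d f)" "continuous_on UNIV (dderiv d (dderiv d f))"
proof -
  note g = Ck_2_differentiable[OF assms]
  show "continuous_on UNIV (dderiv d f)"
    by (auto intro!: continuous_at_imp_continuous_on differentiable_imp_continuous_within g)
  have c: "continuous_on UNIV (dderiv 1 (dderiv 1 f))" "continuous_on UNIV (dderiv \<i> (dderiv 1 f))"
    "continuous_on UNIV (dderiv 1 (dderiv \<i> f))" "continuous_on UNIV (dderiv \<i> (dderiv \<i> f))"
    using assms unfolding numeral_2_eq_2 by auto
  have "continuous_on UNIV (\<lambda>z. of_real (Re d) * (of_real (Re d) * dderiv 1 (dderiv 1 f) z + of_real (Im d) * dderiv \<i> (dderiv 1 f) z)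
     + of_real (Im d) * (of_real (Re d) * dderiv 1 (dderiv \<i> f) z + of_real (Im d) * dderiv \<i> (dderiv \<i> f) z))"
    by (intro continuous_intros c)
  thus "continuous_on UNIV (dderiv d (dderiv d f))"
    by (simp only: dderiv2_decompose[OF assms, where e = d and d = d] dderiv_decompose[OF g(2), where d = d])
qed

lemma Ck_2_twice_diff:
  assumes "Ck 2 f"
  shows "twice_diff d UNIV (\<lambda>z. Re (f z)) (\<lambda>z. Re (dderiv d f z)) (\<lambda>z. Re (dderiv d (dderiv d f) z))"
  unfolding twice_diff_def using Ck_2_differentiable[OF assms] Ck_2_continuous_derivatives[OF assms] Ck_continuous[OF assms]
  by (auto intro!: continuous_intros DERIV_line)

lemma laplacian_rotation:
  assumes "Ck 2 f" "norm c = 1"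
  shows "dderiv c (dderiv c f) z + dderiv (c * \<i>) (dderiv (c * \<i>) f) z
    = dderiv 1 (dderiv 1 f) z + dderiv \<i> (dderiv \<i> f) z"
    "(Re (dderiv c f z))\<^sup>2 + (Re (dderiv (c * \<i>) f z))\<^sup>2 = (Re (dderiv 1 f z))\<^sup>2 + (Re (dderiv \<i> f z))\<^sup>2"
proof -
  note g = Ck_2_differentiable[OF assms(1)]
  define a b where "a = Re c" and "b = Im c"
  have "(Re c)\<^sup>2 + (Im c)\<^sup>2 = 1" using assms(2) by (simp add: cmod_def)
  hence ab: "a\<^sup>2 + b\<^sup>2 = 1" by (simp add: a_def b_def)
  have d2: "dderiv c (dderiv c f) z = of_real a * (of_real a * dderiv 1 (dderiv 1 f) z + of_real b * dderiv \<i> (dderiv 1 f) z)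
     + of_real b * (of_real a * dderiv 1 (dderiv \<i> f) z + of_real b * dderiv \<i> (dderiv \<i> f) z)"
    unfolding dderiv2_decompose[OF assms(1), where d = c and e = c] a_def b_def
    by (simp only: dderiv_decompose[OF g(2), where d = c])
  have d2': "dderiv (c * \<i>) (dderiv (c * \<i>) f) z
     = - of_real b * (- of_real b * dderiv 1 (dderiv 1 f) z + of_real a * dderiv \<i> (dderiv 1 f) z)
     + of_real a * (- of_real b * dderiv 1 (dderiv \<i> f) z + of_real a * dderiv \<i> (dderiv \<i> f) z)"
    unfolding dderiv2_decompose[OF assms(1), where d = "c * \<i>" and e = "c * \<i>"] a_def b_def
    by (simp add: dderiv_decompose[OF g(2), where d = "c * \<i>"])
  have "dderiv c (dderiv c f) z + dderiv (c * \<i>) (dderiv (c * \<i>) f) z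
    = of_real (a\<^sup>2 + b\<^sup>2) * (dderiv 1 (dderiv 1 f) z + dderiv \<i> (dderiv \<i> f) z)"
    unfolding d2 d2' by (simp add: algebra_simps power2_eq_square)
  thus "dderiv c (dderiv c f) z + dderiv (c * \<i>) (dderiv (c * \<i>) f) z
    = dderiv 1 (dderiv 1 f) z + dderiv \<i> (dderiv \<i> f) z" unfolding ab by simp
  have d1: "Re (dderiv c f z) = a * Re (dderiv 1 f z) + b * Re (dderiv \<i> f z)"
    "Re (dderiv (c * \<i>) f z) = - b * Re (dderiv 1 f z) + a * Re (dderiv \<i> f z)"
    using dderiv_decompose[OF g(1), where d = c] dderiv_decompose[OF g(1), where d = "c * \<i>"] by (simp_all add: a_def b_def)
  have "(Re (dderiv c f z))\<^sup>2 + (Re (dderiv (c * \<i>) f z))\<^sup>2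
    = (a\<^sup>2 + b\<^sup>2) * ((Re (dderiv 1 f z))\<^sup>2 + (Re (dderiv \<i> f z))\<^sup>2)"
    unfolding d1 by (simp add: algebra_simps power2_eq_square)
  thus "(Re (dderiv c f z))\<^sup>2 + (Re (dderiv (c * \<i>) f z))\<^sup>2 = (Re (dderiv 1 f z))\<^sup>2 + (Re (dderiv \<i> f z))\<^sup>2"
    unfolding ab by simp
qed

lemma dderiv_real:
  assumes "f differentiable (at z)" "\<And>w. Im (f w) = 0"
  shows "Im (dderiv d f z) = 0"
proof -
  have "((\<lambda>w. Im (f w)) has_derivative (\<lambda>h. Im (dderiv h f z))) (at z)"
    using assms(1) by (intro has_derivative_Im) (simp add: frechet_derivative_works)
  hence "((\<lambda>w. 0) has_derivative (\<lambda>h. Im (dderiv h f z))) (at z)" by (simp add: assms(2))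
  from has_derivative_unique[OF this has_derivative_const] show ?thesis by (rule fun_cong)
qed

lemma norm_d_z_real:
  assumes "f differentiable (at z)" "\<And>w. Im (f w) = 0"
  shows "(Re (dderiv 1 f z))\<^sup>2 + (Re (dderiv \<i> f z))\<^sup>2 = 4 * (norm (d_z f z))\<^sup>2"
  using dderiv_real[OF assms, of 1] dderiv_real[OF assms, of \<i>]
  by (simp add: d_z_def cmod_power2 power_divide)

lemma d_zbar_eq: "(f has_derivative f') (at z) \<Longrightarrow> d_zbar f z = (f' 1 + \<i> * f' \<i>) / 2"
  unfolding d_zbar_def by (simp only: frechet_derivative_at[symmetric])

text \<open>
  When \<open>f\<close> is real, the mixed second derivatives only enter the imaginary part of \<open>d_zbar (d_z f)\<close>.
\<close>

lemma Re_d_zbar_d_z_real: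
  assumes f: "Ck 2 f" and real: "\<And>w. Im (f w) = 0"
  shows "Re (dderiv 1 (dderiv 1 f) z) + Re (dderiv \<i> (dderiv \<i> f) z) = 4 * Re (d_zbar (d_z f) z)"
proof -
  note g = Ck_2_differentiable[OF f]
  have "(d_z f has_derivative (\<lambda>h. (dderiv h (dderiv 1 f) z - \<i> * dderiv h (dderiv \<i> f) z) / 2)) (at z)"
    unfolding d_z_def[abs_def]
    by (auto intro!: derivative_eq_intros g(2)[unfolded frechet_derivative_works])
  note e = d_zbar_eq[OF this]
  have "Im (dderiv d (dderiv e f) z) = 0" for d e
    by (rule dderiv_real[OF g(2)]) (rule dderiv_real[OF g(1) real])
  thus ?thesis unfolding e by simp
qed

lemma d_zbar_sum_mult:
  assumes "\<And>k. k \<in> I \<Longrightarrow> f k differentiable (at z)" "\<And>k. k \<in> I \<Longrightarrow> g k differentiable (at z)"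
  shows "d_zbar (\<lambda>w. \<Sum>k\<in>I. f k w * g k w) z = (\<Sum>k\<in>I. d_zbar (f k) z * g k z + f k z * d_zbar (g k) z)"
proof -
  have "((\<lambda>w. \<Sum>k\<in>I. f k w * g k w) has_derivative (\<lambda>h. \<Sum>k\<in>I. f k z * dderiv h (g k) z + dderiv h (f k) z * g k z)) (at z)"
    using assms by (intro has_derivative_sum has_derivative_mult) (auto simp: frechet_derivative_works[symmetric])
  note e = d_zbar_eq[OF this]
  show ?thesis
    by (rule trans[OF e])
       (simp add: d_zbar_def sum_distrib_left sum_divide_distrib add_divide_distrib algebra_simps flip: sum.distrib)
qed

lemma differentiable_prod:
  fixes f :: "'i \<Rightarrow> complex \<Rightarrow> complex"
  assumes "\<And>i. i \<in> I \<Longrightarrow> f i differentiable (at z)"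
  shows "(\<lambda>w. \<Prod>i\<in>I. f i w) differentiable (at z)"
  using assms by (induction I rule: infinite_finite_induct) auto

lemma differentiable_det:
  fixes M :: "complex \<Rightarrow> complex mat"
  assumes M: "\<And>z. M z \<in> carrier_mat n n" and d: "\<And>i j. i < n \<Longrightarrow> j < n \<Longrightarrow> (\<lambda>z. M z $$ (i, j)) differentiable (at z)"
  shows "(\<lambda>z. det (M z)) differentiable (at z)"
  unfolding det_def'[OF M]
proof (intro differentiable_sum ballI differentiable_mult differentiable_const differentiable_prod d)
  show "finite {p. p permutes {0..<n}}" by (simp add: finite_permutations)
  fix p i assume "p \<in> {p. p permutes {0..<n}}" "i \<in> {0..<n}"
  thus "i < n" "p i < n" using permutes_in_image[of p "{0..<n}" i] by auto
qed

text \<open>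
  By Cramer's rule the entries of \<open>A = H\<inverse> (H A)\<close> are rational expressions in the entries of \<open>H\<close> and \<open>H A\<close>.
  This is how the connection matrix, which is only given pointwise by the Chern equations, becomes
  differentiable.
\<close>

lemma differentiable_solution:
  fixes H A G :: "complex \<Rightarrow> complex mat"
  assumes H: "\<And>z. H z \<in> carrier_mat n n" "\<And>z i j. i < n \<Longrightarrow> j < n \<Longrightarrow> (\<lambda>z. H z $$ (i, j)) differentiable (at z)"
    and G: "\<And>z i j. i < n \<Longrightarrow> j < n \<Longrightarrow> (\<lambda>z. (H z * A z) $$ (i, j)) differentiable (at z)"
    and A: "\<And>z. A z \<in> carrier_mat n n" and det: "\<And>z. det (H z) \<noteq> 0"
    and ij: "i < n" "j < n"
  shows "(\<lambda>z. A z $$ (i, j)) differentiable (at z)"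
proof -
  have cof: "(\<lambda>z. cofactor (H z) k i) differentiable (at z)" if "k < n" for k
    unfolding cofactor_def
  proof (intro differentiable_mult differentiable_const differentiable_det[where n = "n - 1"])
    show "mat_delete (H z) k i \<in> carrier_mat (n - 1) (n - 1)" for z
      using H(1)[of z] by (rule mat_delete_carrier)
    fix i' j' assume "i' < n - 1" "j' < n - 1"
    thus "(\<lambda>z. mat_delete (H z) k i $$ (i', j')) differentiable (at z)"
      using H(1) unfolding mat_delete_def
      by (simp add: carrier_matD[OF H(1)]) (intro conjI impI H(2); simp)
  qed
  have e: "A z $$ (i, j) = (\<Sum>k<n. cofactor (H z) k i * (H z * A z) $$ (k, j)) / det (H z)" for z
  proof -
    have HA: "H z * A z \<in> carrier_mat n n" using H(1) A by (rule mult_carrier_mat)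
    have "adj_mat (H z) * (H z * A z) = (adj_mat (H z) * H z) * A z"
      by (rule assoc_mult_mat[symmetric, OF adj_mat(1)[OF H(1)] H(1) A])
    also have "\<dots> = det (H z) \<cdot>\<^sub>m A z"
      unfolding adj_mat(3)[OF H(1)] using A[of z] by (simp add: mult_smult_assoc_mat[OF one_carrier_mat A])
    finally have "(adj_mat (H z) * (H z * A z)) $$ (i, j) = (det (H z) \<cdot>\<^sub>m A z) $$ (i, j)" by (rule arg_cong)
    also have "\<dots> = det (H z) * A z $$ (i, j)" using ij A[of z] by auto
    also have "(adj_mat (H z) * (H z * A z)) $$ (i, j) = (\<Sum>k<n. adj_mat (H z) $$ (i, k) * (H z * A z) $$ (k, j))"
      by (rule mult_mat_eq_sum[OF adj_mat(1)[OF H(1)] HA ij])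
    also have "\<dots> = (\<Sum>k<n. cofactor (H z) k i * (H z * A z) $$ (k, j))"
      using ij H(1)[of z] by (intro sum.cong) (auto simp: adj_mat_def)
    finally show ?thesis using det[of z] by (simp add: field_simps)
  qed
  show ?thesis unfolding e
    by (intro differentiable_divide differentiable_sum ballI differentiable_mult cof G differentiable_det[OF H(1,2)] det ij) auto
qed

section \<open>The curvature of the Chern connection\<close>

lemma chern_connection_entries:
  assumes h: "\<And>z. hermitian_inner_product K (h z)" and A: "chern_connection K h A A'"
    and ij: "i < K" "j < K"
  shows "d_z (\<lambda>u. h u $$ (i, j)) z = (h z * A z) $$ (i, j)"
    "d_zbar (\<lambda>u. h u $$ (i, j)) z = herm (h z) (unit_vec K j) (A z *\<^sub>v unit_vec K i)"
proof -
  have hc: "h z \<in> carrier_mat K K" for z using h by (simp add: hermitian_inner_product_def)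
  have Ac: "A z \<in> carrier_mat K K" and A'0: "A' z = 0\<^sub>m K K" for z
    using A by (auto simp: chern_connection_def)
  have e: "(\<lambda>u. h u $$ (i, j)) = (\<lambda>u. herm (h u) (unit_vec K j) (unit_vec K i))"
    using herm_unit_vec[OF hc ij] by auto
  interpret hermitian_form K "h z" by standard (rule h)
  have zero: "ip v (0\<^sub>v K) = 0" "ip (0\<^sub>v K) v = 0" if "v \<in> carrier_vec K" for v
    using that by (simp_all add: ip_eq_sum)
  have Az0: "A' z *\<^sub>v unit_vec K k = 0\<^sub>v K" for k
    unfolding A'0 by (intro eq_vecI) (simp_all add: scalar_prod_def)
  have "d_z (\<lambda>u. h u $$ (i, j)) z = ip (A z *\<^sub>v unit_vec K j) (unit_vec K i) + ip (unit_vec K j) (A' z *\<^sub>v unit_vec K i)"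
    "d_zbar (\<lambda>u. h u $$ (i, j)) z = ip (A' z *\<^sub>v unit_vec K j) (unit_vec K i) + ip (unit_vec K j) (A z *\<^sub>v unit_vec K i)"
    using A unfolding e chern_connection_def by auto
  moreover have "ip (A z *\<^sub>v unit_vec K j) (unit_vec K i) = herm (h z * A z) (unit_vec K j) (unit_vec K i)"
    unfolding herm_def assoc_mult_mat_vec[OF hc Ac unit_vec_carrier] ..
  moreover have "\<dots> = (h z * A z) $$ (i, j)"
    by (rule herm_unit_vec[OF mult_carrier_mat[OF hc Ac] ij])
  moreover have "A z *\<^sub>v unit_vec K i \<in> carrier_vec K" by (rule mult_mat_vec_carrier[OF Ac unit_vec_carrier])
  ultimately show "d_z (\<lambda>u. h u $$ (i, j)) z = (h z * A z) $$ (i, j)"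
    "d_zbar (\<lambda>u. h u $$ (i, j)) z = herm (h z) (unit_vec K j) (A z *\<^sub>v unit_vec K i)"
    unfolding Az0 by (simp_all add: zero)
qed

text \<open>
  The Chern equations give \<open>d_z (h(e, e)) = h(A e, e)\<close>. Differentiating again yields the
  length of \<open>A e\<close> from the derivative of \<open>h\<close>, and \<open>h((d_zbar A) e, e)\<close>, where Hitchin's equation replaces
  \<open>d_zbar A\<close> by the commutator of \<open>\<Phi>\<close> and its adjoint.
\<close>

lemma curvature_diagonal:
  assumes h: "hermitian_metric K h" and A: "chern_connection K h A A'"
    and \<Phi>: "\<Phi> \<in> carrier_mat K K" and \<Psi>: "\<Psi> = herm_adjoint K (h z) \<Phi>"
    and curv: "curvature K A A' z + (\<Phi> * \<Psi> - \<Psi> * \<Phi>) = 0\<^sub>m K K"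
    and i: "i < K"
  defines "e \<equiv> unit_vec K i"
  shows "d_zbar (d_z (\<lambda>u. h u $$ (i, i))) z
    = herm (h z) (A z *\<^sub>v e) (A z *\<^sub>v e) + herm (h z) (\<Psi> *\<^sub>v e) (\<Psi> *\<^sub>v e) - herm (h z) (\<Phi> *\<^sub>v e) (\<Phi> *\<^sub>v e)"
    and "d_z (\<lambda>u. h u $$ (i, i)) z = herm (h z) (A z *\<^sub>v e) e"
proof -
  have hp: "hermitian_inner_product K (h z)" for z using h by (simp add: hermitian_metric_def)
  have hc: "h z \<in> carrier_mat K K" for z using hp by (simp add: hermitian_inner_product_def)
  have Ck: "Ck k (\<lambda>z. h z $$ (i, j))" if "i < K" "j < K" for i j k
    using h that unfolding hermitian_metric_def by blast
  have Ac: "A z \<in> carrier_mat K K" and A'0: "A' z = 0\<^sub>m K K" for z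
    using A by (auto simp: chern_connection_def)
  note entries = chern_connection_entries[OF hp A]
  interpret hermitian_form K "h z" by standard (rule hp)
  note ad = herm_adjoint[OF \<Phi>, folded \<Psi>]
  have ec: "e \<in> carrier_vec K" by (simp add: e_def)
  have Aec: "A z *\<^sub>v e \<in> carrier_vec K" and \<Psi>ec: "\<Psi> *\<^sub>v e \<in> carrier_vec K" and \<Phi>ec: "\<Phi> *\<^sub>v e \<in> carrier_vec K"
    using mult_mat_vec_carrier[OF _ ec] Ac \<Phi> ad(1) by blast+
  have hdiff: "(\<lambda>z. h z $$ (i, j)) differentiable (at w)" if "i < K" "j < K" for i j w
    by (rule Ck_2_differentiable(1)[OF Ck[OF that]])
  have Gdiff: "(\<lambda>z. (h z * A z) $$ (i, j)) differentiable (at w)" if ij: "i < K" "j < K" for i j w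
  proof -
    have "d_z (\<lambda>u. h u $$ (i, j)) differentiable (at w)"
      unfolding d_z_def[abs_def]
      by (intro differentiable_divide differentiable_diff differentiable_mult differentiable_const Ck_2_differentiable(2)[OF Ck[OF ij]]) simp
    thus ?thesis by (simp add: entries(1)[OF ij, abs_def] cong: if_cong)
  qed
  have Adiff: "(\<lambda>z. A z $$ (i, j)) differentiable (at w)" if "i < K" "j < K" for i j w
    by (rule differentiable_solution[OF hc hdiff Gdiff Ac hermitian_form.det_nonzero[OF hermitian_form.intro[OF hp]] that])
  define M where "M = \<Phi> * \<Psi> - \<Psi> * \<Phi>"
  have Mc: "M \<in> carrier_mat K K"
    unfolding M_def by (rule minus_carrier_mat[OF mult_carrier_mat[OF ad(1) \<Phi>]])
  have dA: "d_zbar (\<lambda>u. A u $$ (k, i)) z = M $$ (k, i)" if k: "k < K" for k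
  proof -
    have "(curvature K A A' z + M) $$ (k, i) = 0" unfolding M_def curv using k i by simp
    moreover have "(curvature K A A' z + M) $$ (k, i) = curvature K A A' z $$ (k, i) + M $$ (k, i)"
      using Mc k i by simp
    moreover have "curvature K A A' z $$ (k, i) = - d_zbar (\<lambda>u. A u $$ (k, i)) z"
      using k i Ac[of z] by (simp add: curvature_def A'0 d_z_def)
    ultimately show ?thesis by simp
  qed
  have fe: "d_z (\<lambda>u. h u $$ (i, i)) = (\<lambda>u. \<Sum>k<K. h u $$ (i, k) * A u $$ (k, i))"
    by (rule ext) (simp only: entries(1)[OF i i] mult_mat_eq_sum[OF hc Ac i i])
  have Ae: "(A z *\<^sub>v e) $ k = A z $$ (k, i)" if "k < K" for k
    unfolding e_def by (rule mult_unit_vec[OF Ac that i])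
  have Me: "(M *\<^sub>v e) $ k = M $$ (k, i)" if "k < K" for k
    unfolding e_def by (rule mult_unit_vec[OF Mc that i])
  have "d_zbar (d_z (\<lambda>u. h u $$ (i, i))) z
    = (\<Sum>k<K. d_zbar (\<lambda>u. h u $$ (i, k)) z * A z $$ (k, i) + h z $$ (i, k) * d_zbar (\<lambda>u. A u $$ (k, i)) z)"
    unfolding fe by (rule d_zbar_sum_mult) (auto intro: hdiff Adiff i)
  also have "\<dots> = (\<Sum>k<K. (A z *\<^sub>v e) $ k * ip (unit_vec K k) (A z *\<^sub>v e)) + (\<Sum>k<K. (M *\<^sub>v e) $ k * ip (unit_vec K k) e)"
    unfolding sum.distrib[symmetric]
    by (intro sum.cong refl) (simp add: entries(2)[OF i] Ae Me dA herm_unit_vec[OF hc i] e_def[symmetric] del: index_mult_mat_vec,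
         simp add: e_def herm_unit_vec[OF hc i])
  also have "\<dots> = ip (A z *\<^sub>v e) (A z *\<^sub>v e) + ip (M *\<^sub>v e) e"
    using Aec ec Mc by (simp only: ip_expand_left[symmetric] mult_mat_vec_carrier[OF Mc ec])
  also have "M *\<^sub>v e = \<Phi> *\<^sub>v (\<Psi> *\<^sub>v e) - \<Psi> *\<^sub>v (\<Phi> *\<^sub>v e)"
    unfolding M_def minus_mult_distrib_mat_vec[OF mult_carrier_mat[OF \<Phi> ad(1)] mult_carrier_mat[OF ad(1) \<Phi>] ec]
    by (simp only: assoc_mult_mat_vec[OF \<Phi> ad(1) ec] assoc_mult_mat_vec[OF ad(1) \<Phi> ec])
  also have "ip (\<Phi> *\<^sub>v (\<Psi> *\<^sub>v e) - \<Psi> *\<^sub>v (\<Phi> *\<^sub>v e)) e = ip (\<Phi> *\<^sub>v (\<Psi> *\<^sub>v e)) e - ip (\<Psi> *\<^sub>v (\<Phi> *\<^sub>v e)) e"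
    by (rule ip_diff_left[OF mult_mat_vec_carrier[OF \<Phi> \<Psi>ec] mult_mat_vec_carrier[OF ad(1) \<Phi>ec] ec])
  also have "ip (\<Phi> *\<^sub>v (\<Psi> *\<^sub>v e)) e = ip (\<Psi> *\<^sub>v e) (\<Psi> *\<^sub>v e)"
    by (rule ad(2)[OF \<Psi>ec ec])
  also have "ip (\<Psi> *\<^sub>v (\<Phi> *\<^sub>v e)) e = cnj (ip e (\<Psi> *\<^sub>v (\<Phi> *\<^sub>v e)))"
    by (rule ip_sym[OF ec mult_mat_vec_carrier[OF ad(1) \<Phi>ec]])
  also have "\<dots> = cnj (ip (\<Phi> *\<^sub>v e) (\<Phi> *\<^sub>v e))" by (simp only: ad(2)[OF ec \<Phi>ec])
  also have "\<dots> = ip (\<Phi> *\<^sub>v e) (\<Phi> *\<^sub>v e)" by (rule ip_sym[OF \<Phi>ec \<Phi>ec, symmetric])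
  finally show "d_zbar (d_z (\<lambda>u. h u $$ (i, i))) z
    = ip (A z *\<^sub>v e) (A z *\<^sub>v e) + ip (\<Psi> *\<^sub>v e) (\<Psi> *\<^sub>v e) - ip (\<Phi> *\<^sub>v e) (\<Phi> *\<^sub>v e)" by simp
  have "ip (A z *\<^sub>v e) e = herm (h z * A z) e e"
    unfolding herm_def assoc_mult_mat_vec[OF hc Ac ec] ..
  also have "\<dots> = (h z * A z) $$ (i, i)"
    unfolding e_def by (rule herm_unit_vec[OF mult_carrier_mat[OF hc Ac] i i])
  finally show "d_z (\<lambda>u. h u $$ (i, i)) z = ip (A z *\<^sub>v e) e" by (simp only: entries(1)[OF i i])
qed

section \<open>Canonical sections and the weights\<close>

lemma pole_order_le_0: "pole_order_le (\<lambda>z. 0) n"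
  unfolding pole_order_le_def by (intro exI[of _ "\<lambda>x. 0"]) auto

lemma pole_order_le_1: "pole_order_le (\<lambda>z. 1) 0"
  unfolding pole_order_le_def by (intro exI[of _ "\<lambda>x. 1"]) auto

lemma canonical_section_filt:
  assumes "i < K"
  shows "(\<lambda>z. unit_vec K i) \<in> direct_sum_filt K \<alpha> (- \<alpha> i)"
proof -
  have po: "\<exists>n. pole_order_le (\<lambda>z::complex. unit_vec K i $ j) n \<and> real_of_int n - \<alpha> j \<le> - \<alpha> i" if "j < K" for j
  proof (cases "j = i")
    case True
    thus ?thesis using pole_order_le_1 assms by (intro exI[of _ 0]) simp
  next
    case False
    \<comment> \<open>the zero function has every order, so any integer below the bound will do\<close>
    thus ?thesis using pole_order_le_0 assms that by (intro exI[of _ "\<lfloor>\<alpha> j - \<alpha> i\<rfloor>"]) (simp, linarith)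
  qed
  hence "\<exists>n. pole_order_le (\<lambda>z::complex. unit_vec K i $ j) n" if "j < K" for j using that by blast
  hence "(\<lambda>z. unit_vec K i) \<in> mero_sections K" by (simp add: mero_sections_def)
  thus ?thesis using po by (simp add: direct_sum_filt_def O_filt_def)
qed

text \<open>
  The matrix maps the partition to \<open>- \<alpha>\<close>: its rows sum to zero, so the partition can be replaced by the
  differences \<open>\<alpha> j - \<alpha> (nxt K j)\<close>, and summation by parts moves the differences to the row of the matrix, where they
  are \<open>1 / K\<close> except for a jump at the diagonal.
\<close>

lemma B_mat_weights:
  assumes K: "K > 0" and w: "filtration_weights K N b \<alpha>"
  shows "(euclid_norm (B_mat K *\<^sub>v Matrix.vec K (\<lambda>i. real (b i))))\<^sup>2 = (\<Sum>i<K. (\<alpha> i)\<^sup>2)"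
proof -
  let ?v = "B_mat K *\<^sub>v Matrix.vec K (\<lambda>i. real (b i))"
  have wd: "i < K \<Longrightarrow> real (b i) = real N / real K + (\<alpha> i - \<alpha> (nxt K i))" and ws: "(\<Sum>i<K. \<alpha> i) = 0" for i
    using w unfolding filtration_weights_def nxt_def by (force simp: algebra_simps)+
  have dv: "dim_vec ?v = K" by (simp add: B_mat_def)
  have Bc: "B_mat K \<in> carrier_mat K K" by (simp add: B_mat_def)
  have v: "?v $ i = - \<alpha> i" if i: "i < K" for i
  proof -
    define m where "m j = real_of_int ((int j - int i) mod int K)" for j
    define \<beta> where "\<beta> j = (- (real K - 1) + 2 * m j) / (2 * real K)" for j
    \<comment> \<open>a step along the cycle raises the residue by one, except the step into \<open>i\<close>, which resets it to zero\<close>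
    have mnxt: "m (nxt K j) = m j + 1 - (if nxt K j = i then real K else 0)" if j: "j < K" for j
    proof -
      have "(int (nxt K j) - int i) mod int K = (int j - int i + 1) mod int K"
        by (simp add: nxt_def of_nat_mod mod_diff_left_eq algebra_simps)
      also have "\<dots> = ((int j - int i) mod int K + 1) mod int K" by (simp add: mod_add_left_eq)
      finally have a: "(int (nxt K j) - int i) mod int K = ((int j - int i) mod int K + 1) mod int K" .
      have r: "0 \<le> (int j - int i) mod int K" "(int j - int i) mod int K < int K" using K by auto
      show ?thesis
      proof (cases "(int j - int i) mod int K + 1 = int K")
        case True
        hence "(int (nxt K j) - int i) mod int K = 0" unfolding a by simp
        hence "nxt K j = i" using nxt_less[OF K, of j] i
          by (metis K int_ops(1) mod_eq_dvd_iff mod_less of_nat_eq_iff of_nat_mod mod_0 cancel_comm_monoid_add_class.diff_cancel zmod_int dvd_eq_mod_eq_0)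
        moreover have "m j = real K - 1" using True unfolding m_def by linarith
        ultimately show ?thesis by (simp add: m_def)
      next
        case False
        hence e: "(int (nxt K j) - int i) mod int K = (int j - int i) mod int K + 1"
          unfolding a using r by (intro mod_pos_pos_trivial) auto
        hence "nxt K j \<noteq> i" using r by auto
        thus ?thesis unfolding m_def e by simp
      qed
    qed
    have "?v $ i = (\<Sum>j<K. B_mat K $$ (i, j) * Matrix.vec K (\<lambda>i. real (b i)) $ j)"
      by (rule mult_mat_vec_eq_sum[OF Bc _ i]) simp
    also have "\<dots> = (\<Sum>j<K. \<beta> j * (real N / real K + (\<alpha> j - \<alpha> (nxt K j))))"
      using i by (intro sum.cong refl) (simp add: B_mat_def \<beta>_def m_def wd)
    also have "\<dots> = real N / real K * (\<Sum>j<K. \<beta> j) + (\<Sum>j<K. \<beta> j * (\<alpha> j - \<alpha> (nxt K j)))"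
      by (simp add: distrib_left sum.distrib sum_distrib_left sum_divide_distrib mult.commute)
    finally have e1: "?v $ i = real N / real K * (\<Sum>j<K. \<beta> j) + (\<Sum>j<K. \<beta> j * (\<alpha> j - \<alpha> (nxt K j)))" .
    have mi: "m i = 0" by (simp add: m_def)
    \<comment> \<open>telescoping the squares around the cycle computes the sum of the residues\<close>
    have "0 = (\<Sum>j<K. (m (nxt K j))\<^sup>2 - (m j)\<^sup>2)"
      by (simp add: sum_subtractf sum_nxt[of "\<lambda>j. (m j)\<^sup>2"])
    also have "\<dots> = (\<Sum>j<K. 2 * m j + 1 - (if nxt K j = i then (real K)\<^sup>2 else 0))"
    proof (intro sum.cong refl)
      fix j assume "j \<in> {..<K}"
      hence j: "j < K" by simp
      show "(m (nxt K j))\<^sup>2 - (m j)\<^sup>2 = 2 * m j + 1 - (if nxt K j = i then (real K)\<^sup>2 else 0)"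
      proof (cases "nxt K j = i")
        case True
        hence "real K = m j + 1" using mnxt[OF j] mi by simp
        thus ?thesis using True mi by (simp add: power2_eq_square algebra_simps)
      next
        case False
        thus ?thesis using mnxt[OF j] by (simp add: power2_eq_square algebra_simps)
      qed
    qed
    also have "\<dots> = 2 * (\<Sum>j<K. m j) + real K - (\<Sum>j<K. if nxt K j = i then (real K)\<^sup>2 else 0)"
      by (simp add: sum_subtractf sum.distrib sum_distrib_left)
    also have "(\<Sum>j<K. if nxt K j = i then (real K)\<^sup>2 else 0) = (real K)\<^sup>2"
      using sum_nxt[of "\<lambda>j. if j = i then (real K)\<^sup>2 else 0" K] i by simp
    finally have summ: "2 * (\<Sum>j<K. m j) = real K * (real K - 1)" by (simp add: power2_eq_square algebra_simps)
    have "(\<Sum>j<K. \<beta> j) = (2 * (\<Sum>j<K. m j) - real K * (real K - 1)) / (2 * real K)"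
    proof -
      have "(\<Sum>j<K. - (real K - 1) + 2 * m j) = 2 * (\<Sum>j<K. m j) - real K * (real K - 1)"
        unfolding sum.distrib sum_distrib_left[symmetric] by (simp add: algebra_simps)
      thus ?thesis unfolding \<beta>_def sum_divide_distrib[symmetric] by (simp only:)
    qed
    hence sum\<beta>: "(\<Sum>j<K. \<beta> j) = 0" by (simp add: summ)
    have "(\<Sum>j<K. \<beta> j * (\<alpha> j - \<alpha> (nxt K j))) = (\<Sum>j<K. \<alpha> j * (\<beta> j - \<beta> (prv K j)))"
      by (rule cyclic_summation_by_parts[symmetric])
    also have "\<dots> = (\<Sum>j<K. \<alpha> j / real K - (if j = i then \<alpha> j else 0))"
    proof (intro sum.cong refl)
      fix j assume "j \<in> {..<K}"
      hence j: "j < K" by simp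
      have "m j - m (prv K j) = 1 - (if j = i then real K else 0)"
        using mnxt[OF prv_less[OF K, of j]] unfolding nxt_prv[OF j] by simp
      moreover have "\<beta> j - \<beta> (prv K j) = (m j - m (prv K j)) / real K"
        using K by (simp add: \<beta>_def field_simps)
      ultimately have e: "\<beta> j - \<beta> (prv K j) = (1 - (if j = i then real K else 0)) / real K" by (simp only:)
      show "\<alpha> j * (\<beta> j - \<beta> (prv K j)) = \<alpha> j / real K - (if j = i then \<alpha> j else 0)"
        unfolding e using K by (simp add: field_simps)
    qed
    also have "\<dots> = (\<Sum>j<K. \<alpha> j) / real K - \<alpha> i"
      using i by (simp add: sum_subtractf sum_divide_distrib)
    finally show ?thesis unfolding e1 sum\<beta> ws by simp
  qed
  have "(euclid_norm ?v)\<^sup>2 = (\<Sum>i<K. (?v $ i)\<^sup>2)"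
    unfolding euclid_norm_def dv L2_set_def by (simp add: sum_nonneg)
  also have "\<dots> = (\<Sum>i<K. (\<alpha> i)\<^sup>2)" using v by (intro sum.cong refl) simp
  finally show ?thesis .
qed

section \<open>Harmonic metrics on the cyclic Higgs bundle\<close>

locale cyclic_harmonic_metric =
  fixes K N :: nat and b :: "nat \<Rightarrow> nat" and \<alpha> :: "nat \<Rightarrow> real"
    and h A A' :: "complex \<Rightarrow> complex mat"
  assumes K: "K > 0" and weights: "filtration_weights K N b \<alpha>"
    and metric: "hermitian_metric K h" and adapted: "adapted K (direct_sum_filt K \<alpha>) h"
    and chern: "chern_connection K h A A'"
    and hitchin: "\<And>z. let \<Phi> = fh_higgs (higgs_bundle K b \<alpha>) z; \<Psi> = herm_adjoint K (h z) \<Phi>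
      in curvature K A A' z + (\<Phi> * \<Psi> - \<Psi> * \<Phi>) = 0\<^sub>m K K"
begin

text \<open>
  \<open>f i\<close> is the squared norm of the frame vector \<open>i\<close>, \<open>X i\<close> the normalized squared norm of its image under the
  adjoint of the Higgs field, and \<open>D\<close>, \<open>DD\<close> are the directional derivatives of \<open>u i = ln (f i)\<close>.
\<close>

definition "\<Phi> z = fh_higgs (higgs_bundle K b \<alpha>) z"
definition "\<Psi> z = herm_adjoint K (h z) (\<Phi> z)"
abbreviation "e i \<equiv> unit_vec K i"
definition "f i z = h z $$ (i, i)"
definition "u i z = ln (Re (f i z))"
definition "D d i z = Re (dderiv d (f i) z) / Re (f i z)"
definition "DD d i z = Re (dderiv d (dderiv d (f i)) z) / Re (f i z) - (D d i z)\<^sup>2"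
definition "lap i z = DD 1 i z + DD \<i> i z"
definition "X i z = Re (herm (h z) (\<Psi> z *\<^sub>v e i) (\<Psi> z *\<^sub>v e i)) / Re (f i z)"

abbreviation "w \<equiv> toda_term K b u"

lemmas nxt_less_K [simp] = nxt_less[OF K] and prv_less_K [simp] = prv_less[OF K]

lemma form: "hermitian_form K (h z)"
  using metric by (simp add: hermitian_form_def hermitian_metric_def)

lemma \<Phi>_carrier: "\<Phi> z \<in> carrier_mat K K" by (simp add: \<Phi>_def higgs_bundle_def)

lemma \<Psi>_carrier: "\<Psi> z \<in> carrier_mat K K"
  unfolding \<Psi>_def by (rule hermitian_form.herm_adjoint(1)[OF form \<Phi>_carrier])

lemma h_carrier: "h z \<in> carrier_mat K K"
  by (rule hermitian_form.H_carrier[OF form])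

lemma e_ne_0: "i < K \<Longrightarrow> e i \<noteq> 0\<^sub>v K" by (rule unit_vec_nonzero)

lemma f_eq: "i < K \<Longrightarrow> f i z = herm (h z) (e i) (e i)"
  unfolding f_def by (rule herm_unit_vec[OF h_carrier, symmetric])

lemma f_pos: "i < K \<Longrightarrow> Re (f i z) > 0"
  unfolding f_eq by (rule hermitian_form.ip_pos[OF form unit_vec_carrier e_ne_0])

lemma f_real: "i < K \<Longrightarrow> f i z = of_real (Re (f i z))"
  unfolding f_eq by (rule hermitian_form.ip_self_real[OF form unit_vec_carrier])

lemma Im_f: "i < K \<Longrightarrow> Im (f i z) = 0"
  using f_real[of i z] by (metis Im_complex_of_real)

lemma Ck_f: "i < K \<Longrightarrow> Ck k (f i)"
  using metric unfolding hermitian_metric_def f_def[abs_def] by blast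

lemma twice_diff_u: "i < K \<Longrightarrow> twice_diff d UNIV (u i) (D d i) (DD d i)"
  unfolding u_def[abs_def] D_def[abs_def] DD_def[abs_def]
  by (rule twice_diff_ln[OF Ck_2_twice_diff[OF Ck_f] f_pos])

lemma lap_eq:
  assumes i: "i < K" and c: "norm c = 1"
  shows "DD c i z + DD (c * \<i>) i z = 4 * Re (d_zbar (d_z (f i)) z) / Re (f i z) - 4 * (norm (d_z (f i) z))\<^sup>2 / (Re (f i z))\<^sup>2"
proof -
  note rot = laplacian_rotation[OF Ck_f[OF i] c, of z]
  have "DD c i z + DD (c * \<i>) i z = Re (dderiv c (dderiv c (f i)) z + dderiv (c * \<i>) (dderiv (c * \<i>) (f i)) z) / Re (f i z)
     - ((Re (dderiv c (f i) z))\<^sup>2 + (Re (dderiv (c * \<i>) (f i) z))\<^sup>2) / (Re (f i z))\<^sup>2"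
    by (simp add: DD_def D_def power_divide add_divide_distrib)
  also have "\<dots> = 4 * Re (d_zbar (d_z (f i)) z) / Re (f i z) - 4 * (norm (d_z (f i) z))\<^sup>2 / (Re (f i z))\<^sup>2"
    unfolding rot norm_d_z_real[OF Ck_2_differentiable(1)[OF Ck_f[OF i]] Im_f[OF i]]
    using Re_d_zbar_d_z_real[OF Ck_f[OF i] Im_f[OF i], of z] by simp
  finally show ?thesis .
qed

lemma \<Phi>_unit:
  assumes i: "i < K"
  shows "\<Phi> z *\<^sub>v e i = z ^ b (prv K i) \<cdot>\<^sub>v e (prv K i)"
proof (rule eq_vecI)
  fix r assume "r < dim_vec (z ^ b (prv K i) \<cdot>\<^sub>v e (prv K i))"
  hence r: "r < K" by simp
  have "(\<Phi> z *\<^sub>v e i) $ r = (if i = nxt K r then z ^ b r else 0)"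
    unfolding mult_unit_vec[OF \<Phi>_carrier r i] using r i by (simp add: \<Phi>_def higgs_bundle_def nxt_def)
  moreover have "i = nxt K r \<longleftrightarrow> r = prv K i" using prv_nxt[OF r] nxt_prv[OF i] by auto
  ultimately show "(\<Phi> z *\<^sub>v e i) $ r = (z ^ b (prv K i) \<cdot>\<^sub>v e (prv K i)) $ r"
    using r by (simp add: unit_vec_def del: index_mult_mat_vec)
qed (use \<Phi>_carrier[of z] in simp)

lemma toda_term_eq:
  assumes "i < K"
  shows "w i z = norm z ^ (2 * b i) * Re (f i z) / Re (f (nxt K i) z)"
  using f_pos[OF assms, of z] f_pos[of "nxt K i" z] by (simp add: toda_term_def u_def exp_diff)

lemma norm_\<Phi>_unit:
  assumes i: "i < K"
  shows "Re (herm (h z) (\<Phi> z *\<^sub>v e i) (\<Phi> z *\<^sub>v e i)) / Re (f i z) = w (prv K i) z"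
proof -
  interpret hermitian_form K "h z" by (rule form)
  let ?p = "prv K i"
  have "ip (\<Phi> z *\<^sub>v e i) (\<Phi> z *\<^sub>v e i) = z ^ b ?p * cnj (z ^ b ?p) * f ?p z"
    unfolding \<Phi>_unit[OF i] f_eq[OF prv_less_K] by (simp add: ip_smult_left ip_smult_right del: complex_cnj_power)
  also have "\<dots> = of_real (norm z ^ (2 * b ?p) * Re (f ?p z))"
    by (subst f_real[OF prv_less_K]) (simp add: complex_norm_square[symmetric] norm_power power_mult[symmetric] mult.commute del: complex_cnj_power)
  finally show ?thesis using i by (simp add: toda_term_eq nxt_prv)
qed

lemma adjoint_entry:
  assumes i: "i < K"
  shows "herm (h z) (\<Psi> z *\<^sub>v e i) (e (nxt K i)) = cnj (z ^ b i) * f i z"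
proof -
  interpret hermitian_form K "h z" by (rule form)
  let ?n = "nxt K i"
  have \<Psi>e: "\<Psi> z *\<^sub>v e i \<in> carrier_vec K" by (rule mult_mat_vec_carrier[OF \<Psi>_carrier unit_vec_carrier])
  have "ip (\<Psi> z *\<^sub>v e i) (e ?n) = cnj (ip (e ?n) (\<Psi> z *\<^sub>v e i))" by (rule ip_sym[OF unit_vec_carrier \<Psi>e])
  also have "ip (e ?n) (\<Psi> z *\<^sub>v e i) = ip (\<Phi> z *\<^sub>v e ?n) (e i)"
    unfolding \<Psi>_def by (rule herm_adjoint(2)[OF \<Phi>_carrier, symmetric]) simp_all
  also have "\<dots> = z ^ b i * f i z"
    unfolding \<Phi>_unit[OF nxt_less_K] prv_nxt[OF i] f_eq[OF i] by (simp add: ip_smult_left)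
  also have "cnj (z ^ b i * f i z) = cnj (z ^ b i) * f i z" using Im_f[OF i, of z] by (simp add: complex_eq_iff)
  finally show ?thesis .
qed

text \<open>
  Cauchy-Schwarz for the image of \<open>e i\<close> under the adjoint and the next frame vector. Equality means
  that they are parallel, and then the diagonal entry of \<open>\<Phi> * \<Psi>\<close> is determined.
\<close>

lemma X_ge:
  assumes i: "i < K"
  shows "X i z \<ge> w i z"
    and "X i z = w i z \<Longrightarrow> (\<Phi> z * \<Psi> z) $$ (i, i) = of_real (w i z)"
proof -
  interpret hermitian_form K "h z" by (rule form)
  let ?n = "nxt K i"
  note pos = f_pos[OF i, of z] f_pos[OF nxt_less_K, of i z]
  have \<Psi>e: "\<Psi> z *\<^sub>v e i \<in> carrier_vec K" by (rule mult_mat_vec_carrier[OF \<Psi>_carrier unit_vec_carrier])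
  note CS = Cauchy_Schwarz[OF \<Psi>e unit_vec_carrier e_ne_0[OF nxt_less_K], of i]
  have X: "Re (ip (\<Psi> z *\<^sub>v e i) (\<Psi> z *\<^sub>v e i)) = X i z * Re (f i z)" using pos by (simp add: X_def)
  have nn: "(norm (cnj (z ^ b i) * f i z))\<^sup>2 = norm z ^ (2 * b i) * (Re (f i z))\<^sup>2"
    by (subst f_real[OF i]) (simp add: norm_mult norm_power power_mult_distrib power_mult[symmetric] mult.commute)
  have W: "norm z ^ (2 * b i) * (Re (f i z))\<^sup>2 = w i z * Re (f i z) * Re (f ?n z)"
    using pos by (simp add: toda_term_eq[OF i] power2_eq_square)
  have "w i z * Re (f i z) * Re (f ?n z) \<le> X i z * Re (f i z) * Re (f ?n z)"
    using CS(1) unfolding adjoint_entry[OF i] nn X W f_eq[OF nxt_less_K] .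
  thus "X i z \<ge> w i z" using pos by simp
  assume "X i z = w i z"
  hence "(norm (ip (\<Psi> z *\<^sub>v e i) (e ?n)))\<^sup>2 = Re (ip (\<Psi> z *\<^sub>v e i) (\<Psi> z *\<^sub>v e i)) * Re (ip (e ?n) (e ?n))"
    unfolding adjoint_entry[OF i] nn X W f_eq[OF nxt_less_K] by simp
  from CS(2)[OF this] have "\<Psi> z *\<^sub>v e i = (cnj (z ^ b i) * f i z / f ?n z) \<cdot>\<^sub>v e ?n"
    unfolding adjoint_entry[OF i] f_eq[OF nxt_less_K] .
  hence "(\<Psi> z *\<^sub>v e i) $ k = ((cnj (z ^ b i) * f i z / f ?n z) \<cdot>\<^sub>v e ?n) $ k" for k by simp
  hence \<Psi>_entry: "\<Psi> z $$ (k, i) = (if k = ?n then cnj (z ^ b i) * f i z / f ?n z else 0)" if "k < K" for k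
    using that unfolding mult_unit_vec[OF \<Psi>_carrier that i, symmetric] by (simp add: unit_vec_def)
  have "(\<Phi> z * \<Psi> z) $$ (i, i) = (\<Sum>k<K. \<Phi> z $$ (i, k) * \<Psi> z $$ (k, i))"
    by (rule mult_mat_eq_sum[OF \<Phi>_carrier \<Psi>_carrier i i])
  also have "\<dots> = (\<Sum>k<K. if k = ?n then z ^ b i * (cnj (z ^ b i) * f i z / f ?n z) else 0)"
    using i by (intro sum.cong refl) (auto simp: \<Psi>_entry \<Phi>_def higgs_bundle_def nxt_def)
  also have "\<dots> = z ^ b i * cnj (z ^ b i) * f i z / f ?n z" by simp
  also have "\<dots> = of_real (w i z)"
    unfolding toda_term_eq[OF i]
    by (subst f_real[OF i], subst f_real[OF nxt_less_K])
       (simp add: complex_norm_square[symmetric] norm_power power_mult[symmetric] mult.commute del: complex_cnj_power)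
  finally show "(\<Phi> z * \<Psi> z) $$ (i, i) = of_real (w i z)" .
qed

text \<open>
  Curvature decreases in subbundles: by Cauchy-Schwarz, the term \<open>h(A e, A e)\<close> in the curvature formula outweighs
  the square of the first derivative that the logarithm in \<open>u i\<close> contributes.
\<close>

lemma lap_ge:
  assumes i: "i < K"
  shows "lap i z \<ge> 4 * (X i z - w (prv K i) z)"
proof -
  interpret hermitian_form K "h z" by (rule form)
  note pos = f_pos[OF i, of z]
  have hit: "curvature K A A' z + (\<Phi> z * \<Psi> z - \<Psi> z * \<Phi> z) = 0\<^sub>m K K"
    using hitchin[of z] by (simp add: Let_def \<Phi>_def \<Psi>_def)
  have cd: "d_zbar (d_z (f i)) z
      = ip (A z *\<^sub>v e i) (A z *\<^sub>v e i) + ip (\<Psi> z *\<^sub>v e i) (\<Psi> z *\<^sub>v e i) - ip (\<Phi> z *\<^sub>v e i) (\<Phi> z *\<^sub>v e i)"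
    "d_z (f i) z = ip (A z *\<^sub>v e i) (e i)"
    unfolding f_def[abs_def]
    by (rule curvature_diagonal[OF metric chern \<Phi>_carrier \<Psi>_def hit i])+
  have "A z *\<^sub>v e i \<in> carrier_vec K"
    using chern by (intro mult_mat_vec_carrier[OF _ unit_vec_carrier]) (auto simp: chern_connection_def)
  from Cauchy_Schwarz(1)[OF this unit_vec_carrier e_ne_0[OF i]]
  have CS: "(norm (d_z (f i) z))\<^sup>2 \<le> Re (ip (A z *\<^sub>v e i) (A z *\<^sub>v e i)) * Re (f i z)"
    unfolding cd(2) f_eq[OF i] .
  hence CS': "(norm (d_z (f i) z))\<^sup>2 / (Re (f i z))\<^sup>2 \<le> Re (ip (A z *\<^sub>v e i) (A z *\<^sub>v e i)) / Re (f i z)"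
    using pos by (simp add: field_simps power2_eq_square)
  have "lap i z = 4 * Re (d_zbar (d_z (f i)) z) / Re (f i z) - 4 * (norm (d_z (f i) z))\<^sup>2 / (Re (f i z))\<^sup>2"
    unfolding lap_def using lap_eq[OF i, of 1 z] by simp
  also have "\<dots> = 4 * (Re (ip (A z *\<^sub>v e i) (A z *\<^sub>v e i)) / Re (f i z) - (norm (d_z (f i) z))\<^sup>2 / (Re (f i z))\<^sup>2)
      + 4 * (X i z - w (prv K i) z)"
    unfolding norm_\<Phi>_unit[OF i, symmetric] X_def cd(1) by (simp add: add_divide_distrib diff_divide_distrib algebra_simps)
  finally have "lap i z = 4 * (Re (ip (A z *\<^sub>v e i) (A z *\<^sub>v e i)) / Re (f i z) - (norm (d_z (f i) z))\<^sup>2 / (Re (f i z))\<^sup>2)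
      + 4 * (X i z - w (prv K i) z)" .
  thus ?thesis using CS' by argo
qed

text \<open>
  The canonical section \<open>e i\<close> has order at most \<open>- \<alpha> i\<close> in the filtration, so adaptedness bounds its norm.
\<close>

lemma growth:
  assumes i: "i < K" and \<epsilon>: "\<epsilon> > 0"
  shows "\<exists>R C. \<forall>z. norm z \<ge> R \<longrightarrow> u i z \<le> (\<epsilon> - 2 * \<alpha> i) * ln (norm z) + C"
proof -
  have "(\<lambda>z. e i) \<in> direct_sum_filt K \<alpha> (- \<alpha> i)" by (rule canonical_section_filt[OF i])
  hence "(\<lambda>z. herm_norm (h z) (e i)) \<in> O[at_infinity](\<lambda>z::complex. norm (inverse z) powr (- (- \<alpha> i + \<epsilon> / 2)))"
    using adapted \<epsilon> unfolding adapted_def by (auto dest!: spec[of _ "- \<alpha> i"] spec[of _ "\<epsilon> / 2"])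
  then obtain c where c: "c > 0"
    "\<forall>\<^sub>F z in at_infinity. norm (herm_norm (h z) (e i)) \<le> c * norm (norm (inverse z :: complex) powr (- (- \<alpha> i + \<epsilon> / 2)))"
    by (auto elim!: landau_o.bigE)
  then obtain R where R: "\<And>z. norm z \<ge> R \<Longrightarrow> norm (herm_norm (h z) (e i)) \<le> c * norm (norm (inverse z :: complex) powr (- (- \<alpha> i + \<epsilon> / 2)))"
    unfolding eventually_at_infinity by blast
  have "u i z \<le> (\<epsilon> - 2 * \<alpha> i) * ln (norm z) + 2 * ln c" if z: "norm z \<ge> max R 1" for z
  proof -
    have z0: "norm z > 0" using z by linarith
    have hn: "herm_norm (h z) (e i) = sqrt (Re (f i z))" by (simp add: herm_norm_def f_eq[OF i])
    have "sqrt (Re (f i z)) \<le> c * (norm (inverse z) powr (- (- \<alpha> i + \<epsilon> / 2)))"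
      using R[of z] z f_pos[OF i, of z] unfolding hn by simp
    hence "ln (sqrt (Re (f i z))) \<le> ln (c * (norm (inverse z) powr (- (- \<alpha> i + \<epsilon> / 2))))"
      using f_pos[OF i, of z] c(1) z0 by (subst ln_le_cancel_iff) auto
    also have "\<dots> = ln c + (\<epsilon> / 2 - \<alpha> i) * ln (norm z)"
      using c(1) z0 by (simp add: ln_mult ln_powr norm_inverse ln_inverse algebra_simps)
    also have "ln (sqrt (Re (f i z))) = u i z / 2"
      using f_pos[OF i, of z] by (simp add: u_def ln_sqrt)
    finally show ?thesis by (simp add: algebra_simps)
  qed
  thus ?thesis by blast
qed

sublocale toda: cyclic_toda_subsolution K N b \<alpha> u D DD lap
proof
  fix c :: complex and i z assume "i < K" "norm c = 1"
  thus "DD c i z + DD (c * \<i>) i z = lap i z"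
    unfolding lap_def using lap_eq[of i c z] lap_eq[of i 1 z] by simp
next
  fix i z assume "i < K"
  thus "4 * (w i z - w (prv K i) z) \<le> lap i z"
    using lap_ge[of i z] X_ge(1)[of i z] by argo
qed (use K weights twice_diff_u growth in auto)

text \<open>
  The Toda equation leaves no room between \<open>X i\<close> and the Toda term, so equality holds in Cauchy-Schwarz.
\<close>

lemma higgs_trace:
  assumes "i < K"
  shows "(\<Phi> z * \<Psi> z) $$ (i, i) = of_real (w i z)"
proof (rule X_ge(2)[OF assms])
  show "X i z = w i z"
    using lap_ge[OF assms, of z] X_ge(1)[OF assms, of z] toda.toda_equation[OF assms, of z] by argo
qed

lemma regulated_density_eq:
  "regulated_density N (higgs_bundle K b \<alpha>) h z
    = of_real ((\<Sum>i<K. w i z) - real K * norm z powr (2 * real N / real K))"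
proof -
  let ?r = "complex_of_real (norm z powr (2 * real N / real K))"
  let ?M = "\<Phi> z * \<Psi> z - ?r \<cdot>\<^sub>m 1\<^sub>m K"
  have rank: "fh_rank (higgs_bundle K b \<alpha>) = K" by (simp add: higgs_bundle_def)
  have "regulated_density N (higgs_bundle K b \<alpha>) h z = mat_trace ?M"
    by (simp add: regulated_density_def rank \<Phi>_def \<Psi>_def)
  also have "\<dots> = (\<Sum>i<K. ?M $$ (i, i))" by (simp add: mat_trace_def)
  also have "\<dots> = (\<Sum>i<K. of_real (w i z) - ?r)"
    by (intro sum.cong refl) (simp add: higgs_trace[symmetric] del: index_mult_mat)
  finally show ?thesis by (simp add: sum_subtractf)
qed

end

theorem proposition4p1:
  fixes K N :: nat and b :: "nat \<Rightarrow> nat" and \<alpha> :: "nat \<Rightarrow> real"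
    and h :: "complex \<Rightarrow> complex mat"
  assumes "K \<ge> 2" and "N \<ge> 1" and "coprime K N"
    and "ordered_partition K N b"
    and "filtration_weights K N b \<alpha>"
    and "harmonic_metric (higgs_bundle K b \<alpha>) h"
  shows "integrable lborel (regulated_density N (higgs_bundle K b \<alpha>) h) \<and>
    regulated_L2_norm N (higgs_bundle K b \<alpha>) h =
      complex_of_real (real K / real (K + N) *
        (euclid_norm (B_mat K *\<^sub>v Matrix.vec K (\<lambda>i. real (b i))))\<^sup>2)"
proof -
  have fields: "fh_rank (higgs_bundle K b \<alpha>) = K" "fh_filt (higgs_bundle K b \<alpha>) = direct_sum_filt K \<alpha>"
    by (simp_all add: higgs_bundle_def)
  from assms(6) obtain A A' where "hermitian_metric K h" "adapted K (direct_sum_filt K \<alpha>) h"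
    "chern_connection K h A A'"
    "\<And>z. let \<Phi> = fh_higgs (higgs_bundle K b \<alpha>) z; \<Psi> = herm_adjoint K (h z) \<Phi>
      in curvature K A A' z + (\<Phi> * \<Psi> - \<Psi> * \<Phi>) = 0\<^sub>m K K"
    unfolding harmonic_metric_def fields by blast
  then interpret cyclic_harmonic_metric K N b \<alpha> h A A'
    using assms by unfold_locales auto
  have K: "K > 0" using assms(1) by simp
  note I = toda.integral_regulated
  let ?S = "\<Sum>i<K. (\<alpha> i)\<^sup>2"
  have "integrable lborel (regulated_density N (higgs_bundle K b \<alpha>) h)"
    unfolding regulated_density_eq[abs_def] by (intro integrable_of_real I(1))
  moreover have "regulated_L2_norm N (higgs_bundle K b \<alpha>) h = of_real (real K / real (K + N) * ?S)"
  proof -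
    define x where "x = pi * real K / (2 * real (K + N)) * ?S"
    have "(LINT z|lborel. regulated_density N (higgs_bundle K b \<alpha>) h z) = of_real x"
      unfolding regulated_density_eq integral_complex_of_real I(2) x_def ..
    hence "regulated_L2_norm N (higgs_bundle K b \<alpha>) h = \<i> / of_real pi * ((- 2 * \<i>) * of_real x)"
      unfolding regulated_L2_norm_def by (simp only:)
    also have "\<dots> = of_real (2 / pi * x)" by (simp add: complex_eq_iff)
    also have "2 / pi * x = real K / real (K + N) * ?S"
      by (simp add: x_def del: of_nat_add)
    finally show ?thesis .
  qed
  ultimately show ?thesis
    using B_mat_weights[OF K assms(5)] by simp
qed

end
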